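(* Let $\rho : E \to Q$ be a bad orbifold vector bundle over a smooth (not necessarily reduced) orbifold $Q$. Then there exist an orbifold $R$ of which $Q$ is a suborbifold and a good orbifold vector bundle $\hat{\rho} : \hat{E} \to R$ such that $E$ is isomorphic, as an orbifold vector bundle over $Q$, to the restriction $\hat{E}_{|Q}$ of $\hat{E}$ to $Q$.
   Context: Orbifolds. A (smooth) orbifold $Q$ is a Hausdorff space covered by compatible orbifold charts $\{V,G,\pi\}$: $V$ is a connected smooth manifold, $G$ is a finite group acting smoothly on $V$ (not necessarily effectively), and $\pi: V\to U$ induces a homeomorphism $V/G\cong U$ onto an open set $U\subseteq Q$. Charts are related by injections $i:\{V_1,G_1,\pi_1\}\to\{V_2,G_2,\pi_2\}$ consisting of a smooth open embedding $\phi:V_1\to V_2$ with $\pi_2\circ\phi=\pi_1$ and an injective homomorphism $\lambda:G_1\to G_2$ for which $\phi$ is equivariant and which restricts to an isomorphism from the kernel of the $G_1$-action onto the kernel of the $G_2$-action. $Q$ is reduced if every local group acts effectively. Orbifold vector bundles. A rank $k$ orbifold vector bundle $\rho:E\to Q$ is given over a compatible cover of $Q$ by charts $\{V\times\mathbb{R}^k,G,\tilde\pi\}$ lying over charts $\{V,G,\pi\}$ of $Q$, where the same group $G$ acts on $V\times\mathbb{R}^k$ linearly on fibers and covering its action on $V$; each injection $i=(\phi,\lambda)$ of charts of $Q$ has a smooth transition map $g_i:V_1\to \mathrm{Aut}(\mathbb{R}^k)$ satisfying the cocycle condition, and the injection of charts of $E$ is $(x,v)\mapsto(\phi(x),g_i(x)v)$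 with homomorphism $\lambda$. The total space $E$ is thereby an orbifold. Two bundles over $Q$ are isomorphic if they are related by compatible $G$-equivariant fiberwise linear isomorphisms in charts covering the identity. Good and bad. $E$ is good if it is covered by charts $\{V\times\mathbb{R}^k,G,\tilde\pi\}$ over charts $\{V,G,\pi\}$ of $Q$ such that the kernel of the $G$-action on $V\times\mathbb{R}^k$ coincides with the kernel of the $G$-action on $V$. It is bad if it is not good. Suborbifold and restriction. $Q$ is a suborbifold of $R$ if $Q$ is embedded in $R$ so that, around each point of $Q$, there is a chart $\{W,G,\pi\}$ of $R$ and a $G$-invariant embedded submanifold $V\subseteq W$ such that $\{V,G,\pi_{|V}\}$ is a chart of $Q$ (same group $G$, which need not act effectively on $V$), compatibly with injections. The restriction $\hat E_{|Q}$ is obtained by restricting charts $W\times\mathbb{R}^k$ to $V\times\mathbb{R}^k$, with the same groups and restricted transition maps. *)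

theory Defs
  imports "HOL-Analysis.Analysis" "HOL-Algebra.Group_Action"
begin

section \<open>Smooth manifolds\<close>

text \<open>
  Manifolds are modelled on a type \<open>'m\<close> of sort \<open>{real_normed_vector, heine_borel}\<close>, that is
  (by Riesz) on an arbitrary finite-dimensional real normed space. Unlike \<open>euclidean_space\<close>, this
  sort admits the zero space, so that zero-dimensional manifolds are not excluded.
\<close>

text \<open>\<open>C\<^sup>n\<close> maps; the set \<open>S\<close> is meant to be open.\<close>

primrec higher_differentiable_on ::
  "nat \<Rightarrow> 'a::real_normed_vector set \<Rightarrow> ('a \<Rightarrow> 'b::real_normed_vector) \<Rightarrow> bool" where
  "higher_differentiable_on 0 S f \<longleftrightarrow> continuous_on S f"
| "higher_differentiable_on (Suc n) S f \<longleftrightarrow>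
     (\<forall>x\<in>S. f differentiable (at x)) \<and>
     (\<forall>v. higher_differentiable_on n S (\<lambda>x. frechet_derivative f (at x) v))"

definition smooth_on ::
  "'a::real_normed_vector set \<Rightarrow> ('a \<Rightarrow> 'b::real_normed_vector) \<Rightarrow> bool" where
  "smooth_on S f \<longleftrightarrow> (\<forall>n. higher_differentiable_on n S f)"

record ('v, 'm) manifold =
  mtop :: "'v topology"
  matlas :: "('v set \<times> ('v \<Rightarrow> 'm)) set"

abbreviation points :: "('v, 'm) manifold \<Rightarrow> 'v set" where
  "points M \<equiv> topspace (mtop M)"

definition smooth_manifold ::
  "('v, 'm::{real_normed_vector, heine_borel}) manifold \<Rightarrow> bool" where
  "smooth_manifold M \<longleftrightarrow>
     Hausdorff_space (mtop M) \<and> second_countable (mtop M) \<and>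
     (\<Union>(U, \<psi>)\<in>matlas M. U) = points M \<and>
     (\<forall>(U, \<psi>)\<in>matlas M. openin (mtop M) U \<and> open (\<psi> ` U) \<and>
        homeomorphic_map (subtopology (mtop M) U) (top_of_set (\<psi> ` U)) \<psi>) \<and>
     (\<forall>(U, \<psi>)\<in>matlas M. \<forall>(U', \<psi>')\<in>matlas M.
        smooth_on (\<psi> ` (U \<inter> U')) (\<psi>' \<circ> inv_into U \<psi>))"

definition smooth_map ::
  "('v, 'm::{real_normed_vector, heine_borel}) manifold \<Rightarrow>
   ('w, 'n::{real_normed_vector, heine_borel}) manifold \<Rightarrow> ('v \<Rightarrow> 'w) \<Rightarrow> bool" where
  "smooth_map M N f \<longleftrightarrow>
     continuous_map (mtop M) (mtop N) f \<and>
     (\<forall>(U, \<psi>)\<in>matlas M. \<forall>(U', \<psi>')\<in>matlas N.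
        smooth_on (\<psi> ` (U \<inter> f -` U')) (\<psi>' \<circ> f \<circ> inv_into U \<psi>))"

text \<open>
  A smooth embedding is an immersion that is a topological embedding; its image is then an
  embedded submanifold of \<open>N\<close>, diffeomorphic to \<open>M\<close>.
\<close>

definition smooth_embedding ::
  "('v, 'm::{real_normed_vector, heine_borel}) manifold \<Rightarrow>
   ('w, 'n::{real_normed_vector, heine_borel}) manifold \<Rightarrow> ('v \<Rightarrow> 'w) \<Rightarrow> bool" where
  "smooth_embedding M N f \<longleftrightarrow>
     smooth_map M N f \<and> embedding_map (mtop M) (mtop N) f \<and>
     (\<forall>(U, \<psi>)\<in>matlas M. \<forall>(U', \<psi>')\<in>matlas N. \<forall>x\<in>U \<inter> f -` U'.
        inj (frechet_derivative (\<psi>' \<circ> f \<circ> inv_into U \<psi>) (at (\<psi> x))))"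

definition euclidean_manifold :: "('a::{real_normed_vector, heine_borel}, 'a) manifold" where
  "euclidean_manifold = \<lparr>mtop = euclidean, matlas = {(UNIV, id)}\<rparr>"

definition prod_manifold ::
  "('v, 'm) manifold \<Rightarrow> ('w, 'n) manifold \<Rightarrow> ('v \<times> 'w, 'm \<times> 'n) manifold" where
  "prod_manifold M N =
     \<lparr>mtop = prod_topology (mtop M) (mtop N),
      matlas = {(U \<times> U', map_prod \<psi> \<psi>') | U \<psi> U' \<psi>'. (U, \<psi>) \<in> matlas M \<and> (U', \<psi>') \<in> matlas N}\<rparr>"


section \<open>Orbifolds\<close>

text \<open>Orbifold charts \<open>{V, G, \<pi>}\<close>.\<close>

record ('v, 'm, 'g, 'q) orbichart =
  cman :: "('v, 'm) manifold"
  cgrp :: "'g monoid"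
  cact :: "'g \<Rightarrow> 'v \<Rightarrow> 'v"
  cproj :: "'v \<Rightarrow> 'q"

definition chart_image :: "('v, 'm, 'g, 'q) orbichart \<Rightarrow> 'q set" where
  "chart_image C = cproj C ` points (cman C)"

definition act_kernel :: "('v, 'm, 'g, 'q) orbichart \<Rightarrow> 'g set" where
  "act_kernel C = kernel (cgrp C) (BijGroup (points (cman C))) (cact C)"

text \<open>
  The last two conditions say that the projection induces a homeomorphism from the orbit space
  onto the open set \<open>chart_image C\<close>: it is a quotient map whose fibres are the orbits.
\<close>

definition is_orbichart ::
  "'q topology \<Rightarrow> ('v, 'm::{real_normed_vector, heine_borel}, 'g, 'q) orbichart \<Rightarrow> bool" where
  "is_orbichart X C \<longleftrightarrow>
     smooth_manifold (cman C) \<and> connected_space (mtop (cman C)) \<and> points (cman C) \<noteq> {} \<and>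
     finite (carrier (cgrp C)) \<and>
     group_action (cgrp C) (points (cman C)) (cact C) \<and>
     (\<forall>h\<in>carrier (cgrp C). smooth_map (cman C) (cman C) (cact C h)) \<and>
     openin X (chart_image C) \<and>
     quotient_map (mtop (cman C)) (subtopology X (chart_image C)) (cproj C) \<and>
     (\<forall>x\<in>points (cman C). \<forall>y\<in>points (cman C).
        cproj C x = cproj C y \<longleftrightarrow> y \<in> orbit (cgrp C) (cact C) x)"

definition chart_injection ::
  "('v, 'm::{real_normed_vector, heine_borel}, 'g, 'q) orbichart \<Rightarrow>
   ('v, 'm, 'g, 'q) orbichart \<Rightarrow> ('v \<Rightarrow> 'v) \<Rightarrow> ('g \<Rightarrow> 'g) \<Rightarrow> bool" where
  "chart_injection C D \<phi> \<theta> \<longleftrightarrow>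
     smooth_embedding (cman C) (cman D) \<phi> \<and>
     openin (mtop (cman D)) (\<phi> ` points (cman C)) \<and>
     (\<forall>x\<in>points (cman C). cproj D (\<phi> x) = cproj C x) \<and>
     \<theta> \<in> hom (cgrp C) (cgrp D) \<and> inj_on \<theta> (carrier (cgrp C)) \<and>
     (\<forall>h\<in>carrier (cgrp C). \<forall>x\<in>points (cman C). \<phi> (cact C h x) = cact D (\<theta> h) (\<phi> x)) \<and>
     bij_betw \<theta> (act_kernel C) (act_kernel D)"

text \<open>
  An orbifold is given by its underlying space, a family of charts (indexed by \<open>'c\<close>) and a family
  of injections between them (indexed by \<open>'i\<close>). The injections belong to the structure: where a
  local group acts trivially, the set of all pairs \<open>(\<phi>, \<lambda>)\<close> that satisfy \<open>chart_injection\<close>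
  contains its whole automorphism group, and transition maps for all these pairs would exclude most
  representations of the group as fibres of bundles.
\<close>

record ('q, 'c, 'i, 'v, 'm, 'g) orbifold =
  otop :: "'q topology"
  charts :: "'c set"
  chart :: "'c \<Rightarrow> ('v, 'm, 'g, 'q) orbichart"
  injs :: "'i set"
  isrc :: "'i \<Rightarrow> 'c"
  itgt :: "'i \<Rightarrow> 'c"
  iemb :: "'i \<Rightarrow> 'v \<Rightarrow> 'v"
  ihom :: "'i \<Rightarrow> 'g \<Rightarrow> 'g"

abbreviation cpoints :: "('q, 'c, 'i, 'v, 'm, 'g) orbifold \<Rightarrow> 'c \<Rightarrow> 'v set" where
  "cpoints Q c \<equiv> points (cman (chart Q c))"

abbreviation cgroup :: "('q, 'c, 'i, 'v, 'm, 'g) orbifold \<Rightarrow> 'c \<Rightarrow> 'g monoid" where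
  "cgroup Q c \<equiv> cgrp (chart Q c)"

definition injs_over :: "('q, 'c, 'i, 'v, 'm, 'g) orbifold \<Rightarrow> 'c set \<Rightarrow> 'i set" where
  "injs_over Q A = {i \<in> injs Q. isrc Q i \<in> A \<and> itgt Q i \<in> A}"

definition inj_composite :: "('q, 'c, 'i, 'v, 'm, 'g) orbifold \<Rightarrow> 'i \<Rightarrow> 'i \<Rightarrow> 'i \<Rightarrow> bool" where
  "inj_composite Q j i k \<longleftrightarrow>
     isrc Q k = isrc Q i \<and> itgt Q i = isrc Q j \<and> itgt Q k = itgt Q j \<and>
     (\<forall>x\<in>cpoints Q (isrc Q i). iemb Q k x = iemb Q j (iemb Q i x)) \<and>
     (\<forall>h\<in>carrier (cgroup Q (isrc Q i)). ihom Q k h = ihom Q j (ihom Q i h))"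

definition inj_identity :: "('q, 'c, 'i, 'v, 'm, 'g) orbifold \<Rightarrow> 'c \<Rightarrow> 'i \<Rightarrow> bool" where
  "inj_identity Q c i \<longleftrightarrow>
     isrc Q i = c \<and> itgt Q i = c \<and>
     (\<forall>x\<in>cpoints Q c. iemb Q i x = x) \<and> (\<forall>h\<in>carrier (cgroup Q c). ihom Q i h = h)"

definition compatible_cover :: "('q, 'c, 'i, 'v, 'm, 'g) orbifold \<Rightarrow> 'c set \<Rightarrow> bool" where
  "compatible_cover Q A \<longleftrightarrow>
     A \<subseteq> charts Q \<and>
     (\<Union>c\<in>A. chart_image (chart Q c)) = topspace (otop Q) \<and>
     (\<forall>a\<in>A. \<forall>b\<in>A. \<forall>p\<in>chart_image (chart Q a) \<inter> chart_image (chart Q b).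
        \<exists>i\<in>injs_over Q A. \<exists>j\<in>injs_over Q A.
          isrc Q i = isrc Q j \<and> itgt Q i = a \<and> itgt Q j = b \<and>
          p \<in> chart_image (chart Q (isrc Q i)))"

definition is_orbifold ::
  "('q, 'c, 'i, 'v, 'm::{real_normed_vector, heine_borel}, 'g) orbifold \<Rightarrow> bool" where
  "is_orbifold Q \<longleftrightarrow>
     Hausdorff_space (otop Q) \<and>
     (\<forall>c\<in>charts Q. is_orbichart (otop Q) (chart Q c)) \<and>
     (\<forall>i\<in>injs Q. isrc Q i \<in> charts Q \<and> itgt Q i \<in> charts Q \<and>
        chart_injection (chart Q (isrc Q i)) (chart Q (itgt Q i)) (iemb Q i) (ihom Q i)) \<and>
     (\<forall>c\<in>charts Q. \<exists>i\<in>injs Q. inj_identity Q c i) \<and>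
     (\<forall>i\<in>injs Q. \<forall>j\<in>injs Q. itgt Q i = isrc Q j \<longrightarrow> (\<exists>k\<in>injs Q. inj_composite Q j i k)) \<and>
     compatible_cover Q (charts Q)"


section \<open>Orbifold vector bundles\<close>

text \<open>
  A bundle of rank \<open>CARD('k)\<close> with total space \<open>btop\<close> over a compatible cover \<open>bcover\<close> of the base:
  \<open>bact\<close> and \<open>bpi\<close> are the actions on and the projections of the charts with domain
  \<open>V \<times> \<real>\<^sup>k\<close>, and \<open>btrans\<close> gives the transition maps \<open>g\<^sub>i\<close>.
\<close>

record ('e, 'q, 'c, 'i, 'v, 'g, 'k) vbundle =
  btop :: "'e topology"
  bproj :: "'e \<Rightarrow> 'q"
  bcover :: "'c set"
  bact :: "'c \<Rightarrow> 'g \<Rightarrow> 'v \<times> (real ^ 'k) \<Rightarrow> 'v \<times> (real ^ 'k)"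
  bpi :: "'c \<Rightarrow> 'v \<times> (real ^ 'k) \<Rightarrow> 'e"
  btrans :: "'i \<Rightarrow> 'v \<Rightarrow> real ^ 'k ^ 'k"

definition bchart ::
  "('q, 'c, 'i, 'v, 'm, 'g) orbifold \<Rightarrow> ('e, 'q, 'c, 'i, 'v, 'g, 'k::finite) vbundle \<Rightarrow> 'c \<Rightarrow>
   ('v \<times> (real ^ 'k), 'm \<times> (real ^ 'k), 'g, 'e) orbichart" where
  "bchart Q E c =
     \<lparr>cman = prod_manifold (cman (chart Q c)) euclidean_manifold,
      cgrp = cgroup Q c, cact = bact E c, cproj = bpi E c\<rparr>"

definition bemb ::
  "('q, 'c, 'i, 'v, 'm, 'g) orbifold \<Rightarrow> ('e, 'q, 'c, 'i, 'v, 'g, 'k::finite) vbundle \<Rightarrow> 'i \<Rightarrow>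
   'v \<times> (real ^ 'k) \<Rightarrow> 'v \<times> (real ^ 'k)" where
  "bemb Q E i = (\<lambda>(x, v). (iemb Q i x, btrans E i x *v v))"

definition vector_bundle ::
  "('q, 'c, 'i, 'v, 'm::{real_normed_vector, heine_borel}, 'g) orbifold \<Rightarrow>
   ('e, 'q, 'c, 'i, 'v, 'g, 'k::finite) vbundle \<Rightarrow> bool" where
  "vector_bundle Q E \<longleftrightarrow>
     is_orbifold Q \<and> compatible_cover Q (bcover E) \<and>
     Hausdorff_space (btop E) \<and> continuous_map (btop E) (otop Q) (bproj E) \<and>
     (\<forall>c\<in>bcover E.
        is_orbichart (btop E) (bchart Q E c) \<and>
        chart_image (bchart Q E c) =
          {e \<in> topspace (btop E). bproj E e \<in> chart_image (chart Q c)} \<and>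
        (\<forall>x\<in>cpoints Q c. \<forall>v. bproj E (bpi E c (x, v)) = cproj (chart Q c) x) \<and>
        (\<forall>h\<in>carrier (cgroup Q c). \<forall>x\<in>cpoints Q c.
           (\<forall>v. fst (bact E c h (x, v)) = cact (chart Q c) h x) \<and>
           linear (\<lambda>v. snd (bact E c h (x, v))))) \<and>
     (\<forall>i\<in>injs_over Q (bcover E).
        smooth_map (cman (chart Q (isrc Q i))) euclidean_manifold (btrans E i) \<and>
        (\<forall>x\<in>cpoints Q (isrc Q i). invertible (btrans E i x)) \<and>
        chart_injection (bchart Q E (isrc Q i)) (bchart Q E (itgt Q i)) (bemb Q E i) (ihom Q i)) \<and>
     (\<forall>i\<in>injs_over Q (bcover E). \<forall>j\<in>injs_over Q (bcover E). \<forall>k\<in>injs_over Q (bcover E).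
        inj_composite Q j i k \<longrightarrow>
        (\<forall>x\<in>cpoints Q (isrc Q i). btrans E k x = btrans E j (iemb Q i x) ** btrans E i x))"

definition good_bundle ::
  "('q, 'c, 'i, 'v, 'm::{real_normed_vector, heine_borel}, 'g) orbifold \<Rightarrow>
   ('e, 'q, 'c, 'i, 'v, 'g, 'k::finite) vbundle \<Rightarrow> bool" where
  "good_bundle Q E \<longleftrightarrow>
     vector_bundle Q E \<and>
     (\<forall>e\<in>topspace (btop E). \<exists>c\<in>bcover E.
        e \<in> chart_image (bchart Q E c) \<and> act_kernel (bchart Q E c) = act_kernel (chart Q c))"

definition bad_bundle ::
  "('q, 'c, 'i, 'v, 'm::{real_normed_vector, heine_borel}, 'g) orbifold \<Rightarrow>
   ('e, 'q, 'c, 'i, 'v, 'g, 'k::finite) vbundle \<Rightarrow> bool" where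
  "bad_bundle Q E \<longleftrightarrow> vector_bundle Q E \<and> \<not> good_bundle Q E"

text \<open>
  Isomorphisms of bundles over \<open>Q\<close>: fibrewise \<open>(x, v) \<mapsto> (x, \<Psi> c x *v v)\<close> in the charts of a common
  compatible cover, equivariant and compatible with the injections.
\<close>

definition isomorphic_bundles ::
  "('q, 'c, 'i, 'v, 'm::{real_normed_vector, heine_borel}, 'g) orbifold \<Rightarrow>
   ('e, 'q, 'c, 'i, 'v, 'g, 'k::finite) vbundle \<Rightarrow>
   ('f, 'q, 'c, 'i, 'v, 'g, 'k) vbundle \<Rightarrow> bool" where
  "isomorphic_bundles Q E F \<longleftrightarrow>
     vector_bundle Q E \<and> vector_bundle Q F \<and>
     (\<exists>A (\<Psi> :: 'c \<Rightarrow> 'v \<Rightarrow> real ^ 'k ^ 'k).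
        A \<subseteq> bcover E \<inter> bcover F \<and> compatible_cover Q A \<and>
        (\<forall>c\<in>A.
           smooth_map (cman (chart Q c)) euclidean_manifold (\<Psi> c) \<and>
           (\<forall>x\<in>cpoints Q c. invertible (\<Psi> c x)) \<and>
           (\<forall>h\<in>carrier (cgroup Q c). \<forall>x\<in>cpoints Q c. \<forall>v.
              \<Psi> c (cact (chart Q c) h x) *v snd (bact E c h (x, v)) =
              snd (bact F c h (x, \<Psi> c x *v v)))) \<and>
        (\<forall>i\<in>injs_over Q A. \<forall>x\<in>cpoints Q (isrc Q i).
           \<Psi> (itgt Q i) (iemb Q i x) ** btrans E i x = btrans F i x ** \<Psi> (isrc Q i) x))"


section \<open>Suborbifolds and restriction of bundles\<close>

text \<open>
  A suborbifold structure of \<open>Q\<close> in \<open>R\<close>: \<open>sincl\<close> embeds the underlying spaces; to each chart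
  \<open>{V, G, \<pi>}\<close> of \<open>Q\<close> in the cover \<open>scover\<close> belong a chart \<open>{W, G, \<pi>}\<close> of \<open>R\<close>, given by \<open>samb\<close>, and an
  equivariant embedding \<open>semb\<close> of \<open>V\<close> into \<open>W\<close>, which identifies \<open>V\<close> with an invariant
  submanifold of \<open>W\<close>; \<open>slift\<close> gives for each injection of these charts of \<open>Q\<close> an injection of charts of
  \<open>R\<close> that restricts to it.
\<close>

record ('q, 'c, 'i, 'v, 'r, 'd, 'j, 'w) suborb =
  sincl :: "'q \<Rightarrow> 'r"
  scover :: "'c set"
  samb :: "'c \<Rightarrow> 'd"
  semb :: "'c \<Rightarrow> 'v \<Rightarrow> 'w"
  slift :: "'i \<Rightarrow> 'j"

definition inj_restricts ::
  "('q, 'c, 'i, 'v, 'm, 'g) orbifold \<Rightarrow> ('r, 'd, 'j, 'w, 'n, 'g) orbifold \<Rightarrow>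
   ('q, 'c, 'i, 'v, 'r, 'd, 'j, 'w) suborb \<Rightarrow> 'j \<Rightarrow> 'i \<Rightarrow> bool" where
  "inj_restricts Q R S j i \<longleftrightarrow>
     isrc R j = samb S (isrc Q i) \<and> itgt R j = samb S (itgt Q i) \<and>
     (\<forall>x\<in>cpoints Q (isrc Q i).
        iemb R j (semb S (isrc Q i) x) = semb S (itgt Q i) (iemb Q i x)) \<and>
     (\<forall>h\<in>carrier (cgroup Q (isrc Q i)). ihom R j h = ihom Q i h)"

text \<open>
  The final three conditions express compatibility with injections: injections of \<open>Q\<close> extend to \<open>R\<close>,
  functorially, and injections of \<open>R\<close> that preserve the submanifolds restrict to injections of \<open>Q\<close>.
\<close>

definition is_suborbifold ::
  "('q, 'c, 'i, 'v, 'm::{real_normed_vector, heine_borel}, 'g) orbifold \<Rightarrow>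
   ('r, 'd, 'j, 'w, 'n::{real_normed_vector, heine_borel}, 'g) orbifold \<Rightarrow>
   ('q, 'c, 'i, 'v, 'r, 'd, 'j, 'w) suborb \<Rightarrow> bool" where
  "is_suborbifold Q R S \<longleftrightarrow>
     is_orbifold Q \<and> is_orbifold R \<and>
     embedding_map (otop Q) (otop R) (sincl S) \<and>
     compatible_cover Q (scover S) \<and>
     (\<forall>c\<in>scover S.
        samb S c \<in> charts R \<and> cgroup R (samb S c) = cgroup Q c \<and>
        smooth_embedding (cman (chart Q c)) (cman (chart R (samb S c))) (semb S c) \<and>
        (\<forall>h\<in>carrier (cgroup Q c). \<forall>x\<in>cpoints Q c.
           semb S c (cact (chart Q c) h x) = cact (chart R (samb S c)) h (semb S c x)) \<and>
        (\<forall>x\<in>cpoints Q c.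
           cproj (chart R (samb S c)) (semb S c x) = sincl S (cproj (chart Q c) x))) \<and>
     (\<forall>i\<in>injs_over Q (scover S). slift S i \<in> injs R \<and> inj_restricts Q R S (slift S i) i) \<and>
     (\<forall>i\<in>injs_over Q (scover S). \<forall>j\<in>injs_over Q (scover S). \<forall>k\<in>injs_over Q (scover S).
        inj_composite Q j i k \<longrightarrow> inj_composite R (slift S j) (slift S i) (slift S k)) \<and>
     (\<forall>a\<in>scover S. \<forall>b\<in>scover S. \<forall>j\<in>injs R.
        isrc R j = samb S a \<and> itgt R j = samb S b \<and>
        iemb R j ` semb S a ` cpoints Q a \<subseteq> semb S b ` cpoints Q b \<longrightarrow>
        (\<exists>i\<in>injs Q. isrc Q i = a \<and> itgt Q i = b \<and> inj_restricts Q R S j i))"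

definition restrict_bundle ::
  "('q, 'c, 'i, 'v, 'm, 'g) orbifold \<Rightarrow>
   ('q, 'c, 'i, 'v, 'r, 'd, 'j, 'w) suborb \<Rightarrow> ('f, 'r, 'd, 'j, 'w, 'g, 'k::finite) vbundle \<Rightarrow>
   ('f, 'q, 'c, 'i, 'v, 'g, 'k) vbundle" where
  "restrict_bundle Q S F =
     \<lparr>btop = subtopology (btop F) {e. bproj F e \<in> sincl S ` topspace (otop Q)},
      bproj = inv_into (topspace (otop Q)) (sincl S) \<circ> bproj F,
      bcover = {c \<in> scover S. samb S c \<in> bcover F},
      bact = (\<lambda>c h. \<lambda>(x, v)\<in>cpoints Q c \<times> UNIV.
                (cact (chart Q c) h x, snd (bact F (samb S c) h (semb S c x, v)))),
      bpi = (\<lambda>c (x, v). bpi F (samb S c) (semb S c x, v)),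
      btrans = (\<lambda>i x. btrans F (slift S i) (semb S (isrc Q i) x))\<rparr>"

end

theory Submission
  imports Defs
begin

text \<open>
  Let \<open>R\<close> be the total space of \<open>E\<close>, an orbifold with the charts \<open>V \<times> \<real>\<^sup>k\<close> and the groups \<open>G\<close>. The zero
  section makes \<open>Q\<close> a suborbifold of \<open>R\<close>: in a chart it is \<open>V \<times> {0}\<close>, which is invariant because \<open>G\<close>
  acts linearly on the fibres. Let \<open>F\<close> be the pull-back \<open>\<rho>\<^sup>*E\<close> along \<open>\<rho> : E \<rightarrow> Q\<close>, in other words the
  vertical tangent bundle of \<open>R\<close>, with charts \<open>V \<times> \<real>\<^sup>k \<times> \<real>\<^sup>k\<close> on which \<open>G\<close> acts diagonally on the two
  fibre coordinates. An element that acts trivially on \<open>V \<times> \<real>\<^sup>k\<close> acts trivially on \<open>V \<times> \<real>\<^sup>k \<times> \<real>\<^sup>k\<close>, hence \<open>F\<close>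
  is good whatever the kernels for \<open>E\<close> are; and on \<open>V \<times> {0} \<times> \<real>\<^sup>k\<close> the bundle \<open>F\<close> restricts to \<open>E\<close>.

  The work lies in constructing the total space of \<open>F\<close>. It is not the fibre product of \<open>E\<close> with itself
  over \<open>Q\<close>, whose fibres are quotients of \<open>\<real>\<^sup>k \<times> \<real>\<^sup>k\<close> by two independent copies of the local group, and gluing the charts
  along the injections requires that the injections generate a manageable equivalence relation. Both
  difficulties disappear when a vertical tangent vector is recorded by the affine line that it spans:
  the triple \<open>((x, v), w)\<close> yields the curve \<open>t \<mapsto> [x, v + t w]\<close> in \<open>E\<close> (\<open>fibre_line\<close>), and two triples,
  possibly in different charts, are identified if and only if their curves agree. This is an
  equivalence relation for free, it is preserved by injections, and the space of classes is Hausdorff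
  because evaluation at every \<open>t\<close> is a continuous map into \<open>E\<close> and these maps separate the classes.
  Inside a single chart the classes are exactly the \<open>G\<close>-orbits (\<open>fibre_line_eq_iff\<close>): if every
  \<open>v + t w\<close> is moved to \<open>v' + t w'\<close> by some element of the finite group, then one element serves two
  values of \<open>t\<close>, and by linearity it moves \<open>v\<close> to \<open>v'\<close> and \<open>w\<close> to \<open>w'\<close>.

  The classes that lie over the zero section are the lines \<open>t \<mapsto> [x, t w]\<close>; evaluation at \<open>t = 1\<close> is a
  homeomorphism from the space of these lines to \<open>E\<close> (\<open>homeomorphic_radial_line\<close>), under which the
  restriction of \<open>F\<close> becomes \<open>E\<close> with the same actions and transition maps, so that the identity
  matrices are an isomorphism.

  On the analytic side, the action on \<open>F\<close> and the injections of \<open>F\<close> both arise from a fibre preserving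
  map \<open>\<Phi>\<close> of \<open>V \<times> \<real>\<^sup>k\<close> by the same operation \<open>fibre_double\<close>, so smoothness, the embedding property and
  immersivity are proved once for that operation.
\<close>

section \<open>Smooth maps between normed spaces\<close>

lemma higher_differentiable_on_cong:
  assumes "higher_differentiable_on n S f" "open S" "\<And>x. x \<in> S \<Longrightarrow> f x = g x"
  shows "higher_differentiable_on n S g"
  using assms
proof (induction n arbitrary: f g)
  case 0
  then show ?case
    using continuous_on_cong by (metis higher_differentiable_on.simps(1))
next
  case (Suc n)
  have D: "(g has_derivative frechet_derivative f (at x)) (at x)" if "x \<in> S" for x
  proof -
    have "(f has_derivative frechet_derivative f (at x)) (at x)"
      using Suc.prems(1) that frechet_derivative_works by auto
    then show ?thesis
      using has_derivative_transform_within_open Suc.prems(2,3) that by blast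
  qed
  have eq: "frechet_derivative f (at x) = frechet_derivative g (at x)" if "x \<in> S" for x
    using frechet_derivative_at[OF D[OF that]] .
  have "g differentiable (at x)" if "x \<in> S" for x
    using D[OF that] by (auto simp: differentiable_def)
  moreover have "higher_differentiable_on n S (\<lambda>x. frechet_derivative g (at x) v)" for v
  proof (rule Suc.IH)
    show "higher_differentiable_on n S (\<lambda>x. frechet_derivative f (at x) v)"
      using Suc.prems(1) by simp
  qed (use Suc.prems(2) eq in auto)
  ultimately show ?case by simp
qed

lemma smooth_on_cong:
  assumes "smooth_on S f" "open S" "\<And>x. x \<in> S \<Longrightarrow> f x = g x"
  shows "smooth_on S g"
  using assms higher_differentiable_on_cong unfolding smooth_on_def by blast

text \<open>
  Higher differentiability is defined through the chosen derivative \<open>frechet_derivative\<close>. This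
  introduction rule accepts any family of derivatives, which makes the inductions below short.
\<close>

lemma higher_differentiable_on_SucI:
  assumes "open S" "\<And>x. x \<in> S \<Longrightarrow> (f has_derivative f' x) (at x)"
    "\<And>v. higher_differentiable_on n S (\<lambda>x. f' x v)"
  shows "higher_differentiable_on (Suc n) S f"
proof -
  have eq: "f' x = frechet_derivative f (at x)" if "x \<in> S" for x
    using assms(2)[OF that] by (rule frechet_derivative_at)
  have "f differentiable (at x)" if "x \<in> S" for x
    using assms(2)[OF that] by (auto simp: differentiable_def)
  moreover have "higher_differentiable_on n S (\<lambda>x. frechet_derivative f (at x) v)" for v
    by (rule higher_differentiable_on_cong[OF assms(3)[of v] assms(1)]) (simp add: eq)
  ultimately show ?thesis by simp
qed

lemma higher_differentiable_on_SucD: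
  assumes "higher_differentiable_on (Suc n) S f" "x \<in> S"
  shows "(f has_derivative frechet_derivative f (at x)) (at x)"
  using assms frechet_derivative_works by auto

lemma smooth_on_imp_has_derivative:
  assumes "smooth_on S f" "x \<in> S"
  shows "(f has_derivative frechet_derivative f (at x)) (at x)"
proof -
  have "higher_differentiable_on (Suc 0) S f"
    using assms unfolding smooth_on_def by blast
  then show ?thesis using assms(2) by (rule higher_differentiable_on_SucD)
qed

text \<open>
  All compositions needed are with linear maps on one side: \<open>(f \<circ> L)' x v = f' (L x) (L v)\<close> has again the
  form of a map in the directions \<open>L v\<close> precomposed with \<open>L\<close>, so the induction on the order of
  differentiability closes up without the general chain rule.
\<close>

lemma higher_differentiable_on_comp_linear:
  assumes "higher_differentiable_on n S f" "bounded_linear L" "open T" "L ` T \<subseteq> S"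
  shows "higher_differentiable_on n T (\<lambda>x. f (L x))"
  using assms(1)
proof (induction n arbitrary: f)
  case 0
  have "continuous_on T L"
    using assms(2) by (simp add: linear_continuous_on)
  then show ?case
    using 0 assms(4) by (simp add: continuous_on_compose2)
next
  case (Suc n)
  show ?case
  proof (rule higher_differentiable_on_SucI[OF assms(3)])
    fix x assume "x \<in> T"
    then have "(f has_derivative frechet_derivative f (at (L x))) (at (L x))"
      using Suc.prems assms(4) by (intro higher_differentiable_on_SucD) auto
    then show "((\<lambda>x. f (L x)) has_derivative (\<lambda>v. frechet_derivative f (at (L x)) (L v))) (at x)"
      using has_derivative_compose bounded_linear_imp_has_derivative assms(2) by blast
  next
    fix v show "higher_differentiable_on n T (\<lambda>x. frechet_derivative f (at (L x)) (L v))"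
      using Suc.IH[of "\<lambda>y. frechet_derivative f (at y) (L v)"] Suc.prems by simp
  qed
qed

lemma smooth_on_comp_linear:
  assumes "smooth_on S f" "bounded_linear L" "open T" "L ` T \<subseteq> S"
  shows "smooth_on T (\<lambda>x. f (L x))"
  using assms higher_differentiable_on_comp_linear unfolding smooth_on_def by blast

lemma higher_differentiable_on_linear_comp:
  assumes "higher_differentiable_on n S f" "bounded_linear L" "open S"
  shows "higher_differentiable_on n S (\<lambda>x. L (f x))"
  using assms(1)
proof (induction n arbitrary: f)
  case 0
  then show ?case
    using assms(2) by (simp add: bounded_linear.continuous_on)
next
  case (Suc n)
  show ?case
  proof (rule higher_differentiable_on_SucI[OF assms(3)])
    show "((\<lambda>x. L (f x)) has_derivative (\<lambda>v. L (frechet_derivative f (at x) v))) (at x)"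
      if "x \<in> S" for x
      by (rule bounded_linear.has_derivative[OF assms(2) higher_differentiable_on_SucD[OF Suc.prems that]])
    show "higher_differentiable_on n S (\<lambda>x. L (frechet_derivative f (at x) v))" for v
      using Suc.IH[of "\<lambda>y. frechet_derivative f (at y) v"] Suc.prems by simp
  qed
qed

lemma smooth_on_linear_comp:
  assumes "smooth_on S f" "bounded_linear L" "open S"
  shows "smooth_on S (\<lambda>x. L (f x))"
  using assms higher_differentiable_on_linear_comp unfolding smooth_on_def by blast

lemma higher_differentiable_on_Pair:
  assumes "higher_differentiable_on n S f" "higher_differentiable_on n S g" "open S"
  shows "higher_differentiable_on n S (\<lambda>x. (f x, g x))"
  using assms(1,2)
proof (induction n arbitrary: f g)
  case 0
  then show ?case by (simp add: continuous_on_Pair)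
next
  case (Suc n)
  show ?case
  proof (rule higher_differentiable_on_SucI[OF assms(3)])
    show "((\<lambda>x. (f x, g x)) has_derivative
        (\<lambda>v. (frechet_derivative f (at x) v, frechet_derivative g (at x) v))) (at x)"
      if "x \<in> S" for x
      by (rule has_derivative_Pair[OF higher_differentiable_on_SucD[OF Suc.prems(1) that]
            higher_differentiable_on_SucD[OF Suc.prems(2) that]])
    show "higher_differentiable_on n S
        (\<lambda>x. (frechet_derivative f (at x) v, frechet_derivative g (at x) v))" for v
      using Suc.IH[of "\<lambda>y. frechet_derivative f (at y) v" "\<lambda>y. frechet_derivative g (at y) v"]
        Suc.prems by simp
  qed
qed

lemma smooth_on_Pair:
  assumes "smooth_on S f" "smooth_on S g" "open S"
  shows "smooth_on S (\<lambda>x. (f x, g x))"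
  using assms higher_differentiable_on_Pair unfolding smooth_on_def by blast

lemma smooth_on_const: "smooth_on S (\<lambda>x. c)"
proof -
  have "higher_differentiable_on n S (\<lambda>x. c)" for n
    by (induction n arbitrary: c) auto
  then show ?thesis unfolding smooth_on_def by blast
qed

lemma smooth_on_linear:
  assumes "bounded_linear L" "open S"
  shows "smooth_on S L"
proof -
  have "higher_differentiable_on n S L" for n
  proof (cases n)
    case 0
    then show ?thesis using assms by (simp add: linear_continuous_on)
  next
    case (Suc m)
    have D: "frechet_derivative L (at x) = L" for x
      using assms(1) bounded_linear_imp_has_derivative frechet_derivative_at by metis
    then show ?thesis
      unfolding Suc higher_differentiable_on.simps D
      using assms bounded_linear_imp_differentiable smooth_on_const
      unfolding smooth_on_def by blast
  qed
  then show ?thesis unfolding smooth_on_def by blast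
qed

section \<open>Smooth manifolds and their products\<close>

lemma smooth_manifoldD:
  assumes "smooth_manifold M"
  shows "Hausdorff_space (mtop M)" "second_countable (mtop M)"
    "(\<Union>(U, \<psi>)\<in>matlas M. U) = points M"
    "(U, \<psi>) \<in> matlas M \<Longrightarrow> (U', \<psi>') \<in> matlas M \<Longrightarrow>
      smooth_on (\<psi> ` (U \<inter> U')) (\<psi>' \<circ> inv_into U \<psi>)"
  using assms unfolding smooth_manifold_def by blast+

lemma smooth_manifold_chart:
  assumes "smooth_manifold M" "(U, \<psi>) \<in> matlas M"
  shows "openin (mtop M) U" "U \<subseteq> points M" "open (\<psi> ` U)" "inj_on \<psi> U"
    "homeomorphic_map (subtopology (mtop M) U) (top_of_set (\<psi> ` U)) \<psi>"
proof -
  show *: "openin (mtop M) U" "open (\<psi> ` U)"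
    "homeomorphic_map (subtopology (mtop M) U) (top_of_set (\<psi> ` U)) \<psi>"
    using assms unfolding smooth_manifold_def by blast+
  show "U \<subseteq> points M" using *(1) by (rule openin_subset)
  then show "inj_on \<psi> U"
    using homeomorphic_imp_injective_map[OF *(3)] by (simp add: Int_absorb1)
qed

lemma open_chart_image:
  assumes "smooth_manifold M" "(U, \<psi>) \<in> matlas M" "openin (mtop M) W"
  shows "open (\<psi> ` (U \<inter> W))"
proof -
  note c = smooth_manifold_chart[OF assms(1,2)]
  have "openin (subtopology (mtop M) U) (U \<inter> W)"
    using assms(3) by (simp add: openin_subtopology_Int2)
  then have "openin (top_of_set (\<psi> ` U)) (\<psi> ` (U \<inter> W))"
    using c(2,5) by (metis Int_lower1 homeomorphic_map_openness inf.absorb2 topspace_subtopology)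
  then show ?thesis using c(3) by (simp add: openin_open_eq)
qed

lemma open_chart_preimage:
  assumes "smooth_manifold M" "(U, \<psi>) \<in> matlas M" "(U', \<psi>') \<in> matlas N" "smooth_manifold N"
    "continuous_map (mtop M) (mtop N) f"
  shows "open (\<psi> ` (U \<inter> f -` U'))"
proof -
  have "openin (mtop M) {x \<in> points M. f x \<in> U'}"
    using openin_continuous_map_preimage[OF assms(5) smooth_manifold_chart(1)[OF assms(4,3)]] .
  moreover have "U \<inter> {x \<in> points M. f x \<in> U'} = U \<inter> f -` U'"
    using smooth_manifold_chart(2)[OF assms(1,2)] by auto
  ultimately show ?thesis
    using open_chart_image[OF assms(1,2)] by metis
qed

lemma second_countable_euclidean: "second_countable (euclidean :: 'a::second_countable_topology topology)"
proof -
  obtain B :: "'a set set" where B: "countable B" "topological_basis B"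
    using ex_countable_basis by blast
  show ?thesis
    unfolding second_countable_def
  proof (intro exI conjI ballI allI impI)
    show "countable B" by (rule B(1))
    show "openin euclidean V" if "V \<in> B" for V
      using topological_basis_open[OF B(2) that] by simp
    show "\<exists>V\<in>B. x \<in> V \<and> V \<subseteq> U" if "openin euclidean U \<and> x \<in> U" for U and x :: 'a
      using that topological_basisE[OF B(2), of U x] by (metis open_openin)
  qed
qed

lemma second_countable_prod_topology:
  assumes "second_countable X" "second_countable Y"
  shows "second_countable (prod_topology X Y)"
proof -
  obtain A B where A: "countable A" "\<And>V. V \<in> A \<Longrightarrow> openin X V"
      "\<And>U x. openin X U \<Longrightarrow> x \<in> U \<Longrightarrow> \<exists>V\<in>A. x \<in> V \<and> V \<subseteq> U"
    and B: "countable B" "\<And>V. V \<in> B \<Longrightarrow> openin Y V"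
      "\<And>U x. openin Y U \<Longrightarrow> x \<in> U \<Longrightarrow> \<exists>V\<in>B. x \<in> V \<and> V \<subseteq> U"
    using assms unfolding second_countable_def by metis
  show ?thesis
    unfolding second_countable_def
  proof (intro exI conjI allI impI ballI)
    let ?C = "(\<lambda>(U, V). U \<times> V) ` (A \<times> B)"
    show "countable ?C" using A(1) B(1) by blast
    show "openin (prod_topology X Y) W" if "W \<in> ?C" for W
      using that A(2) B(2) by (auto simp: openin_prod_Times_iff)
    fix U and p :: "'a \<times> 'b" assume "openin (prod_topology X Y) U \<and> p \<in> U"
    then obtain U1 U2 where U: "openin X U1" "openin Y U2" "fst p \<in> U1" "snd p \<in> U2" "U1 \<times> U2 \<subseteq> U"
      by (metis openin_prod_topology_alt prod.collapse)
    then obtain V1 V2 where "V1 \<in> A" "fst p \<in> V1" "V1 \<subseteq> U1" "V2 \<in> B" "snd p \<in> V2" "V2 \<subseteq> U2"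
      by (meson A(3) B(3))
    then show "\<exists>V\<in>?C. p \<in> V \<and> V \<subseteq> U"
      using U(5) by (intro bexI[of _ "V1 \<times> V2"]) (auto simp: mem_Times_iff)
  qed
qed

lemma inv_into_map_prod:
  assumes "inj_on f A" "inj_on g B" "a \<in> f ` A" "b \<in> g ` B"
  shows "inv_into (A \<times> B) (map_prod f g) (a, b) = (inv_into A f a, inv_into B g b)"
  using assms
  by (intro inv_into_f_eq map_prod_inj_on) (auto simp: f_inv_into_f inv_into_into)

lemma points_prod_manifold [simp]: "points (prod_manifold M N) = points M \<times> points N"
  and mtop_prod_manifold [simp]: "mtop (prod_manifold M N) = prod_topology (mtop M) (mtop N)"
  and mtop_euclidean_manifold [simp]: "mtop euclidean_manifold = euclidean"
  and matlas_euclidean_manifold [simp]: "matlas euclidean_manifold = {(UNIV, id)}"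
  by (simp_all add: prod_manifold_def euclidean_manifold_def)

lemma matlas_prod_manifold:
  "(W, \<eta>) \<in> matlas (prod_manifold M N) \<longleftrightarrow>
   (\<exists>U \<psi> U' \<psi>'. W = U \<times> U' \<and> \<eta> = map_prod \<psi> \<psi>' \<and> (U, \<psi>) \<in> matlas M \<and> (U', \<psi>') \<in> matlas N)"
  by (simp add: prod_manifold_def)

lemma matlas_prod_euclidean:
  "(W, \<eta>) \<in> matlas (prod_manifold M euclidean_manifold) \<longleftrightarrow>
   (\<exists>U \<psi>. W = U \<times> UNIV \<and> \<eta> = map_prod \<psi> id \<and> (U, \<psi>) \<in> matlas M)"
  unfolding matlas_prod_manifold by auto

lemma smooth_manifold_euclidean:
  "smooth_manifold (euclidean_manifold :: ('a::euclidean_space, 'a) manifold)"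
proof -
  have "homeomorphic_map euclidean euclidean (id :: 'a \<Rightarrow> 'a)"
    by simp
  moreover have "smooth_on UNIV (id :: 'a \<Rightarrow> 'a)"
    unfolding id_def by (intro smooth_on_linear bounded_linear_ident open_UNIV)
  moreover have "inv_into UNIV id = (id :: 'a \<Rightarrow> 'a)"
    by (rule inv_id)
  ultimately show ?thesis
    unfolding smooth_manifold_def
    using second_countable_euclidean Hausdorff_space_euclidean by auto
qed

lemma smooth_manifold_prod:
  fixes M :: "('v, 'm::{real_normed_vector, heine_borel}) manifold"
    and N :: "('w, 'n::{real_normed_vector, heine_borel}) manifold"
  assumes M: "smooth_manifold M" and N: "smooth_manifold N"
  shows "smooth_manifold (prod_manifold M N)"
proof -
  have top: "Hausdorff_space (prod_topology (mtop M) (mtop N))"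
      "second_countable (prod_topology (mtop M) (mtop N))"
    using smooth_manifoldD(1,2)[OF M] smooth_manifoldD(1,2)[OF N]
    by (simp_all add: Hausdorff_space_prod_topology second_countable_prod_topology)
  have cover: "(\<Union>(U, \<psi>)\<in>matlas (prod_manifold M N). U) = points M \<times> points N"
  proof -
    have *: "(\<Union>(U, \<psi>)\<in>A. U) = \<Union>(fst ` A)" for A :: "('y set \<times> 'z) set"
      by auto
    have "fst ` matlas (prod_manifold M N) =
        (\<lambda>(U, U'). U \<times> U') ` (fst ` matlas M \<times> fst ` matlas N)"
      by (auto simp: prod_manifold_def image_iff) (metis fst_conv)+
    then have "\<Union>(fst ` matlas (prod_manifold M N)) = \<Union>(fst ` matlas M) \<times> \<Union>(fst ` matlas N)"
      by auto
    then show ?thesis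
      unfolding smooth_manifoldD(3)[OF M, symmetric] smooth_manifoldD(3)[OF N, symmetric] *
      by simp
  qed
  have chart: "openin (prod_topology (mtop M) (mtop N)) (U \<times> U') \<and>
      open (map_prod \<psi> \<psi>' ` (U \<times> U')) \<and>
      homeomorphic_map (subtopology (prod_topology (mtop M) (mtop N)) (U \<times> U'))
        (top_of_set (map_prod \<psi> \<psi>' ` (U \<times> U'))) (map_prod \<psi> \<psi>')"
    if "(U, \<psi>) \<in> matlas M" "(U', \<psi>') \<in> matlas N" for U \<psi> U' \<psi>'
  proof -
    note c = smooth_manifold_chart[OF M that(1)] smooth_manifold_chart[OF N that(2)]
    have im: "map_prod \<psi> \<psi>' ` (U \<times> U') = \<psi> ` U \<times> \<psi>' ` U'" by auto
    obtain g g' where "homeomorphic_maps (subtopology (mtop M) U) (top_of_set (\<psi> ` U)) \<psi> g"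
      "homeomorphic_maps (subtopology (mtop N) U') (top_of_set (\<psi>' ` U')) \<psi>' g'"
      using c(5,10) homeomorphic_map_maps by metis
    then have "homeomorphic_maps (prod_topology (subtopology (mtop M) U) (subtopology (mtop N) U'))
        (prod_topology (top_of_set (\<psi> ` U)) (top_of_set (\<psi>' ` U')))
        (\<lambda>(x, y). (\<psi> x, \<psi>' y)) (\<lambda>(x, y). (g x, g' y))"
      by (simp only: homeomorphic_maps_prod simp_thms)
    then have "homeomorphic_map (subtopology (prod_topology (mtop M) (mtop N)) (U \<times> U'))
        (top_of_set (\<psi> ` U \<times> \<psi>' ` U')) (map_prod \<psi> \<psi>')"
      unfolding homeomorphic_map_maps map_prod_def subtopology_Times prod_topology_subtopology_eu
      by (rule exI[where P = "homeomorphic_maps _ _ _"])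
    then show ?thesis
      using c by (simp add: im openin_prod_Times_iff open_Times)
  qed
  have trans: "smooth_on (map_prod \<psi> \<psi>' ` (U \<times> U' \<inter> V \<times> V'))
      (map_prod \<eta> \<eta>' \<circ> inv_into (U \<times> U') (map_prod \<psi> \<psi>'))"
    if "(U, \<psi>) \<in> matlas M" "(U', \<psi>') \<in> matlas N" "(V, \<eta>) \<in> matlas M" "(V', \<eta>') \<in> matlas N"
    for U \<psi> U' \<psi>' V \<eta> V' \<eta>'
  proof -
    note c = smooth_manifold_chart[OF M that(1)] smooth_manifold_chart[OF N that(2)]
    have im: "map_prod \<psi> \<psi>' ` (U \<times> U' \<inter> V \<times> V') = \<psi> ` (U \<inter> V) \<times> \<psi>' ` (U' \<inter> V')"
      by auto
    have op: "open (\<psi> ` (U \<inter> V))" "open (\<psi>' ` (U' \<inter> V'))"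
      using open_chart_image[OF M that(1)] open_chart_image[OF N that(2)]
        smooth_manifold_chart(1)[OF M that(3)] smooth_manifold_chart(1)[OF N that(4)] by auto
    have sm: "smooth_on (\<psi> ` (U \<inter> V)) (\<eta> \<circ> inv_into U \<psi>)"
      "smooth_on (\<psi>' ` (U' \<inter> V')) (\<eta>' \<circ> inv_into U' \<psi>')"
      using smooth_manifoldD(4)[OF M that(1,3)] smooth_manifoldD(4)[OF N that(2,4)] .
    let ?S = "\<psi> ` (U \<inter> V) \<times> \<psi>' ` (U' \<inter> V')"
    have "smooth_on ?S (\<lambda>p. ((\<eta> \<circ> inv_into U \<psi>) (fst p), (\<eta>' \<circ> inv_into U' \<psi>') (snd p)))"
      using op by (intro smooth_on_Pair smooth_on_comp_linear[OF sm(1)] smooth_on_comp_linear[OF sm(2)]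
          bounded_linear_fst bounded_linear_snd open_Times) auto
    then show ?thesis
      unfolding im
    proof (rule smooth_on_cong)
      show "open ?S" using op by (rule open_Times)
      fix p assume "p \<in> ?S"
      then show "((\<eta> \<circ> inv_into U \<psi>) (fst p), (\<eta>' \<circ> inv_into U' \<psi>') (snd p)) =
          (map_prod \<eta> \<eta>' \<circ> inv_into (U \<times> U') (map_prod \<psi> \<psi>')) p"
        using inv_into_map_prod[OF c(4,9), of "fst p" "snd p"] by (cases p) auto
    qed
  qed
  show ?thesis
    unfolding smooth_manifold_def mtop_prod_manifold topspace_prod_topology
  proof (intro conjI)
    show "\<forall>(W, \<eta>)\<in>matlas (prod_manifold M N).
        openin (prod_topology (mtop M) (mtop N)) W \<and> open (\<eta> ` W) \<and>
        homeomorphic_map (subtopology (prod_topology (mtop M) (mtop N)) W) (top_of_set (\<eta> ` W)) \<eta>"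
      using chart by (auto simp: matlas_prod_manifold)
    show "\<forall>(U, \<psi>)\<in>matlas (prod_manifold M N). \<forall>(U', \<psi>')\<in>matlas (prod_manifold M N).
        smooth_on (\<psi> ` (U \<inter> U')) (\<psi>' \<circ> inv_into U \<psi>)"
    proof (clarify, elim matlas_prod_manifold[THEN iffD1, elim_format] exE conjE)
      fix W \<zeta> W' \<zeta>' U \<psi> U' \<psi>' V \<eta> V' \<eta>'
      assume "W = U \<times> U'" "\<zeta> = map_prod \<psi> \<psi>'" "W' = V \<times> V'" "\<zeta>' = map_prod \<eta> \<eta>'"
        "(U, \<psi>) \<in> matlas M" "(U', \<psi>') \<in> matlas N" "(V, \<eta>) \<in> matlas M" "(V', \<eta>') \<in> matlas N"
      then show "smooth_on (\<zeta> ` (W \<inter> W')) (\<zeta>' \<circ> inv_into W \<zeta>)"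
        using trans by simp
    qed
  qed (use top cover in auto)
qed

section \<open>Smooth maps and embeddings\<close>

lemma smooth_mapD:
  assumes "smooth_map M N f"
  shows "continuous_map (mtop M) (mtop N) f"
    "(U, \<psi>) \<in> matlas M \<Longrightarrow> (U', \<psi>') \<in> matlas N \<Longrightarrow>
      smooth_on (\<psi> ` (U \<inter> f -` U')) (\<psi>' \<circ> f \<circ> inv_into U \<psi>)"
  using assms unfolding smooth_map_def by blast+

lemma smooth_embeddingD:
  assumes "smooth_embedding M N f"
  shows "smooth_map M N f" "embedding_map (mtop M) (mtop N) f"
    "(U, \<psi>) \<in> matlas M \<Longrightarrow> (U', \<psi>') \<in> matlas N \<Longrightarrow> x \<in> U \<Longrightarrow> f x \<in> U' \<Longrightarrow>
      inj (frechet_derivative (\<psi>' \<circ> f \<circ> inv_into U \<psi>) (at (\<psi> x)))"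
proof -
  assume U: "(U, \<psi>) \<in> matlas M" and U': "(U', \<psi>') \<in> matlas N" and x: "x \<in> U" "f x \<in> U'"
  have "\<forall>(U, \<psi>)\<in>matlas M. \<forall>(U', \<psi>')\<in>matlas N. \<forall>x\<in>U \<inter> f -` U'.
        inj (frechet_derivative (\<psi>' \<circ> f \<circ> inv_into U \<psi>) (at (\<psi> x)))"
    using assms by (simp add: smooth_embedding_def)
  from bspec[OF bspec[OF this U, unfolded prod.case] U', unfolded prod.case] x
  show "inj (frechet_derivative (\<psi>' \<circ> f \<circ> inv_into U \<psi>) (at (\<psi> x)))"
    by simp
qed (use assms in \<open>simp_all add: smooth_embedding_def\<close>)

section \<open>Doubling the fibres of a map\<close>

text \<open>
  For a map \<open>\<Phi>(x, v) = (\<phi> x, g\<^sub>x v)\<close> that preserves fibres this is \<open>((x, v), w) \<mapsto> ((\<phi> x, g\<^sub>x v), g\<^sub>x w)\<close>,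
  the map induced on the pull-back of the bundle to its own total space.
\<close>

definition fibre_double :: "('v \<times> 'b \<Rightarrow> 'w \<times> 'c) \<Rightarrow> ('v \<times> 'b) \<times> 'b \<Rightarrow> ('w \<times> 'c) \<times> 'c" where
  "fibre_double \<Phi> = (\<lambda>(p, w). (\<Phi> p, snd (\<Phi> (fst p, w))))"

lemma fibre_double_apply [simp]: "fibre_double \<Phi> (p, w) = (\<Phi> p, snd (\<Phi> (fst p, w)))"
  by (simp add: fibre_double_def)

lemma smooth_on_fibre_double:
  fixes f :: "'a::real_normed_vector \<times> 'b::real_normed_vector \<Rightarrow> 'c::real_normed_vector \<times> 'd::real_normed_vector"
  assumes "smooth_on (A \<times> UNIV) f" "open (A \<times> (UNIV :: 'b set))"
  shows "smooth_on ((A \<times> UNIV) \<times> UNIV) (fibre_double f)"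
proof -
  have op: "open ((A \<times> (UNIV :: 'b set)) \<times> (UNIV :: 'b set))"
    using assms(2) by (simp add: open_Times)
  have lin: "bounded_linear (\<lambda>q :: ('a \<times> 'b) \<times> 'b. (fst (fst q), snd q))"
    by (intro bounded_linear_Pair bounded_linear_fst_comp bounded_linear_fst bounded_linear_snd)
  have "smooth_on ((A \<times> UNIV) \<times> UNIV) (\<lambda>q. (f (fst q), snd (f (fst (fst q), snd q))))"
    by (intro smooth_on_Pair op smooth_on_comp_linear[OF assms(1) bounded_linear_fst]
        smooth_on_linear_comp[OF _ bounded_linear_snd] smooth_on_comp_linear[OF assms(1) lin]) auto
  then show ?thesis by (simp add: fibre_double_def case_prod_unfold)
qed

text \<open>
  The derivative at \<open>((a, v), w)\<close> sends \<open>((s, t), r)\<close> to \<open>(D\<^sub>v (s, t), snd (D\<^sub>w (s, r)))\<close>, where \<open>D\<^sub>v\<close> is the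
  derivative of \<open>f\<close> at \<open>(a, v)\<close>. If this vanishes, then \<open>(s, t) = 0\<close> by injectivity of \<open>D\<^sub>v\<close>; moreover
  \<open>D\<^sub>w (0, r)\<close> is vertical since \<open>f\<close> preserves the fibre over \<open>a\<close>, so \<open>D\<^sub>w (0, r) = 0\<close> and \<open>r = 0\<close>.
\<close>

lemma inj_frechet_derivative_fibre_double:
  fixes f :: "'a::real_normed_vector \<times> 'b::real_normed_vector \<Rightarrow> 'c::real_normed_vector \<times> 'd::real_normed_vector"
  assumes sm: "smooth_on (A \<times> UNIV) f" and a: "a \<in> A"
    and inj: "\<And>v. inj (frechet_derivative f (at (a, v)))"
    and fibre: "\<And>v. fst (f (a, v)) = b"
  shows "inj (frechet_derivative (fibre_double f) (at ((a, v), w)))"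
proof -
  let ?D = "\<lambda>v. frechet_derivative f (at (a, v))"
  have D: "(f has_derivative ?D v) (at (a, v))" for v
    using a by (intro smooth_on_imp_has_derivative[OF sm]) auto
  have lin: "linear (?D v)" for v
    using has_derivative_linear[OF D] .
  have "((\<lambda>t. fst (f (a, t))) has_derivative (\<lambda>d. fst (?D w (0, d)))) (at w)"
    by (rule has_derivative_fst has_derivative_compose[OF has_derivative_Pair[OF has_derivative_const has_derivative_ident] D])+
  moreover have "((\<lambda>t. fst (f (a, t))) has_derivative (\<lambda>d. 0)) (at w)"
    by (simp add: fibre)
  ultimately have vert: "fst (?D w (0, d)) = 0" for d
    using has_derivative_unique by metis
  let ?D2 = "\<lambda>q. (?D v (fst q), snd (?D w (fst (fst q), snd q)))"
  have "((\<lambda>q. (f (fst q), snd (f (fst (fst q), snd q)))) has_derivative ?D2) (at ((a, v), w))"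
  proof (intro has_derivative_Pair has_derivative_snd)
    show "((\<lambda>q. f (fst q)) has_derivative (\<lambda>q. ?D v (fst q))) (at ((a, v), w))"
      by (rule has_derivative_compose[OF has_derivative_fst[OF has_derivative_ident]]) (simp add: D)
    have "((\<lambda>q. (fst (fst q), snd q)) has_derivative (\<lambda>q. (fst (fst q), snd q))) (at ((a, v), w))"
      by (intro has_derivative_Pair has_derivative_fst has_derivative_snd has_derivative_ident)
    then show "((\<lambda>q. f (fst (fst q), snd q)) has_derivative (\<lambda>q. ?D w (fst (fst q), snd q))) (at ((a, v), w))"
      by (rule has_derivative_compose) (simp add: D)
  qed
  then have eq: "frechet_derivative (fibre_double f) (at ((a, v), w)) = ?D2"
    by (intro frechet_derivative_at[symmetric]) (simp add: fibre_double_def case_prod_unfold)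
  have lin2: "linear ?D2"
    using \<open>(_ has_derivative ?D2) _\<close> has_derivative_linear by blast
  show ?thesis
    unfolding eq linear_injective_0[OF lin2]
  proof (intro allI impI)
    fix q assume q: "?D2 q = 0"
    obtain s t r where qq: "q = ((s, t), r)" by (metis surj_pair)
    have "?D v (s, t) = 0" using q by (simp add: qq zero_prod_def)
    then have st: "s = 0" "t = 0"
      using inj[of v] linear_injective_0[OF lin] by (auto simp: zero_prod_def)
    have "?D w (0, r) = 0"
      using q vert[of r] by (auto simp: qq st zero_prod_def prod_eq_iff)
    then have "r = 0"
      using inj[of w] linear_injective_0[OF lin] by (auto simp: zero_prod_def)
    then show "q = 0" by (simp add: qq st zero_prod_def)
  qed
qed

text \<open>
  Doubling commutes with passing to charts: the local expression of the doubled map is the double of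
  the local expression \<open>f\<close> of \<open>\<Phi>\<close>. The map \<open>\<phi>\<close> on the base describes the domain, which is a product
  because the fibre coordinate is global.
\<close>

lemma fibre_double_in_charts:
  fixes M :: "('v, 'm::{real_normed_vector, heine_borel}) manifold"
    and N :: "('w, 'n::{real_normed_vector, heine_borel}) manifold"
    and \<Phi> :: "'v \<times> 'b::euclidean_space \<Rightarrow> 'w \<times> 'c::euclidean_space"
    and U :: "'v set"
  assumes M: "smooth_manifold M" and N: "smooth_manifold N"
    and \<Phi>: "smooth_map (prod_manifold M euclidean_manifold) (prod_manifold N euclidean_manifold) \<Phi>"
    and fibre: "\<forall>x\<in>points M. \<forall>v. fst (\<Phi> (x, v)) = \<phi> x"
    and U: "(U, \<psi>) \<in> matlas M" and U': "(U', \<psi>') \<in> matlas N"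
  defines "A \<equiv> \<psi> ` (U \<inter> \<phi> -` U')"
    and "f \<equiv> map_prod \<psi>' id \<circ> \<Phi> \<circ> inv_into (U \<times> UNIV) (map_prod \<psi> id)"
  shows "open (A \<times> (UNIV :: 'b set))"
    and "smooth_on (A \<times> UNIV) f"
    and "\<And>a v. a \<in> A \<Longrightarrow> fst (f (a, v)) = \<psi>' (\<phi> (inv_into U \<psi> a))"
    and "map_prod (map_prod \<psi> id) id ` ((U \<times> UNIV) \<times> UNIV \<inter> fibre_double \<Phi> -` ((U' \<times> UNIV) \<times> UNIV))
      = (A \<times> UNIV) \<times> UNIV"
    and "\<And>q. q \<in> (A \<times> UNIV) \<times> UNIV \<Longrightarrow>
      (map_prod (map_prod \<psi>' id) id \<circ> fibre_double \<Phi> \<circ>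
        inv_into ((U \<times> UNIV) \<times> UNIV) (map_prod (map_prod \<psi> id) id)) q = fibre_double f q"
proof -
  note c = smooth_manifold_chart[OF M U]
  have \<phi>: "fst (\<Phi> (x, v)) = \<phi> x" if "x \<in> U" for x v
    using that c(2) fibre by auto
  have \<phi>': "fst (\<Phi> p) = \<phi> (fst p)" if "fst p \<in> U" for p
    using \<phi>[OF that, of "snd p"] by simp
  have dom: "map_prod \<psi> id ` ((U \<times> UNIV) \<inter> \<Phi> -` (U' \<times> UNIV)) = A \<times> (UNIV :: 'b set)"
  proof -
    have "(U \<times> UNIV) \<inter> \<Phi> -` (U' \<times> UNIV) = (U \<inter> \<phi> -` U') \<times> (UNIV :: 'b set)"
      by (rule Set.set_eqI) (simp add: mem_Times_iff fibre_double_def split_beta \<phi>' cong: conj_cong)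
    then show ?thesis by (simp add: A_def map_prod_surj_on)
  qed
  have UU: "(U \<times> UNIV, map_prod \<psi> id) \<in> matlas (prod_manifold M euclidean_manifold)"
    "(U' \<times> UNIV, map_prod \<psi>' id) \<in> matlas (prod_manifold N euclidean_manifold)"
    unfolding matlas_prod_euclidean using U U' by blast+
  show "open (A \<times> (UNIV :: 'b set))"
    unfolding dom[symmetric]
    using \<Phi> by (intro open_chart_preimage[OF _ UU] smooth_manifold_prod smooth_manifold_euclidean M N)
      (simp add: smooth_map_def)
  show "smooth_on (A \<times> UNIV) f"
    unfolding dom[symmetric] f_def using \<Phi> UU unfolding smooth_map_def by blast
  have inv1: "inv_into (U \<times> UNIV) (map_prod \<psi> id) (a, v) = (inv_into U \<psi> a, v)"
    if "a \<in> A" for a and v :: 'b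
    using inv_into_map_prod[OF c(4) inj_on_id, of a v UNIV] that by (auto simp: A_def)
  have inv2: "inv_into ((U \<times> UNIV) \<times> UNIV) (map_prod (map_prod \<psi> id) id) ((a, v), w) = ((inv_into U \<psi> a, v), w)"
    if "a \<in> A" for a and v w :: 'b
  proof -
    have "(a, v) \<in> map_prod \<psi> id ` (U \<times> UNIV)"
      using that by (auto simp: A_def map_prod_surj_on)
    then show ?thesis
      using inv_into_map_prod[OF map_prod_inj_on[OF c(4) inj_on_id] inj_on_id, of "(a, v)" UNIV w UNIV]
        inv1[OF that] by simp
  qed
  have inU: "inv_into U \<psi> a \<in> U" if "a \<in> A" for a
    using that c(4) by (auto simp: A_def)
  show "fst (f (a, v)) = \<psi>' (\<phi> (inv_into U \<psi> a))" if "a \<in> A" for a v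
    using that by (simp add: f_def inv1 \<phi> inU)
  have "(U \<times> UNIV) \<times> UNIV \<inter> fibre_double \<Phi> -` ((U' \<times> UNIV) \<times> UNIV)
      = ((U \<inter> \<phi> -` U') \<times> (UNIV :: 'b set)) \<times> (UNIV :: 'b set)"
    by (rule Set.set_eqI) (simp add: mem_Times_iff fibre_double_def split_beta \<phi>' cong: conj_cong)
  then show "map_prod (map_prod \<psi> id) id ` ((U \<times> UNIV) \<times> UNIV \<inter> fibre_double \<Phi> -` ((U' \<times> UNIV) \<times> UNIV))
      = (A \<times> UNIV) \<times> UNIV"
    by (simp add: A_def map_prod_surj_on)
  fix q :: "('m \<times> 'b) \<times> 'b" assume "q \<in> (A \<times> UNIV) \<times> UNIV"
  then obtain a v w where q: "q = ((a, v), w)" and a: "a \<in> A" by auto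
  show "(map_prod (map_prod \<psi>' id) id \<circ> fibre_double \<Phi> \<circ>
        inv_into ((U \<times> UNIV) \<times> UNIV) (map_prod (map_prod \<psi> id) id)) q = fibre_double f q"
    by (simp add: q inv2[OF a] f_def inv1[OF a])
qed

text \<open>
  The subsets \<open>S\<close> and \<open>T\<close> are carried along for the sake of the inverse of an embedding, which is
  continuous on its image only.
\<close>

lemma continuous_map_fibre_double:
  fixes \<Phi> :: "'v \<times> 'b::topological_space \<Rightarrow> 'w \<times> 'c::topological_space"
  assumes \<Phi>: "continuous_map (subtopology (prod_topology X euclidean) S) (prod_topology Y euclidean) \<Phi>"
    and T: "\<And>q. q \<in> T \<Longrightarrow> fst q \<in> S \<and> (fst (fst q), snd q) \<in> S"
  shows "continuous_map (subtopology (prod_topology (prod_topology X euclidean) euclidean) T)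
    (prod_topology (prod_topology Y euclidean) euclidean) (fibre_double \<Phi>)"
proof -
  let ?X = "subtopology (prod_topology (prod_topology X euclidean) euclidean) T"
  have 1: "continuous_map ?X (subtopology (prod_topology X euclidean) S) fst"
    using T by (auto simp: continuous_map_in_subtopology intro: continuous_map_subtopology_fst)
  have "continuous_map ?X (prod_topology X euclidean) (\<lambda>q. (fst (fst q), snd q))"
    by (intro continuous_map_from_subtopology continuous_map_pairedI continuous_map_snd
        continuous_map_compose[OF continuous_map_fst continuous_map_fst, unfolded o_def])
  then have 2: "continuous_map ?X (subtopology (prod_topology X euclidean) S) (\<lambda>q. (fst (fst q), snd q))"
    using T by (auto simp: continuous_map_in_subtopology)
  have "continuous_map ?X (prod_topology (prod_topology Y euclidean) euclidean)
      (\<lambda>q. (\<Phi> (fst q), snd (\<Phi> (fst (fst q), snd q))))"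
    using continuous_map_compose[OF 1 \<Phi>] continuous_map_compose[OF 2 \<Phi>]
    by (intro continuous_map_pairedI continuous_map_snd_of[unfolded o_def]) (auto simp: o_def)
  then show ?thesis by (simp add: fibre_double_def case_prod_unfold)
qed

text \<open>
  Doubling is functorial, so the double of the inverse on the image is inverse to the double.
\<close>

lemma embedding_map_fibre_double:
  fixes \<Phi> :: "'v \<times> 'b::topological_space \<Rightarrow> 'w \<times> 'c::topological_space"
  assumes emb: "embedding_map (prod_topology X euclidean) (prod_topology Y euclidean) \<Phi>"
    and fibre: "\<And>x v. x \<in> topspace X \<Longrightarrow> fst (\<Phi> (x, v)) = \<phi> x"
  shows "embedding_map (prod_topology (prod_topology X euclidean) euclidean)
    (prod_topology (prod_topology Y euclidean) euclidean) (fibre_double \<Phi>)"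
proof -
  let ?I = "\<Phi> ` (topspace X \<times> UNIV)" and ?I2 = "fibre_double \<Phi> ` ((topspace X \<times> UNIV) \<times> UNIV)"
  let ?X2 = "prod_topology (prod_topology X euclidean) (euclidean :: 'b topology)"
    and ?Y2 = "prod_topology (prod_topology Y euclidean) (euclidean :: 'c topology)"
  obtain g where g: "homeomorphic_maps (prod_topology X euclidean)
      (subtopology (prod_topology Y euclidean) ?I) \<Phi> g"
    using emb unfolding embedding_map_def homeomorphic_map_maps by auto
  have inv: "g (\<Phi> (x, v)) = (x, v)" if "x \<in> topspace X" for x v
    using g that by (simp add: homeomorphic_maps_def)
  have pair: "(\<phi> x, snd (\<Phi> (x, v))) = \<Phi> (x, v)" if "x \<in> topspace X" for x v
    using fibre[OF that] by (metis prod.collapse)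
  have inv2: "fibre_double g (fibre_double \<Phi> q) = q" if q2: "q \<in> (topspace X \<times> UNIV) \<times> UNIV" for q
  proof -
    obtain x v w where q: "q = ((x, v), w)" and x: "x \<in> topspace X" using q2 by auto
    show ?thesis by (simp add: q fibre[OF x] inv[OF x] pair[OF x])
  qed
  have "homeomorphic_maps ?X2 (subtopology ?Y2 ?I2) (fibre_double \<Phi>) (fibre_double g)"
    unfolding homeomorphic_maps_def
  proof (intro conjI ballI)
    have "continuous_map (subtopology (prod_topology X euclidean) UNIV) (prod_topology Y euclidean) \<Phi>"
      using g by (simp add: homeomorphic_maps_def continuous_map_in_subtopology)
    then have "continuous_map (subtopology ?X2 UNIV) ?Y2 (fibre_double \<Phi>)"
      by (rule continuous_map_fibre_double) auto
    then show "continuous_map ?X2 (subtopology ?Y2 ?I2) (fibre_double \<Phi>)"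
      by (simp add: continuous_map_in_subtopology)
    have "continuous_map (subtopology (prod_topology Y euclidean) ?I) (prod_topology X euclidean) g"
      using g by (simp add: homeomorphic_maps_def)
    then show "continuous_map (subtopology ?Y2 ?I2) ?X2 (fibre_double g)"
    proof (rule continuous_map_fibre_double)
      fix q assume "q \<in> ?I2"
      then obtain x v w where q: "q = fibre_double \<Phi> ((x, v), w)" and x: "x \<in> topspace X" by auto
      show "fst q \<in> ?I \<and> (fst (fst q), snd q) \<in> ?I"
        using x by (auto simp: q fibre[OF x] pair[OF x])
    qed
  qed (use inv2 in auto)
  then show ?thesis
    unfolding embedding_map_def homeomorphic_map_maps by auto
qed

lemma smooth_map_fibre_double:
  fixes M :: "('v, 'm::{real_normed_vector, heine_borel}) manifold"
    and N :: "('w, 'n::{real_normed_vector, heine_borel}) manifold"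
    and \<Phi> :: "'v \<times> 'b::euclidean_space \<Rightarrow> 'w \<times> 'c::euclidean_space"
  assumes M: "smooth_manifold M" and N: "smooth_manifold N"
    and \<Phi>: "smooth_map (prod_manifold M euclidean_manifold) (prod_manifold N euclidean_manifold) \<Phi>"
    and fibre: "\<And>x v. x \<in> points M \<Longrightarrow> fst (\<Phi> (x, v)) = \<phi> x"
  shows "smooth_map (prod_manifold (prod_manifold M euclidean_manifold) euclidean_manifold)
    (prod_manifold (prod_manifold N euclidean_manifold) euclidean_manifold) (fibre_double \<Phi>)"
  unfolding smooth_map_def
proof (intro conjI)
  have "continuous_map (subtopology (prod_topology (mtop M) euclidean) UNIV) (prod_topology (mtop N) euclidean) \<Phi>"
    using \<Phi> by (simp add: smooth_map_def)
  then have "continuous_map (subtopology (prod_topology (prod_topology (mtop M) euclidean) euclidean) UNIV)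
      (prod_topology (prod_topology (mtop N) euclidean) euclidean) (fibre_double \<Phi>)"
    by (rule continuous_map_fibre_double) auto
  then show "continuous_map (mtop (prod_manifold (prod_manifold M euclidean_manifold) euclidean_manifold))
      (mtop (prod_manifold (prod_manifold N euclidean_manifold) euclidean_manifold)) (fibre_double \<Phi>)"
    by simp
  have "smooth_on (map_prod (map_prod \<psi> id) id `
        ((U \<times> UNIV) \<times> UNIV \<inter> fibre_double \<Phi> -` ((U' \<times> UNIV) \<times> UNIV)))
      (map_prod (map_prod \<psi>' id) id \<circ> fibre_double \<Phi> \<circ>
        inv_into ((U \<times> UNIV) \<times> UNIV) (map_prod (map_prod \<psi> id) id))"
    if U: "(U, \<psi>) \<in> matlas M" and U': "(U', \<psi>') \<in> matlas N" for U \<psi> U' \<psi>'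
  proof -
    have "\<forall>x\<in>points M. \<forall>v. fst (\<Phi> (x, v)) = \<phi> x" using fibre by blast
    note c = fibre_double_in_charts[OF M N \<Phi> this U U']
    show ?thesis
      unfolding c(4)
      by (rule smooth_on_cong[OF smooth_on_fibre_double[OF c(2,1)] open_Times[OF c(1) open_UNIV]])
        (rule c(5)[symmetric])
  qed
  then show "\<forall>(U, \<psi>)\<in>matlas (prod_manifold (prod_manifold M euclidean_manifold) euclidean_manifold).
      \<forall>(U', \<psi>')\<in>matlas (prod_manifold (prod_manifold N euclidean_manifold) euclidean_manifold).
        smooth_on (\<psi> ` (U \<inter> fibre_double \<Phi> -` U')) (\<psi>' \<circ> fibre_double \<Phi> \<circ> inv_into U \<psi>)"
    by (auto simp: matlas_prod_euclidean)
qed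

lemma smooth_embedding_fibre_double:
  fixes M :: "('v, 'm::{real_normed_vector, heine_borel}) manifold"
    and N :: "('w, 'n::{real_normed_vector, heine_borel}) manifold"
    and \<Phi> :: "'v \<times> 'b::euclidean_space \<Rightarrow> 'w \<times> 'c::euclidean_space"
  assumes M: "smooth_manifold M" and N: "smooth_manifold N"
    and \<Phi>: "smooth_embedding (prod_manifold M euclidean_manifold) (prod_manifold N euclidean_manifold) \<Phi>"
    and fibre: "\<And>x v. x \<in> points M \<Longrightarrow> fst (\<Phi> (x, v)) = \<phi> x"
  shows "smooth_embedding (prod_manifold (prod_manifold M euclidean_manifold) euclidean_manifold)
    (prod_manifold (prod_manifold N euclidean_manifold) euclidean_manifold) (fibre_double \<Phi>)"
  unfolding smooth_embedding_def
proof (intro conjI)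
  have sm: "smooth_map (prod_manifold M euclidean_manifold) (prod_manifold N euclidean_manifold) \<Phi>"
    using \<Phi> by (simp add: smooth_embedding_def)
  show "smooth_map (prod_manifold (prod_manifold M euclidean_manifold) euclidean_manifold)
      (prod_manifold (prod_manifold N euclidean_manifold) euclidean_manifold) (fibre_double \<Phi>)"
    by (rule smooth_map_fibre_double[OF M N sm fibre])
  show "embedding_map (mtop (prod_manifold (prod_manifold M euclidean_manifold) euclidean_manifold))
      (mtop (prod_manifold (prod_manifold N euclidean_manifold) euclidean_manifold)) (fibre_double \<Phi>)"
    using \<Phi> fibre by (simp add: smooth_embedding_def embedding_map_fibre_double)
  have "inj (frechet_derivative (map_prod (map_prod \<psi>' id) id \<circ> fibre_double \<Phi> \<circ>
        inv_into ((U \<times> UNIV) \<times> UNIV) (map_prod (map_prod \<psi> id) id))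
        (at (map_prod (map_prod \<psi> id) id q)))"
    if U: "(U, \<psi>) \<in> matlas M" and U': "(U', \<psi>') \<in> matlas N"
      and q: "q \<in> (U \<times> UNIV) \<times> UNIV \<inter> fibre_double \<Phi> -` ((U' \<times> UNIV) \<times> UNIV)" for U \<psi> U' \<psi>' q
  proof -
    have "\<forall>x\<in>points M. \<forall>v. fst (\<Phi> (x, v)) = \<phi> x" using fibre by blast
    note c = fibre_double_in_charts[OF M N sm this U U']
    let ?A = "\<psi> ` (U \<inter> \<phi> -` U')"
    let ?f = "map_prod \<psi>' id \<circ> \<Phi> \<circ> inv_into (U \<times> UNIV) (map_prod \<psi> id)"
    let ?g = "map_prod (map_prod \<psi>' id) id \<circ> fibre_double \<Phi> \<circ>
        inv_into ((U \<times> UNIV) \<times> UNIV) (map_prod (map_prod \<psi> id) id)"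
    have op: "open ((?A \<times> (UNIV :: 'b set)) \<times> (UNIV :: 'b set))"
      by (rule open_Times[OF c(1) open_UNIV])
    obtain x v w where qq: "q = ((x, v), w)" and x: "x \<in> U" using q by auto
    have xM: "x \<in> points M" using x smooth_manifold_chart(2)[OF M U] by auto
    have x': "\<phi> x \<in> U'" using q by (auto simp: qq mem_Times_iff fibre[OF xM])
    let ?q = "((\<psi> x, v), w)"
    have D: "(fibre_double ?f has_derivative frechet_derivative (fibre_double ?f) (at ?q)) (at ?q)"
      using x x' by (intro smooth_on_imp_has_derivative[OF smooth_on_fibre_double[OF c(2,1)]]) auto
    have "(?g has_derivative frechet_derivative (fibre_double ?f) (at ?q)) (at ?q)"
      by (rule has_derivative_transform_within_open[OF D op]) (use x x' c(5) in auto)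
    then have eq: "frechet_derivative ?g (at ?q) = frechet_derivative (fibre_double ?f) (at ?q)"
      by (rule frechet_derivative_at[symmetric])
    have "inj (frechet_derivative (fibre_double ?f) (at ?q))"
    proof (rule inj_frechet_derivative_fibre_double[OF c(2)])
      show "\<psi> x \<in> ?A" using x x' by blast
      then show "fst (?f (\<psi> x, t)) = \<psi>' (\<phi> (inv_into U \<psi> (\<psi> x)))" for t by (rule c(3))
      fix t :: 'b
      have "(U \<times> UNIV, map_prod \<psi> id) \<in> matlas (prod_manifold M euclidean_manifold)"
          "(U' \<times> UNIV, map_prod \<psi>' id) \<in> matlas (prod_manifold N euclidean_manifold)"
        unfolding matlas_prod_euclidean using U U' by blast+
      moreover have "(x, t) \<in> U \<times> UNIV" "\<Phi> (x, t) \<in> U' \<times> UNIV"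
        using x x' by (simp_all add: mem_Times_iff fibre[OF xM])
      ultimately have "inj (frechet_derivative ?f (at (map_prod \<psi> id (x, t))))"
        by (rule smooth_embeddingD(3)[OF \<Phi>])
      then show "inj (frechet_derivative ?f (at (\<psi> x, t)))" by simp
    qed
    then show ?thesis by (simp add: qq eq)
  qed
  then show "\<forall>(U, \<psi>)\<in>matlas (prod_manifold (prod_manifold M euclidean_manifold) euclidean_manifold).
      \<forall>(U', \<psi>')\<in>matlas (prod_manifold (prod_manifold N euclidean_manifold) euclidean_manifold).
      \<forall>x\<in>U \<inter> fibre_double \<Phi> -` U'.
        inj (frechet_derivative (\<psi>' \<circ> fibre_double \<Phi> \<circ> inv_into U \<psi>) (at (\<psi> x)))"
    by (auto simp: matlas_prod_euclidean)
qed

section \<open>Bundle projection and zero section\<close>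

lemma smooth_map_const:
  assumes "smooth_manifold M"
  shows "smooth_map M euclidean_manifold (\<lambda>x. c)"
  using assms by (auto simp: smooth_map_def smooth_on_const o_def)

lemma smooth_map_fst_euclidean:
  fixes M :: "('v, 'm::{real_normed_vector, heine_borel}) manifold"
    and g :: "'v \<Rightarrow> 'c::euclidean_space"
  assumes M: "smooth_manifold M" and g: "smooth_map M euclidean_manifold g"
  shows "smooth_map (prod_manifold M (euclidean_manifold :: ('b::euclidean_space, 'b) manifold))
    euclidean_manifold (\<lambda>p. g (fst p))"
  unfolding smooth_map_def
proof (intro conjI)
  show "continuous_map (mtop (prod_manifold M (euclidean_manifold :: ('b, 'b) manifold)))
      (mtop euclidean_manifold) (\<lambda>p. g (fst p))"
    using continuous_map_compose[OF continuous_map_fst smooth_mapD(1)[OF g]] by (simp add: o_def)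
  have "smooth_on (map_prod \<psi> id ` (U \<times> (UNIV :: 'b set)))
      ((\<lambda>p. g (fst p)) \<circ> inv_into (U \<times> (UNIV :: 'b set)) (map_prod \<psi> id))"
    if U: "(U, \<psi>) \<in> matlas M" for U \<psi>
  proof -
    note c = smooth_manifold_chart[OF M U]
    have im: "map_prod \<psi> id ` (U \<times> UNIV) = \<psi> ` U \<times> (UNIV :: 'b set)"
      by (simp add: map_prod_surj_on)
    have op: "open (\<psi> ` U \<times> (UNIV :: 'b set))"
      by (rule open_Times[OF c(3) open_UNIV])
    have "smooth_on (\<psi> ` U) (g \<circ> inv_into U \<psi>)"
      using smooth_mapD(2)[OF g U, of UNIV id] by simp
    then have "smooth_on (\<psi> ` U \<times> (UNIV :: 'b set)) (\<lambda>p. (g \<circ> inv_into U \<psi>) (fst p))"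
      by (rule smooth_on_comp_linear[OF _ bounded_linear_fst op]) auto
    then show ?thesis
      unfolding im
    proof (rule smooth_on_cong[OF _ op])
      fix p :: "'m \<times> 'b" assume "p \<in> \<psi> ` U \<times> UNIV"
      then show "(g \<circ> inv_into U \<psi>) (fst p) = ((\<lambda>p. g (fst p)) \<circ> inv_into (U \<times> UNIV) (map_prod \<psi> id)) p"
        using inv_into_map_prod[OF c(4) inj_on_id, of "fst p" "snd p" UNIV] by (cases p) auto
    qed
  qed
  then show "\<forall>(U, \<psi>)\<in>matlas (prod_manifold M (euclidean_manifold :: ('b, 'b) manifold)).
      \<forall>(U', \<psi>')\<in>matlas (euclidean_manifold :: ('c, 'c) manifold).
        smooth_on (\<psi> ` (U \<inter> (\<lambda>p. g (fst p)) -` U')) (\<psi>' \<circ> (\<lambda>p. g (fst p)) \<circ> inv_into U \<psi>)"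
    by (auto simp: matlas_prod_euclidean)
qed

text \<open>
  A transition map is inverted by the transition map in the opposite direction.
\<close>

lemma inj_frechet_derivative_transition:
  assumes M: "smooth_manifold M" and U: "(U, \<psi>) \<in> matlas M" and U': "(U', \<psi>') \<in> matlas M"
    and x: "x \<in> U \<inter> U'"
  shows "inj (frechet_derivative (\<psi>' \<circ> inv_into U \<psi>) (at (\<psi> x)))"
proof -
  let ?\<tau> = "\<psi>' \<circ> inv_into U \<psi>" and ?\<sigma> = "\<psi> \<circ> inv_into U' \<psi>'"
  have \<tau>x: "?\<tau> (\<psi> y) = \<psi>' y" "?\<sigma> (\<psi>' y) = \<psi> y" if "y \<in> U \<inter> U'" for y
    using that smooth_manifold_chart(4)[OF M U] smooth_manifold_chart(4)[OF M U'] by auto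
  have op: "open (\<psi> ` (U \<inter> U'))"
    by (rule open_chart_image[OF M U smooth_manifold_chart(1)[OF M U']])
  have D\<tau>: "(?\<tau> has_derivative frechet_derivative ?\<tau> (at (\<psi> x))) (at (\<psi> x))"
    using smooth_on_imp_has_derivative[OF smooth_manifoldD(4)[OF M U U']] x by blast
  have "(?\<sigma> has_derivative frechet_derivative ?\<sigma> (at (\<psi>' x))) (at (\<psi>' x))"
    using smooth_on_imp_has_derivative[OF smooth_manifoldD(4)[OF M U' U]] x by blast
  then have "(?\<sigma> has_derivative frechet_derivative ?\<sigma> (at (\<psi>' x))) (at (?\<tau> (\<psi> x)))"
    using \<tau>x(1)[OF x] by simp
  from has_derivative_compose[OF D\<tau> this]
  have 1: "((\<lambda>a. ?\<sigma> (?\<tau> a)) has_derivative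
      (\<lambda>v. frechet_derivative ?\<sigma> (at (\<psi>' x)) (frechet_derivative ?\<tau> (at (\<psi> x)) v))) (at (\<psi> x))" .
  have "((\<lambda>a. ?\<sigma> (?\<tau> a)) has_derivative (\<lambda>v. v)) (at (\<psi> x))"
  proof (rule has_derivative_transform_within_open[OF has_derivative_ident op])
    show "\<psi> x \<in> \<psi> ` (U \<inter> U')" using x by blast
    show "a = ?\<sigma> (?\<tau> a)" if "a \<in> \<psi> ` (U \<inter> U')" for a
      using that \<tau>x by fastforce
  qed
  from has_derivative_unique[OF 1 this]
  have "frechet_derivative ?\<sigma> (at (\<psi>' x)) (frechet_derivative ?\<tau> (at (\<psi> x)) v) = v" for v
    by (rule fun_cong)
  then show ?thesis by (rule inj_on_inverseI)
qed

lemma smooth_embedding_zero_section: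
  fixes M :: "('v, 'm::{real_normed_vector, heine_borel}) manifold"
  assumes M: "smooth_manifold M"
  shows "smooth_embedding M (prod_manifold M (euclidean_manifold :: ('b::euclidean_space, 'b) manifold))
    (\<lambda>x. (x, 0))"
proof -
  let ?z = "\<lambda>x :: 'v. (x, 0 :: 'b)"
  have pre: "U \<inter> ?z -` (U' \<times> UNIV) = U \<inter> U'" for U U' :: "'v set"
    by auto
  have loc: "map_prod \<psi>' id \<circ> ?z \<circ> inv_into U \<psi> = (\<lambda>a. ((\<psi>' \<circ> inv_into U \<psi>) a, 0))"
    for U and \<psi> \<psi>' :: "'v \<Rightarrow> 'm"
    by auto
  have emb: "embedding_map (mtop M) (prod_topology (mtop M) euclidean) ?z"
    by (simp add: embedding_map_graph[where f = "\<lambda>x. 0", simplified])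
  have sm: "smooth_on (\<psi> ` (U \<inter> U')) (\<lambda>a. ((\<psi>' \<circ> inv_into U \<psi>) a, 0 :: 'b))"
    and inj: "x \<in> U \<inter> U' \<Longrightarrow>
      inj (frechet_derivative (\<lambda>a. ((\<psi>' \<circ> inv_into U \<psi>) a, 0 :: 'b)) (at (\<psi> x)))"
    if U: "(U, \<psi>) \<in> matlas M" and U': "(U', \<psi>') \<in> matlas M" for U \<psi> U' \<psi>' x
  proof -
    note s = smooth_manifoldD(4)[OF M U U']
    have op: "open (\<psi> ` (U \<inter> U'))"
      by (rule open_chart_image[OF M U smooth_manifold_chart(1)[OF M U']])
    show "smooth_on (\<psi> ` (U \<inter> U')) (\<lambda>a. ((\<psi>' \<circ> inv_into U \<psi>) a, 0 :: 'b))"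
      by (rule smooth_on_Pair[OF s smooth_on_const op])
    assume x: "x \<in> U \<inter> U'"
    then have "((\<psi>' \<circ> inv_into U \<psi>) has_derivative
        frechet_derivative (\<psi>' \<circ> inv_into U \<psi>) (at (\<psi> x))) (at (\<psi> x))"
      by (intro smooth_on_imp_has_derivative[OF s]) blast
    from has_derivative_Pair[OF this has_derivative_const[of "0 :: 'b"]]
    have eq: "frechet_derivative (\<lambda>a. ((\<psi>' \<circ> inv_into U \<psi>) a, 0 :: 'b)) (at (\<psi> x)) =
        (\<lambda>v. (frechet_derivative (\<psi>' \<circ> inv_into U \<psi>) (at (\<psi> x)) v, 0))"
      by (rule frechet_derivative_at[symmetric])
    show "inj (frechet_derivative (\<lambda>a. ((\<psi>' \<circ> inv_into U \<psi>) a, 0 :: 'b)) (at (\<psi> x)))"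
      unfolding eq using inj_frechet_derivative_transition[OF M U U' x] by (simp add: inj_on_def)
  qed
  show ?thesis
    unfolding smooth_embedding_def smooth_map_def
  proof (intro conjI)
    show "embedding_map (mtop M) (mtop (prod_manifold M (euclidean_manifold :: ('b, 'b) manifold))) ?z"
      using emb by simp
    show "continuous_map (mtop M) (mtop (prod_manifold M (euclidean_manifold :: ('b, 'b) manifold))) ?z"
      by (simp add: continuous_map_pairedI)
    show "\<forall>(U, \<psi>)\<in>matlas M. \<forall>(U', \<psi>')\<in>matlas (prod_manifold M (euclidean_manifold :: ('b, 'b) manifold)).
        smooth_on (\<psi> ` (U \<inter> ?z -` U')) (\<psi>' \<circ> ?z \<circ> inv_into U \<psi>)"
      using sm by (auto simp: matlas_prod_euclidean pre loc)
    show "\<forall>(U, \<psi>)\<in>matlas M. \<forall>(U', \<psi>')\<in>matlas (prod_manifold M (euclidean_manifold :: ('b, 'b) manifold)).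
        \<forall>x\<in>U \<inter> ?z -` U'. inj (frechet_derivative (\<psi>' \<circ> ?z \<circ> inv_into U \<psi>) (at (\<psi> x)))"
      using inj by (auto simp: matlas_prod_euclidean pre loc)
  qed
qed

text \<open>
  Needed to see that the doubles of open embeddings have open images.
\<close>

lemma fibre_double_image:
  fixes \<Phi> :: "'v \<times> 'b \<Rightarrow> 'w \<times> 'c"
  assumes fibre: "\<And>x v. x \<in> A \<Longrightarrow> fst (\<Phi> (x, v)) = \<phi> x"
    and surj: "\<And>x. x \<in> A \<Longrightarrow> surj (\<lambda>v. snd (\<Phi> (x, v)))"
  shows "fibre_double \<Phi> ` ((A \<times> UNIV) \<times> UNIV) = \<Phi> ` (A \<times> UNIV) \<times> (UNIV :: 'c set)"
proof (intro equalityI subsetI)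
  fix q assume "q \<in> \<Phi> ` (A \<times> UNIV) \<times> (UNIV :: 'c set)"
  then obtain x v t where x: "x \<in> A" and q: "q = (\<Phi> (x, v), t)" by auto
  obtain w where "t = snd (\<Phi> (x, w))" using surjD[OF surj[OF x], of t] by blast
  then have "q = fibre_double \<Phi> ((x, v), w)" using q by simp
  moreover have "((x, v), w) \<in> (A \<times> UNIV) \<times> UNIV" using x by simp
  ultimately show "q \<in> fibre_double \<Phi> ` ((A \<times> UNIV) \<times> UNIV)" by (rule image_eqI)
qed auto

section \<open>Orbifold charts and bundles\<close>

lemma is_orbichartD:
  assumes "is_orbichart X C"
  shows "smooth_manifold (cman C)" "connected_space (mtop (cman C))" "points (cman C) \<noteq> {}"
    "finite (carrier (cgrp C))" "group_action (cgrp C) (points (cman C)) (cact C)"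
    "h \<in> carrier (cgrp C) \<Longrightarrow> smooth_map (cman C) (cman C) (cact C h)"
    "openin X (chart_image C)"
    "quotient_map (mtop (cman C)) (subtopology X (chart_image C)) (cproj C)"
    "x \<in> points (cman C) \<Longrightarrow> y \<in> points (cman C) \<Longrightarrow>
      cproj C x = cproj C y \<longleftrightarrow> (\<exists>h\<in>carrier (cgrp C). cact C h x = y)"
    "h \<in> carrier (cgrp C) \<Longrightarrow> x \<in> points (cman C) \<Longrightarrow> cact C h x \<in> points (cman C)"
    "x \<in> points (cman C) \<Longrightarrow> cproj C x \<in> topspace X"
proof -
  show 1: "smooth_manifold (cman C)" "connected_space (mtop (cman C))" "points (cman C) \<noteq> {}"
    "finite (carrier (cgrp C))" "group_action (cgrp C) (points (cman C)) (cact C)"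
    "openin X (chart_image C)"
    "quotient_map (mtop (cman C)) (subtopology X (chart_image C)) (cproj C)"
    using assms unfolding is_orbichart_def by blast+
  show "h \<in> carrier (cgrp C) \<Longrightarrow> smooth_map (cman C) (cman C) (cact C h)"
    using assms unfolding is_orbichart_def by blast
  show "x \<in> points (cman C) \<Longrightarrow> y \<in> points (cman C) \<Longrightarrow>
      cproj C x = cproj C y \<longleftrightarrow> (\<exists>h\<in>carrier (cgrp C). cact C h x = y)"
  proof -
    have "y \<in> orbit (cgrp C) (cact C) x \<longleftrightarrow> (\<exists>h\<in>carrier (cgrp C). cact C h x = y)"
      unfolding orbit_def by blast
    then show "x \<in> points (cman C) \<Longrightarrow> y \<in> points (cman C) \<Longrightarrow>
        cproj C x = cproj C y \<longleftrightarrow> (\<exists>h\<in>carrier (cgrp C). cact C h x = y)"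
      using assms unfolding is_orbichart_def by blast
  qed
  show "h \<in> carrier (cgrp C) \<Longrightarrow> x \<in> points (cman C) \<Longrightarrow> cact C h x \<in> points (cman C)"
    using group_action.element_image[OF 1(5)] by blast
  show "x \<in> points (cman C) \<Longrightarrow> cproj C x \<in> topspace X"
    using openin_subset[OF 1(6)] by (auto simp: chart_image_def)
qed

lemma chart_injectionD:
  assumes "chart_injection C D \<phi> \<theta>"
  shows "smooth_embedding (cman C) (cman D) \<phi>" "openin (mtop (cman D)) (\<phi> ` points (cman C))"
    "x \<in> points (cman C) \<Longrightarrow> cproj D (\<phi> x) = cproj C x"
    "\<theta> \<in> hom (cgrp C) (cgrp D)" "inj_on \<theta> (carrier (cgrp C))"
    "h \<in> carrier (cgrp C) \<Longrightarrow> x \<in> points (cman C) \<Longrightarrow> \<phi> (cact C h x) = cact D (\<theta> h) (\<phi> x)"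
    "bij_betw \<theta> (act_kernel C) (act_kernel D)"
    "x \<in> points (cman C) \<Longrightarrow> \<phi> x \<in> points (cman D)"
proof -
  show 1: "smooth_embedding (cman C) (cman D) \<phi>" "openin (mtop (cman D)) (\<phi> ` points (cman C))"
    "\<theta> \<in> hom (cgrp C) (cgrp D)" "inj_on \<theta> (carrier (cgrp C))"
    "bij_betw \<theta> (act_kernel C) (act_kernel D)"
    using assms unfolding chart_injection_def by blast+
  show "x \<in> points (cman C) \<Longrightarrow> cproj D (\<phi> x) = cproj C x"
    "h \<in> carrier (cgrp C) \<Longrightarrow> x \<in> points (cman C) \<Longrightarrow> \<phi> (cact C h x) = cact D (\<theta> h) (\<phi> x)"
    using assms unfolding chart_injection_def by blast+
  show "x \<in> points (cman C) \<Longrightarrow> \<phi> x \<in> points (cman D)"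
    using openin_subset[OF 1(2)] by blast
qed

lemma is_orbifoldD:
  assumes "is_orbifold Q"
  shows "Hausdorff_space (otop Q)"
    "c \<in> charts Q \<Longrightarrow> is_orbichart (otop Q) (chart Q c)"
    "i \<in> injs Q \<Longrightarrow> isrc Q i \<in> charts Q" "i \<in> injs Q \<Longrightarrow> itgt Q i \<in> charts Q"
    "i \<in> injs Q \<Longrightarrow> chart_injection (chart Q (isrc Q i)) (chart Q (itgt Q i)) (iemb Q i) (ihom Q i)"
    "c \<in> charts Q \<Longrightarrow> \<exists>i\<in>injs Q. inj_identity Q c i"
    "i \<in> injs Q \<Longrightarrow> j \<in> injs Q \<Longrightarrow> itgt Q i = isrc Q j \<Longrightarrow> \<exists>k\<in>injs Q. inj_composite Q j i k"
  using assms unfolding is_orbifold_def by blast+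

lemma vector_bundleD:
  assumes "vector_bundle Q E"
  shows "is_orbifold Q" "compatible_cover Q (bcover E)" "Hausdorff_space (btop E)"
    "continuous_map (btop E) (otop Q) (bproj E)"
    "c \<in> bcover E \<Longrightarrow> is_orbichart (btop E) (bchart Q E c)"
    "c \<in> bcover E \<Longrightarrow> chart_image (bchart Q E c) =
      {e \<in> topspace (btop E). bproj E e \<in> chart_image (chart Q c)}"
    "c \<in> bcover E \<Longrightarrow> x \<in> cpoints Q c \<Longrightarrow> bproj E (bpi E c (x, v)) = cproj (chart Q c) x"
    "c \<in> bcover E \<Longrightarrow> h \<in> carrier (cgroup Q c) \<Longrightarrow> x \<in> cpoints Q c \<Longrightarrow>
      fst (bact E c h (x, v)) = cact (chart Q c) h x"
    "c \<in> bcover E \<Longrightarrow> h \<in> carrier (cgroup Q c) \<Longrightarrow> x \<in> cpoints Q c \<Longrightarrow>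
      linear (\<lambda>v. snd (bact E c h (x, v)))"
    "i \<in> injs_over Q (bcover E) \<Longrightarrow>
      smooth_map (cman (chart Q (isrc Q i))) euclidean_manifold (btrans E i)"
    "i \<in> injs_over Q (bcover E) \<Longrightarrow> x \<in> cpoints Q (isrc Q i) \<Longrightarrow> invertible (btrans E i x)"
    "i \<in> injs_over Q (bcover E) \<Longrightarrow>
      chart_injection (bchart Q E (isrc Q i)) (bchart Q E (itgt Q i)) (bemb Q E i) (ihom Q i)"
    "i \<in> injs_over Q (bcover E) \<Longrightarrow> j \<in> injs_over Q (bcover E) \<Longrightarrow> k \<in> injs_over Q (bcover E) \<Longrightarrow>
      inj_composite Q j i k \<Longrightarrow> x \<in> cpoints Q (isrc Q i) \<Longrightarrow>
      btrans E k x = btrans E j (iemb Q i x) ** btrans E i x"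
proof -
  show "is_orbifold Q" "compatible_cover Q (bcover E)" "Hausdorff_space (btop E)"
    "continuous_map (btop E) (otop Q) (bproj E)"
    using assms unfolding vector_bundle_def by blast+
  show "c \<in> bcover E \<Longrightarrow> is_orbichart (btop E) (bchart Q E c)"
    "c \<in> bcover E \<Longrightarrow> chart_image (bchart Q E c) =
      {e \<in> topspace (btop E). bproj E e \<in> chart_image (chart Q c)}"
    "c \<in> bcover E \<Longrightarrow> x \<in> cpoints Q c \<Longrightarrow> bproj E (bpi E c (x, v)) = cproj (chart Q c) x"
    "c \<in> bcover E \<Longrightarrow> h \<in> carrier (cgroup Q c) \<Longrightarrow> x \<in> cpoints Q c \<Longrightarrow>
      fst (bact E c h (x, v)) = cact (chart Q c) h x"
    "c \<in> bcover E \<Longrightarrow> h \<in> carrier (cgroup Q c) \<Longrightarrow> x \<in> cpoints Q c \<Longrightarrow>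
      linear (\<lambda>v. snd (bact E c h (x, v)))"
    using assms unfolding vector_bundle_def by blast+
  show "i \<in> injs_over Q (bcover E) \<Longrightarrow>
      smooth_map (cman (chart Q (isrc Q i))) euclidean_manifold (btrans E i)"
    "i \<in> injs_over Q (bcover E) \<Longrightarrow> x \<in> cpoints Q (isrc Q i) \<Longrightarrow> invertible (btrans E i x)"
    "i \<in> injs_over Q (bcover E) \<Longrightarrow>
      chart_injection (bchart Q E (isrc Q i)) (bchart Q E (itgt Q i)) (bemb Q E i) (ihom Q i)"
    "i \<in> injs_over Q (bcover E) \<Longrightarrow> j \<in> injs_over Q (bcover E) \<Longrightarrow> k \<in> injs_over Q (bcover E) \<Longrightarrow>
      inj_composite Q j i k \<Longrightarrow> x \<in> cpoints Q (isrc Q i) \<Longrightarrow>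
      btrans E k x = btrans E j (iemb Q i x) ** btrans E i x"
    using assms unfolding vector_bundle_def by blast+
qed

lemma compatible_coverD:
  assumes "compatible_cover Q A"
  shows "c \<in> A \<Longrightarrow> c \<in> charts Q" "(\<Union>c\<in>A. chart_image (chart Q c)) = topspace (otop Q)"
    "a \<in> A \<Longrightarrow> b \<in> A \<Longrightarrow> p \<in> chart_image (chart Q a) \<Longrightarrow> p \<in> chart_image (chart Q b) \<Longrightarrow>
      \<exists>i\<in>injs_over Q A. \<exists>j\<in>injs_over Q A. isrc Q i = isrc Q j \<and> itgt Q i = a \<and> itgt Q j = b \<and>
          p \<in> chart_image (chart Q (isrc Q i))"
  using assms unfolding compatible_cover_def by blast+

lemma injs_overD:
  assumes "i \<in> injs_over Q A"
  shows "i \<in> injs Q" "isrc Q i \<in> A" "itgt Q i \<in> A"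
  using assms by (auto simp: injs_over_def)

text \<open>
  Continuity out of an orbifold or a bundle can be checked in charts, these being quotient maps onto the
  members of an open cover.
\<close>

lemma continuous_map_from_quotient_charts:
  assumes op: "\<And>c. c \<in> A \<Longrightarrow> openin Y (f c ` topspace (X c))"
    and cov: "(\<Union>c\<in>A. f c ` topspace (X c)) = topspace Y"
    and quo: "\<And>c. c \<in> A \<Longrightarrow> quotient_map (X c) (subtopology Y (f c ` topspace (X c))) (f c)"
    and cont: "\<And>c. c \<in> A \<Longrightarrow> continuous_map (X c) Z (\<lambda>x. g (f c x))"
  shows "continuous_map Y Z g"
proof -
  have loc: "continuous_map (subtopology Y (f c ` topspace (X c))) Z g" if "c \<in> A" for c
    by (rule continuous_compose_quotient_map[OF quo[OF that]]) (use cont[OF that] in \<open>simp add: o_def\<close>)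
  show ?thesis
    unfolding continuous_map_def
  proof (intro conjI allI impI)
    show "g \<in> topspace Y \<rightarrow> topspace Z"
    proof
      fix y assume "y \<in> topspace Y"
      then obtain c where c: "c \<in> A" "y \<in> f c ` topspace (X c)" using cov by blast
      then have "y \<in> topspace (subtopology Y (f c ` topspace (X c)))"
        using \<open>y \<in> topspace Y\<close> by simp
      then show "g y \<in> topspace Z"
        using loc[OF c(1)] unfolding continuous_map_def by blast
    qed
    fix U assume U: "openin Z U"
    have "openin Y {y \<in> topspace (subtopology Y (f c ` topspace (X c))). g y \<in> U}" if "c \<in> A" for c
      using openin_continuous_map_preimage[OF loc[OF that] U] op[OF that] openin_trans_full by blast
    then have "openin Y (\<Union>c\<in>A. {y \<in> topspace (subtopology Y (f c ` topspace (X c))). g y \<in> U})"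
      by blast
    moreover have "(\<Union>c\<in>A. {y \<in> topspace (subtopology Y (f c ` topspace (X c))). g y \<in> U}) =
        {y \<in> topspace Y. g y \<in> U}"
      unfolding topspace_subtopology cov[symmetric] by blast
    ultimately show "openin Y {y \<in> topspace Y. g y \<in> U}" by simp
  qed
qed

lemma bchart_simps [simp]:
  "cman (bchart Q E c) = prod_manifold (cman (chart Q c)) euclidean_manifold"
  "cgrp (bchart Q E c) = cgroup Q c" "cact (bchart Q E c) = bact E c" "cproj (bchart Q E c) = bpi E c"
  by (simp_all add: bchart_def)

lemma bemb_apply [simp]: "bemb Q E i (x, v) = (iemb Q i x, btrans E i x *v v)"
  by (simp add: bemb_def)

section \<open>The total space as an orbifold\<close>

locale orbi_bundle =
  fixes Q :: "('q, 'c, 'i, 'v, 'm::{real_normed_vector, heine_borel}, 'g) orbifold"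
    and E :: "('e, 'q, 'c, 'i, 'v, 'g, 'k::finite) vbundle"
  assumes vector_bundle: "vector_bundle Q E"
begin

lemmas base_orbifold = vector_bundleD(1)[OF vector_bundle]
lemmas cover = vector_bundleD(2)[OF vector_bundle]
lemmas cover_chart = compatible_coverD(1)[OF cover]
lemmas base_chart = is_orbifoldD(2)[OF base_orbifold cover_chart]
lemmas total_chart = vector_bundleD(5)[OF vector_bundle]
lemmas base_manifold = is_orbichartD(1)[OF base_chart]

lemma bpi_eq_iff:
  assumes "c \<in> bcover E" "x \<in> cpoints Q c" "y \<in> cpoints Q c"
  shows "bpi E c (x, v) = bpi E c (y, w) \<longleftrightarrow> (\<exists>h\<in>carrier (cgroup Q c). bact E c h (x, v) = (y, w))"
  using is_orbichartD(9)[OF total_chart[OF assms(1)], of "(x, v)" "(y, w)"] assms by simp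

lemma cact_in_points:
  assumes "c \<in> bcover E" "h \<in> carrier (cgroup Q c)" "x \<in> cpoints Q c"
  shows "cact (chart Q c) h x \<in> cpoints Q c"
  using is_orbichartD(10)[OF base_chart] assms by blast

lemma bact_eq:
  assumes "c \<in> bcover E" "h \<in> carrier (cgroup Q c)" "x \<in> cpoints Q c"
  shows "bact E c h (x, v) = (cact (chart Q c) h x, snd (bact E c h (x, v)))"
  using vector_bundleD(8)[OF vector_bundle assms] by (metis prod.collapse)

lemma total_action:
  assumes "c \<in> bcover E"
  shows "group_action (cgroup Q c) (cpoints Q c \<times> UNIV) (bact E c)"
  using is_orbichartD(5)[OF total_chart[OF assms]] by simp

lemma bact_bij:
  assumes "c \<in> bcover E" "h \<in> carrier (cgroup Q c)" "x \<in> cpoints Q c"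
  shows "inj (\<lambda>v. snd (bact E c h (x, v)))" "surj (\<lambda>v. snd (bact E c h (x, v)))"
proof -
  show inj: "inj (\<lambda>v. snd (bact E c h (x, v)))"
  proof (rule injI)
    fix v w assume "snd (bact E c h (x, v)) = snd (bact E c h (x, w))"
    then have "bact E c h (x, v) = bact E c h (x, w)"
      by (metis bact_eq[OF assms])
    then show "v = w"
      using group_action.inj_prop[OF total_action[OF assms(1)] assms(2)] assms(3)
      by (simp add: inj_on_def)
  qed
  show "surj (\<lambda>v. snd (bact E c h (x, v)))"
    by (rule linear_inj_imp_surj[OF vector_bundleD(9)[OF vector_bundle assms] inj])
qed

lemma bact_zero:
  assumes "c \<in> bcover E" "h \<in> carrier (cgroup Q c)" "x \<in> cpoints Q c"
  shows "bact E c h (x, 0) = (cact (chart Q c) h x, 0)"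
  using bact_eq[OF assms, of 0] linear_0[OF vector_bundleD(9)[OF vector_bundle assms]] by simp

lemma bpi_bemb:
  assumes "i \<in> injs_over Q (bcover E)" "x \<in> cpoints Q (isrc Q i)"
  shows "bpi E (itgt Q i) (iemb Q i x, btrans E i x *v v) = bpi E (isrc Q i) (x, v)"
  using chart_injectionD(3)[OF vector_bundleD(12)[OF vector_bundle assms(1)], of "(x, v)"] assms(2)
  by simp

lemma base_injection:
  assumes "i \<in> injs_over Q (bcover E)"
  shows "chart_injection (chart Q (isrc Q i)) (chart Q (itgt Q i)) (iemb Q i) (ihom Q i)"
  using is_orbifoldD(5)[OF base_orbifold] injs_overD(1)[OF assms] by blast

lemma iemb_in_points:
  assumes "i \<in> injs_over Q (bcover E)" "x \<in> cpoints Q (isrc Q i)"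
  shows "iemb Q i x \<in> cpoints Q (itgt Q i)"
  using chart_injectionD(8)[OF base_injection] assms by blast

lemma cproj_iemb:
  assumes "i \<in> injs_over Q (bcover E)" "x \<in> cpoints Q (isrc Q i)"
  shows "cproj (chart Q (itgt Q i)) (iemb Q i x) = cproj (chart Q (isrc Q i)) x"
  using chart_injectionD(3)[OF base_injection] assms by blast

lemma btrans_bij:
  assumes "i \<in> injs_over Q (bcover E)" "x \<in> cpoints Q (isrc Q i)"
  obtains B where "\<And>v. btrans E i x *v (B *v v) = v" "\<And>v. B *v (btrans E i x *v v) = v"
proof -
  obtain B where "btrans E i x ** B = mat 1" "B ** btrans E i x = mat 1"
    using vector_bundleD(11)[OF vector_bundle assms] unfolding invertible_def by blast
  then show ?thesis
    by (intro that[of B]) (simp_all add: matrix_vector_mul_assoc)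
qed

text \<open>
  Near a common point of the base, the charts \<open>a\<close> and \<open>b\<close> both receive an injection from a third chart.
  The point \<open>y\<close> in \<open>b\<close> is hit only up to the group element \<open>h\<close>, because points of one chart with the
  same image in \<open>Q\<close> agree only up to the local group.
\<close>

lemma common_chart:
  assumes "a \<in> bcover E" "b \<in> bcover E" "x \<in> cpoints Q a" "y \<in> cpoints Q b"
    "cproj (chart Q a) x = cproj (chart Q b) y"
  obtains i j z h where "i \<in> injs_over Q (bcover E)" "j \<in> injs_over Q (bcover E)"
    "isrc Q i = isrc Q j" "itgt Q i = a" "itgt Q j = b" "z \<in> cpoints Q (isrc Q i)"
    "h \<in> carrier (cgroup Q b)" "cact (chart Q b) h (iemb Q j z) = y"
proof -
  have "cproj (chart Q a) x \<in> chart_image (chart Q a)" "cproj (chart Q a) x \<in> chart_image (chart Q b)"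
    unfolding chart_image_def using imageI[OF assms(3)] imageI[OF assms(4)] assms(5) by metis+
  then obtain i j where ij: "i \<in> injs_over Q (bcover E)" "j \<in> injs_over Q (bcover E)"
    "isrc Q i = isrc Q j" "itgt Q i = a" "itgt Q j = b"
    "cproj (chart Q a) x \<in> chart_image (chart Q (isrc Q i))"
    using compatible_coverD(3)[OF cover assms(1,2)] by blast
  then obtain z where z: "z \<in> cpoints Q (isrc Q i)" "cproj (chart Q (isrc Q i)) z = cproj (chart Q a) x"
    by (auto simp: chart_image_def)
  have zj: "z \<in> cpoints Q (isrc Q j)" using z(1) ij(3) by simp
  have "cproj (chart Q b) (iemb Q j z) = cproj (chart Q b) y"
    using cproj_iemb[OF ij(2) zj] ij(3,5) z(2) assms(5) by simp
  then obtain h where "h \<in> carrier (cgroup Q b)" "cact (chart Q b) h (iemb Q j z) = y"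
    using is_orbichartD(9)[OF base_chart[OF assms(2)], of "iemb Q j z" y]
      iemb_in_points[OF ij(2) zj] ij(5) assms(4) by auto
  then show ?thesis using that ij(1-5) z(1) by blast
qed

definition total_space :: "('e, 'c, 'i, 'v \<times> (real ^ 'k), 'm \<times> (real ^ 'k), 'g) orbifold" where
  "total_space = \<lparr>otop = btop E, charts = bcover E, chart = bchart Q E,
     injs = injs_over Q (bcover E), isrc = isrc Q, itgt = itgt Q, iemb = bemb Q E, ihom = ihom Q\<rparr>"

lemma total_space_simps [simp]:
  "otop total_space = btop E" "charts total_space = bcover E" "chart total_space = bchart Q E"
  "injs total_space = injs_over Q (bcover E)" "isrc total_space = isrc Q" "itgt total_space = itgt Q"
  "iemb total_space = bemb Q E" "ihom total_space = ihom Q"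
  by (simp_all add: total_space_def)

lemma injs_over_total_space [simp]: "injs_over total_space (bcover E) = injs_over Q (bcover E)"
  by (auto simp: injs_over_def)

text \<open>
  The cocycle condition makes composites of injections of \<open>Q\<close> composites for the total space; the
  converse is seen on the zero section.
\<close>

lemma inj_composite_total_space:
  assumes i: "i \<in> injs_over Q (bcover E)" and j: "j \<in> injs_over Q (bcover E)"
    and k: "k \<in> injs_over Q (bcover E)"
  shows "inj_composite total_space j i k \<longleftrightarrow> inj_composite Q j i k"
proof
  assume c: "inj_composite Q j i k"
  then show "inj_composite total_space j i k"
    using vector_bundleD(13)[OF vector_bundle i j k c]
    by (auto simp: inj_composite_def matrix_vector_mul_assoc)
next
  assume c: "inj_composite total_space j i k"
  have "iemb Q k x = iemb Q j (iemb Q i x)" if "x \<in> cpoints Q (isrc Q i)" for x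
  proof -
    have "bemb Q E k (x, 0) = bemb Q E j (bemb Q E i (x, 0))"
      using c that unfolding inj_composite_def total_space_simps bchart_simps by simp
    then show ?thesis by simp
  qed
  then show "inj_composite Q j i k"
    using c by (simp add: inj_composite_def)
qed

text \<open>
  An identity injection \<open>i\<close> is its own composite with itself, so the cocycle condition gives
  \<open>g\<^sub>i = g\<^sub>i g\<^sub>i\<close>, and an invertible idempotent is the identity.
\<close>

lemma inj_identity_total_space:
  assumes i: "i \<in> injs_over Q (bcover E)" and id: "inj_identity Q c i"
  shows "inj_identity total_space c i"
proof -
  have src: "isrc Q i = c" "itgt Q i = c" using id by (auto simp: inj_identity_def)
  have "inj_composite Q i i i"
    using id by (simp add: inj_identity_def inj_composite_def)
  have "btrans E i x = mat 1" if x: "x \<in> cpoints Q c" for x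
  proof -
    obtain B where B: "B ** btrans E i x = mat 1"
      using vector_bundleD(11)[OF vector_bundle i] x src unfolding invertible_def by blast
    have ix: "iemb Q i x = x" using id x by (simp add: inj_identity_def)
    have "btrans E i x = btrans E i x ** btrans E i x"
      using vector_bundleD(13)[OF vector_bundle i i i \<open>inj_composite Q i i i\<close>, of x] x src ix by simp
    then have "B ** btrans E i x = (B ** btrans E i x) ** btrans E i x"
      by (metis matrix_mul_assoc)
    then show ?thesis by (simp add: B)
  qed
  then show ?thesis
    using id by (simp add: inj_identity_def matrix_vector_mul_lid)
qed

lemma total_compatible_cover: "compatible_cover total_space (bcover E)"
  unfolding compatible_cover_def injs_over_total_space total_space_simps
proof (intro conjI ballI)
  show "(\<Union>c\<in>bcover E. chart_image (bchart Q E c)) = topspace (btop E)"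
  proof (intro equalityI subsetI)
    fix e assume e: "e \<in> topspace (btop E)"
    then have "bproj E e \<in> topspace (otop Q)"
      using continuous_map_image_subset_topspace[OF vector_bundleD(4)[OF vector_bundle]] by blast
    then obtain c where c: "c \<in> bcover E" "bproj E e \<in> chart_image (chart Q c)"
      using compatible_coverD(2)[OF cover] by blast
    then show "e \<in> (\<Union>c\<in>bcover E. chart_image (bchart Q E c))"
      using e vector_bundleD(6)[OF vector_bundle] by blast
  qed (use vector_bundleD(6)[OF vector_bundle] in blast)
  fix a b e assume ab: "a \<in> bcover E" "b \<in> bcover E"
    and "e \<in> chart_image (bchart Q E a) \<inter> chart_image (bchart Q E b)"
  then have e: "e \<in> topspace (btop E)" "bproj E e \<in> chart_image (chart Q a)" "bproj E e \<in> chart_image (chart Q b)"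
    using vector_bundleD(6)[OF vector_bundle] by auto
  obtain i j where ij: "i \<in> injs_over Q (bcover E)" "j \<in> injs_over Q (bcover E)" "isrc Q i = isrc Q j"
      "itgt Q i = a" "itgt Q j = b" "bproj E e \<in> chart_image (chart Q (isrc Q i))"
    using compatible_coverD(3)[OF cover ab e(2,3)] by blast
  have "e \<in> chart_image (bchart Q E (isrc Q i))"
    unfolding vector_bundleD(6)[OF vector_bundle injs_overD(2)[OF ij(1)]] using e(1) ij(6) by simp
  then show "\<exists>i\<in>injs_over Q (bcover E). \<exists>j\<in>injs_over Q (bcover E).
      isrc Q i = isrc Q j \<and> itgt Q i = a \<and> itgt Q j = b \<and> e \<in> chart_image (bchart Q E (isrc Q i))"
    using ij(3-5) by (intro bexI[OF _ ij(1)] bexI[OF _ ij(2)]) simp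
qed simp

lemma is_orbifold_total_space: "is_orbifold total_space"
  unfolding is_orbifold_def total_space_simps
proof (intro conjI ballI impI total_compatible_cover vector_bundleD(3)[OF vector_bundle]
    vector_bundleD(5,12)[OF vector_bundle] injs_overD(2,3)[of _ Q])
  fix c assume c: "c \<in> bcover E"
  then obtain i where i: "i \<in> injs Q" "inj_identity Q c i"
    using is_orbifoldD(6)[OF base_orbifold] cover_chart by blast
  then have "i \<in> injs_over Q (bcover E)"
    using c by (simp add: injs_over_def inj_identity_def)
  then show "\<exists>i\<in>injs_over Q (bcover E). inj_identity total_space c i"
    using inj_identity_total_space i(2) by blast
next
  fix i j assume i: "i \<in> injs_over Q (bcover E)" and j: "j \<in> injs_over Q (bcover E)"
    and "itgt Q i = isrc Q j"
  then obtain k where k: "k \<in> injs Q" "inj_composite Q j i k"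
    using is_orbifoldD(7)[OF base_orbifold] injs_overD(1) by metis
  then have "k \<in> injs_over Q (bcover E)"
    using i j by (simp add: injs_over_def inj_composite_def)
  then show "\<exists>k\<in>injs_over Q (bcover E). inj_composite total_space j i k"
    using inj_composite_total_space[OF i j] k(2) by blast
qed

section \<open>The base as the zero section of the total space\<close>

lemma bpi_zero_eq_same_chart:
  assumes "c \<in> bcover E" "x \<in> cpoints Q c" "y \<in> cpoints Q c"
    "cproj (chart Q c) x = cproj (chart Q c) y"
  shows "bpi E c (x, 0) = bpi E c (y, 0)"
proof -
  obtain h where "h \<in> carrier (cgroup Q c)" "cact (chart Q c) h x = y"
    using is_orbichartD(9)[OF base_chart[OF assms(1)] assms(2,3)] assms(4) by blast
  then show ?thesis
    using bpi_eq_iff[OF assms(1-3)] bact_zero[OF assms(1) _ assms(2)] by auto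
qed

text \<open>
  The zero section is well defined: zero vectors are fixed by group elements and by transition maps, and
  these relate any two charts over the same point of \<open>Q\<close>.
\<close>

lemma bpi_zero_eq:
  assumes "c \<in> bcover E" "d \<in> bcover E" "x \<in> cpoints Q c" "y \<in> cpoints Q d"
    "cproj (chart Q c) x = cproj (chart Q d) y"
  shows "bpi E c (x, 0) = bpi E d (y, 0)"
proof -
  obtain i j z h where ij: "i \<in> injs_over Q (bcover E)" "j \<in> injs_over Q (bcover E)"
    "isrc Q i = isrc Q j" "itgt Q i = c" "itgt Q j = d" "z \<in> cpoints Q (isrc Q i)"
    "h \<in> carrier (cgroup Q d)" "cact (chart Q d) h (iemb Q j z) = y"
    using common_chart[OF assms] by blast
  have zj: "z \<in> cpoints Q (isrc Q j)" using ij by simp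
  have yj: "cproj (chart Q d) (iemb Q j z) = cproj (chart Q d) y"
    using is_orbichartD(9)[OF base_chart[OF assms(2)] _ assms(4)] iemb_in_points[OF ij(2) zj] ij(5,7,8)
    by blast
  then have xi: "cproj (chart Q c) (iemb Q i z) = cproj (chart Q c) x"
    using cproj_iemb[OF ij(1,6)] cproj_iemb[OF ij(2) zj] ij(3-5) assms(5) by simp
  have "bpi E c (x, 0) = bpi E c (iemb Q i z, 0)"
    using bpi_zero_eq_same_chart[OF assms(1) _ assms(3) xi] iemb_in_points[OF ij(1,6)] ij(4) by simp
  also have "\<dots> = bpi E d (iemb Q j z, 0)"
    using bpi_bemb[OF ij(1,6), of 0] bpi_bemb[OF ij(2) zj, of 0] ij(3-5) by simp
  also have "\<dots> = bpi E d (y, 0)"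
    using bpi_zero_eq_same_chart[OF assms(2) _ assms(4) yj] iemb_in_points[OF ij(2) zj] ij(5) by simp
  finally show ?thesis .
qed

definition zero_section :: "'q \<Rightarrow> 'e" where
  "zero_section q = (SOME e. \<exists>c\<in>bcover E. \<exists>x\<in>cpoints Q c. cproj (chart Q c) x = q \<and> e = bpi E c (x, 0))"

lemma zero_section_cproj:
  assumes "c \<in> bcover E" "x \<in> cpoints Q c"
  shows "zero_section (cproj (chart Q c) x) = bpi E c (x, 0)"
  unfolding zero_section_def
proof (rule some_equality)
  show "\<exists>d\<in>bcover E. \<exists>y\<in>cpoints Q d. cproj (chart Q d) y = cproj (chart Q c) x \<and> bpi E c (x, 0) = bpi E d (y, 0)"
    using assms by blast
next
  fix e assume "\<exists>d\<in>bcover E. \<exists>y\<in>cpoints Q d. cproj (chart Q d) y = cproj (chart Q c) x \<and> e = bpi E d (y, 0)"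
  then show "e = bpi E c (x, 0)"
    using bpi_zero_eq assms by metis
qed

lemma base_cover_cases:
  assumes "q \<in> topspace (otop Q)"
  obtains c x where "c \<in> bcover E" "x \<in> cpoints Q c" "q = cproj (chart Q c) x"
  using assms compatible_coverD(2)[OF cover] unfolding chart_image_def by blast

lemma total_cover_cases:
  assumes "e \<in> topspace (btop E)"
  obtains c x v where "c \<in> bcover E" "x \<in> cpoints Q c" "e = bpi E c (x, v)"
proof -
  obtain c where "c \<in> bcover E" "e \<in> chart_image (bchart Q E c)"
    using compatible_coverD(2)[OF total_compatible_cover] assms by auto
  then show ?thesis using that by (auto simp: chart_image_def)
qed

lemma continuous_zero_section: "continuous_map (otop Q) (btop E) zero_section"
proof (rule continuous_map_from_quotient_charts[where A = "bcover E"
      and f = "\<lambda>c. cproj (chart Q c)" and X = "\<lambda>c. mtop (cman (chart Q c))"])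
  show "(\<Union>c\<in>bcover E. cproj (chart Q c) ` cpoints Q c) = topspace (otop Q)"
    using compatible_coverD(2)[OF cover] by (simp add: chart_image_def)
  fix c assume c: "c \<in> bcover E"
  show "openin (otop Q) (cproj (chart Q c) ` cpoints Q c)"
    "quotient_map (mtop (cman (chart Q c))) (subtopology (otop Q) (cproj (chart Q c) ` cpoints Q c)) (cproj (chart Q c))"
    using is_orbichartD(7,8)[OF base_chart[OF c]] by (simp_all add: chart_image_def)
  have "continuous_map (mtop (cman (chart Q c))) (prod_topology (mtop (cman (chart Q c))) euclidean) (\<lambda>x. (x, 0))"
    by (simp add: continuous_map_pairedI)
  moreover have "continuous_map (prod_topology (mtop (cman (chart Q c))) euclidean) (btop E) (bpi E c)"
    using quotient_imp_continuous_map[OF is_orbichartD(8)[OF total_chart[OF c]]]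
    by (simp add: continuous_map_in_subtopology)
  ultimately have "continuous_map (mtop (cman (chart Q c))) (btop E) (\<lambda>x. bpi E c (x, 0))"
    using continuous_map_compose by (fastforce simp: o_def)
  then show "continuous_map (mtop (cman (chart Q c))) (btop E) (\<lambda>x. zero_section (cproj (chart Q c) x))"
    by (rule continuous_map_eq) (simp add: zero_section_cproj[OF c])
qed

lemma bproj_zero_section:
  assumes "q \<in> topspace (otop Q)"
  shows "bproj E (zero_section q) = q"
  using assms
  by (rule base_cover_cases) (simp add: zero_section_cproj vector_bundleD(7)[OF vector_bundle])

lemma embedding_zero_section: "embedding_map (otop Q) (btop E) zero_section"
proof (rule section_imp_embedding_map)
  show "section_map (otop Q) (btop E) zero_section"
    unfolding section_map_def retraction_maps_def
    using continuous_zero_section vector_bundleD(4)[OF vector_bundle] bproj_zero_section by blast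
qed

text \<open>
  A group element that moves \<open>(x, v)\<close> to \<open>(x, 0)\<close> acts on the fibre by an injective linear map, so
  \<open>v = 0\<close>. Thus the zero section meets the chart in \<open>V \<times> {0}\<close> only.
\<close>

lemma bpi_in_zero_section_iff:
  assumes c: "c \<in> bcover E" and x: "x \<in> cpoints Q c"
  shows "bpi E c (x, v) \<in> zero_section ` topspace (otop Q) \<longleftrightarrow> v = 0"
proof
  assume "bpi E c (x, v) \<in> zero_section ` topspace (otop Q)"
  then obtain q where q: "q \<in> topspace (otop Q)" "bpi E c (x, v) = zero_section q" by blast
  have "cproj (chart Q c) x = q"
    using vector_bundleD(7)[OF vector_bundle c x, of v] q(2) bproj_zero_section[OF q(1)] by simp
  then have "bpi E c (x, v) = bpi E c (x, 0)"
    using zero_section_cproj[OF c x] q(2) by simp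
  then obtain h where h: "h \<in> carrier (cgroup Q c)" "bact E c h (x, v) = (x, 0)"
    using bpi_eq_iff[OF c x x] by blast
  then have "snd (bact E c h (x, v)) = snd (bact E c h (x, 0))"
    using bact_zero[OF c h(1) x] by simp
  then show "v = 0" using injD[OF bact_bij(1)[OF c h(1) x]] by blast
next
  assume "v = 0"
  moreover have "cproj (chart Q c) x \<in> topspace (otop Q)"
    using is_orbichartD(11)[OF base_chart[OF c] x] .
  ultimately show "bpi E c (x, v) \<in> zero_section ` topspace (otop Q)"
    using zero_section_cproj[OF c x] by (metis image_eqI)
qed

definition zero_suborbifold ::
  "('q, 'c, 'i, 'v, 'e, 'c, 'i, 'v \<times> (real ^ 'k)) suborb" where
  "zero_suborbifold = \<lparr>sincl = zero_section, scover = bcover E, samb = (\<lambda>c. c),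
     semb = (\<lambda>c x. (x, 0)), slift = (\<lambda>i. i)\<rparr>"

lemma zero_suborbifold_simps [simp]:
  "sincl zero_suborbifold = zero_section" "scover zero_suborbifold = bcover E"
  "samb zero_suborbifold c = c" "semb zero_suborbifold c x = (x, 0)" "slift zero_suborbifold i = i"
  by (simp_all add: zero_suborbifold_def)

lemma inj_restricts_zero_suborbifold: "inj_restricts Q total_space zero_suborbifold i i"
  by (simp add: inj_restricts_def)

lemma is_suborbifold_zero_suborbifold: "is_suborbifold Q total_space zero_suborbifold"
  unfolding is_suborbifold_def zero_suborbifold_simps total_space_simps bchart_simps
proof (intro conjI ballI impI base_orbifold is_orbifold_total_space embedding_zero_section cover
    inj_restricts_zero_suborbifold refl)
  fix c assume c: "c \<in> bcover E"
  show "smooth_embedding (cman (chart Q c)) (prod_manifold (cman (chart Q c)) euclidean_manifold)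
      (\<lambda>x. (x, 0 :: real ^ 'k))"
    by (rule smooth_embedding_zero_section[OF base_manifold[OF c]])
  show "(cact (chart Q c) h x, 0) = bact E c h (x, 0)"
    if "h \<in> carrier (cgroup Q c)" "x \<in> cpoints Q c" for h x
    using bact_zero[OF c that] by simp
  show "bpi E c (x, 0) = zero_section (cproj (chart Q c) x)" if "x \<in> cpoints Q c" for x
    using zero_section_cproj[OF c that] by simp
next
  fix i j k assume "i \<in> injs_over Q (bcover E)" "j \<in> injs_over Q (bcover E)" "k \<in> injs_over Q (bcover E)"
    "inj_composite Q j i k"
  then show "inj_composite total_space j i k"
    using inj_composite_total_space by blast
next
  fix a b j assume j: "j \<in> injs_over Q (bcover E)"
    and "isrc Q j = a \<and> itgt Q j = b \<and>
      bemb Q E j ` (\<lambda>x. (x, 0)) ` cpoints Q a \<subseteq> (\<lambda>x. (x, 0)) ` cpoints Q b"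
  then show "\<exists>i\<in>injs Q. isrc Q i = a \<and> itgt Q i = b \<and> inj_restricts Q total_space zero_suborbifold j i"
    by (intro bexI[OF _ injs_overD(1)[OF j]]) (simp add: inj_restricts_zero_suborbifold)
qed simp_all

end

text \<open>
  Bijectivity of the single transformations comes from the inverses in the group.
\<close>

lemma group_actionI:
  assumes G: "group G"
    and ext: "\<And>g. g \<in> carrier G \<Longrightarrow> \<phi> g \<in> extensional X"
    and closed: "\<And>g x. g \<in> carrier G \<Longrightarrow> x \<in> X \<Longrightarrow> \<phi> g x \<in> X"
    and one: "\<And>x. x \<in> X \<Longrightarrow> \<phi> \<one>\<^bsub>G\<^esub> x = x"
    and mult: "\<And>g h x. g \<in> carrier G \<Longrightarrow> h \<in> carrier G \<Longrightarrow> x \<in> X \<Longrightarrow> \<phi> (g \<otimes>\<^bsub>G\<^esub> h) x = \<phi> g (\<phi> h x)"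
  shows "group_action G X \<phi>"
proof -
  interpret group G by (rule G)
  have inv: "\<phi> (inv\<^bsub>G\<^esub> g) (\<phi> g x) = x" "\<phi> g (\<phi> (inv\<^bsub>G\<^esub> g) x) = x" if "g \<in> carrier G" "x \<in> X" for g x
    using mult[of "inv\<^bsub>G\<^esub> g" g x] mult[of g "inv\<^bsub>G\<^esub> g" x] one that by simp_all
  have Bij: "\<phi> g \<in> Bij X" if g: "g \<in> carrier G" for g
  proof -
    have "bij_betw (\<phi> g) X X"
      by (rule bij_betw_byWitness[where f' = "\<phi> (inv\<^bsub>G\<^esub> g)"]) (use g inv closed in auto)
    then show ?thesis using ext[OF g] by (simp add: Bij_def)
  qed
  have "\<phi> (g \<otimes>\<^bsub>G\<^esub> h) = compose X (\<phi> g) (\<phi> h)" if "g \<in> carrier G" "h \<in> carrier G" for g h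
    by (rule extensionalityI[of _ X]) (use that ext mult in \<open>auto simp: compose_eq\<close>)
  then have "\<phi> \<in> hom G (BijGroup X)"
    using Bij by (auto simp: hom_def BijGroup_def)
  then have "group_hom G (BijGroup X) \<phi>"
    using G group_BijGroup by (simp add: group_hom_def group_hom_axioms_def)
  then show ?thesis by (rule group_action.intro)
qed

lemma group_action_open_map:
  assumes act: "group_action G (topspace X) \<phi>"
    and cont: "\<And>g. g \<in> carrier G \<Longrightarrow> continuous_map X X (\<phi> g)"
    and g: "g \<in> carrier G" and U: "openin X U"
  shows "openin X (\<phi> g ` U)"
proof -
  interpret group_action G "topspace X" \<phi> by (rule act)
  interpret group G using group_hom group_hom.axioms(1) by blast
  have ig: "inv\<^bsub>G\<^esub> g \<in> carrier G" using g by simp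
  have "\<phi> g ` U = {y \<in> topspace X. \<phi> (inv\<^bsub>G\<^esub> g) y \<in> U}"
  proof (intro equalityI subsetI)
    fix y assume "y \<in> \<phi> g ` U"
    then obtain x where x: "x \<in> U" "y = \<phi> g x" by blast
    then have "x \<in> topspace X" using openin_subset[OF U] by blast
    then show "y \<in> {y \<in> topspace X. \<phi> (inv\<^bsub>G\<^esub> g) y \<in> U}"
      using orbit_sym_aux[OF g _ x(2)[symmetric]] element_image[OF g _ x(2)[symmetric]] x by simp
  next
    fix y assume y: "y \<in> {y \<in> topspace X. \<phi> (inv\<^bsub>G\<^esub> g) y \<in> U}"
    then have "\<phi> (inv\<^bsub>G\<^esub> (inv\<^bsub>G\<^esub> g)) (\<phi> (inv\<^bsub>G\<^esub> g) y) = y"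
      using orbit_sym_aux[OF ig _ refl] by blast
    then show "y \<in> \<phi> g ` U"
      using y g by (metis (mono_tags, lifting) image_eqI inv_inv mem_Collect_eq)
  qed
  then show ?thesis
    using openin_continuous_map_preimage[OF cont[OF ig] U] by simp
qed

lemma smooth_map_cong:
  assumes M: "smooth_manifold M" and N: "smooth_manifold N" and f: "smooth_map M N f"
    and eq: "\<And>x. x \<in> points M \<Longrightarrow> f x = g x"
  shows "smooth_map M N g"
  unfolding smooth_map_def
proof (intro conjI)
  show "continuous_map (mtop M) (mtop N) g"
    by (rule continuous_map_eq[OF smooth_mapD(1)[OF f] eq])
  have "smooth_on (\<psi> ` (U \<inter> g -` U')) (\<psi>' \<circ> g \<circ> inv_into U \<psi>)"
    if U: "(U, \<psi>) \<in> matlas M" and U': "(U', \<psi>') \<in> matlas N" for U \<psi> U' \<psi>'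
  proof -
    have UM: "U \<subseteq> points M" by (rule smooth_manifold_chart(2)[OF M U])
    have dom: "U \<inter> g -` U' = U \<inter> f -` U'" using UM eq by auto
    show ?thesis
      unfolding dom
    proof (rule smooth_on_cong[OF smooth_mapD(2)[OF f U U'] open_chart_preimage[OF M U U' N smooth_mapD(1)[OF f]]])
      fix a assume "a \<in> \<psi> ` (U \<inter> f -` U')"
      then have "inv_into U \<psi> a \<in> points M" using UM by (auto simp: inv_into_into)
      then show "(\<psi>' \<circ> f \<circ> inv_into U \<psi>) a = (\<psi>' \<circ> g \<circ> inv_into U \<psi>) a" using eq by simp
    qed
  qed
  then show "\<forall>(U, \<psi>)\<in>matlas M. \<forall>(U', \<psi>')\<in>matlas N. smooth_on (\<psi> ` (U \<inter> g -` U')) (\<psi>' \<circ> g \<circ> inv_into U \<psi>)"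
    by blast
qed

lemma act_kernel_eq: "act_kernel C = {h \<in> carrier (cgrp C). cact C h = (\<lambda>x\<in>points (cman C). x)}"
  by (simp add: act_kernel_def kernel_def BijGroup_def)

section \<open>Lines in the fibres\<close>

text \<open>
  For \<open>p = ((x, v), w)\<close> this is the curve \<open>t \<mapsto> [x, v + t w]\<close> in the total space, the affine line through
  the point \<open>[x, v]\<close> of \<open>E\<close> in the vertical direction \<open>w\<close>.
\<close>

definition fibre_line ::
  "('e, 'q, 'c, 'i, 'v, 'g, 'k::finite) vbundle \<Rightarrow> 'c \<Rightarrow> ('v \<times> (real ^ 'k)) \<times> (real ^ 'k) \<Rightarrow> real \<Rightarrow> 'e" where
  "fibre_line E c p t = bpi E c (fst (fst p), snd (fst p) + t *\<^sub>R snd p)"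

context orbi_bundle
begin

abbreviation double_points :: "'c \<Rightarrow> (('v \<times> (real ^ 'k)) \<times> (real ^ 'k)) set" where
  "double_points c \<equiv> (cpoints Q c \<times> UNIV) \<times> UNIV"

abbreviation double_top :: "'c \<Rightarrow> (('v \<times> (real ^ 'k)) \<times> (real ^ 'k)) topology" where
  "double_top c \<equiv> prod_topology (prod_topology (mtop (cman (chart Q c))) euclidean) euclidean"

text \<open>
  Restricted to the points of the chart, as group actions by bijections of a set are required to be
  extensional.
\<close>

definition double_act :: "'c \<Rightarrow> 'g \<Rightarrow> ('v \<times> (real ^ 'k)) \<times> (real ^ 'k) \<Rightarrow> ('v \<times> (real ^ 'k)) \<times> (real ^ 'k)" where
  "double_act c h = restrict (fibre_double (bact E c h)) (double_points c)"

abbreviation double_emb :: "'i \<Rightarrow> ('v \<times> (real ^ 'k)) \<times> (real ^ 'k) \<Rightarrow> ('v \<times> (real ^ 'k)) \<times> (real ^ 'k)" where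
  "double_emb i \<equiv> fibre_double (bemb Q E i)"

text \<open>
  A point of the pull-back bundle, as the set of all its coordinate expressions in all charts.
\<close>

definition line_class :: "'c \<Rightarrow> ('v \<times> (real ^ 'k)) \<times> (real ^ 'k) \<Rightarrow> ('c \<times> ('v \<times> (real ^ 'k)) \<times> (real ^ 'k)) set" where
  "line_class c p = {(d, q). d \<in> bcover E \<and> q \<in> double_points d \<and> fibre_line E d q = fibre_line E c p}"

text \<open>
  Evaluation of the common curve of a class; at \<open>t = 0\<close> it is the projection to the total space of \<open>E\<close>.
\<close>

definition line_at :: "('c \<times> ('v \<times> (real ^ 'k)) \<times> (real ^ 'k)) set \<Rightarrow> real \<Rightarrow> 'e" where
  "line_at A = (case SOME s. s \<in> A of (d, q) \<Rightarrow> fibre_line E d q)"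

lemma line_at_line_class:
  assumes "c \<in> bcover E" "p \<in> double_points c"
  shows "line_at (line_class c p) = fibre_line E c p"
proof -
  have "(c, p) \<in> line_class c p" using assms by (simp add: line_class_def)
  then have "(SOME s. s \<in> line_class c p) \<in> line_class c p" by (rule someI)
  then show ?thesis by (auto simp: line_at_def line_class_def)
qed

lemma line_class_eq_iff:
  assumes "c \<in> bcover E" "p \<in> double_points c" "d \<in> bcover E" "q \<in> double_points d"
  shows "line_class c p = line_class d q \<longleftrightarrow> fibre_line E c p = fibre_line E d q"
proof
  assume "line_class c p = line_class d q"
  then show "fibre_line E c p = fibre_line E d q"
    using line_at_line_class[OF assms(1,2)] line_at_line_class[OF assms(3,4)] by simp
qed (simp add: line_class_def)

lemma double_emb_in:
  assumes "i \<in> injs_over Q (bcover E)" "p \<in> double_points (isrc Q i)"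
  shows "double_emb i p \<in> double_points (itgt Q i)"
  using assms iemb_in_points[OF assms(1)] by (auto simp: mem_Times_iff fibre_double_def bemb_def split_beta)

lemma fibre_line_double_emb:
  assumes i: "i \<in> injs_over Q (bcover E)" and p: "p \<in> double_points (isrc Q i)"
  shows "fibre_line E (itgt Q i) (double_emb i p) = fibre_line E (isrc Q i) p"
proof -
  obtain x v w where q: "p = ((x, v), w)" and x: "x \<in> cpoints Q (isrc Q i)" using p by auto
  have "btrans E i x *v v + t *\<^sub>R (btrans E i x *v w) = btrans E i x *v (v + t *\<^sub>R w)" for t
    by (simp add: matrix_vector_right_distrib matrix_vector_mult_scaleR)
  then show ?thesis
    using bpi_bemb[OF i x] by (simp add: q fibre_line_def fun_eq_iff)
qed

lemma double_act_apply:
  assumes "c \<in> bcover E" "h \<in> carrier (cgroup Q c)" "x \<in> cpoints Q c"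
  shows "double_act c h ((x, v), w) =
    ((cact (chart Q c) h x, snd (bact E c h (x, v))), snd (bact E c h (x, w)))"
  using bact_eq[OF assms] assms(3) by (simp add: double_act_def)

lemma double_act_in:
  assumes "c \<in> bcover E" "h \<in> carrier (cgroup Q c)" "p \<in> double_points c"
  shows "double_act c h p \<in> double_points c"
proof -
  obtain x v w where "p = ((x, v), w)" "x \<in> cpoints Q c" using assms(3) by auto
  then show ?thesis
    using double_act_apply[OF assms(1,2)] cact_in_points[OF assms(1,2)] by simp
qed

text \<open>
  Within one chart the curve determines the point up to the group. Equality of curves gives for every
  \<open>t\<close> some element that moves \<open>(x, v + t w)\<close> to \<open>(y, v' + t w')\<close>. The group being finite, one element
  serves two values of \<open>t\<close>, and an affine line is determined by two of its points.
\<close>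

lemma fibre_line_eq_iff:
  assumes c: "c \<in> bcover E" and p: "p \<in> double_points c" and q: "q \<in> double_points c"
  shows "fibre_line E c p = fibre_line E c q \<longleftrightarrow> (\<exists>h\<in>carrier (cgroup Q c). double_act c h p = q)"
proof -
  obtain x v w where pp: "p = ((x, v), w)" and x: "x \<in> cpoints Q c" using p by auto
  obtain y v' w' where qq: "q = ((y, v'), w')" and y: "y \<in> cpoints Q c" using q by auto
  have lin: "linear (\<lambda>v. snd (bact E c h (x, v)))" if "h \<in> carrier (cgroup Q c)" for h
    by (rule vector_bundleD(9)[OF vector_bundle c that x])
  show ?thesis
  proof
    assume "fibre_line E c p = fibre_line E c q"
    then have "\<exists>h\<in>carrier (cgroup Q c). bact E c h (x, v + t *\<^sub>R w) = (y, v' + t *\<^sub>R w')" for t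
      using bpi_eq_iff[OF c x y] by (simp add: fibre_line_def fun_eq_iff pp qq)
    then obtain h where h: "\<And>t. h t \<in> carrier (cgroup Q c)"
      "\<And>t. bact E c (h t) (x, v + t *\<^sub>R w) = (y, v' + t *\<^sub>R w')" by metis
    have "finite (range h)"
      using h(1) finite_subset[OF _ is_orbichartD(4)[OF base_chart[OF c]]] by blast
    \<comment> \<open>Pigeonhole: infinitely many parameters, finitely many group elements.\<close>
    then have "\<not> inj h"
      using finite_imageD infinite_UNIV_char_0 by blast
    then obtain s t :: real where st: "s \<noteq> t" "h s = h t" by (auto simp: inj_def)
    let ?L = "\<lambda>v. snd (bact E c (h t) (x, v))"
    interpret L: linear ?L by (rule lin[OF h(1)])
    have 1: "?L v + s *\<^sub>R ?L w = v' + s *\<^sub>R w'" "?L v + t *\<^sub>R ?L w = v' + t *\<^sub>R w'"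
      using h(2)[of s] h(2)[of t] st(2) by (simp_all add: L.add[symmetric] L.scale[symmetric])
    have "(s - t) *\<^sub>R (?L w - w') = (?L v + s *\<^sub>R ?L w) - (?L v + t *\<^sub>R ?L w) - ((v' + s *\<^sub>R w') - (v' + t *\<^sub>R w'))"
      by (simp add: algebra_simps)
    also have "\<dots> = 0" by (simp add: 1)
    finally have w: "?L w = w'" using st(1) by simp
    then have v: "?L v = v'" using 1(1) by simp
    have "cact (chart Q c) (h t) x = y"
      using h(2)[of t] bact_eq[OF c h(1) x] by (metis prod.inject)
    then have "double_act c (h t) p = q"
      using double_act_apply[OF c h(1) x] v w by (simp add: pp qq)
    then show "\<exists>h\<in>carrier (cgroup Q c). double_act c h p = q" using h(1) by blast
  next
    assume "\<exists>h\<in>carrier (cgroup Q c). double_act c h p = q"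
    then obtain h where h: "h \<in> carrier (cgroup Q c)" "double_act c h p = q" by blast
    interpret L: linear "\<lambda>v. snd (bact E c h (x, v))" by (rule lin[OF h(1)])
    have "bact E c h (x, v + t *\<^sub>R w) = (y, v' + t *\<^sub>R w')" for t
      using h(2) double_act_apply[OF c h(1) x] bact_eq[OF c h(1) x, of "v + t *\<^sub>R w"]
      by (auto simp: pp qq L.add L.scale)
    then have "bpi E c (x, v + t *\<^sub>R w) = bpi E c (y, v' + t *\<^sub>R w')" for t
      using bpi_eq_iff[OF c x y] h(1) by blast
    then show "fibre_line E c p = fibre_line E c q"
      by (simp add: fibre_line_def fun_eq_iff pp qq)
  qed
qed

lemma double_action:
  assumes c: "c \<in> bcover E"
  shows "group_action (cgroup Q c) (double_points c) (double_act c)"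
proof (rule group_actionI)
  interpret A: group_action "cgroup Q c" "cpoints Q c \<times> (UNIV :: (real ^ 'k) set)" "bact E c"
    by (rule total_action[OF c])
  show "group (cgroup Q c)" using A.group_hom group_hom.axioms(1) by blast
  then interpret group "cgroup Q c" .
  show "double_act c g \<in> extensional (double_points c)" for g by (simp add: double_act_def)
  show "double_act c g p \<in> double_points c" if "g \<in> carrier (cgroup Q c)" "p \<in> double_points c" for g p
    using double_act_in[OF c that] .
  have one: "bact E c \<one>\<^bsub>cgroup Q c\<^esub> (x, v) = (x, v)" if "x \<in> cpoints Q c" for x v
    using A.id_eq_one that by (metis SigmaI UNIV_I restrict_apply')
  show "double_act c \<one>\<^bsub>cgroup Q c\<^esub> p = p" if p: "p \<in> double_points c" for p
    using p one by (auto simp: double_act_def)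
  show "double_act c (g \<otimes>\<^bsub>cgroup Q c\<^esub> h) p = double_act c g (double_act c h p)"
    if g: "g \<in> carrier (cgroup Q c)" and h: "h \<in> carrier (cgroup Q c)" and p: "p \<in> double_points c" for g h p
  proof -
    obtain x v w where pp: "p = ((x, v), w)" and x: "x \<in> cpoints Q c" using p by auto
    have gh: "g \<otimes>\<^bsub>cgroup Q c\<^esub> h \<in> carrier (cgroup Q c)" using g h by simp
    have hx: "cact (chart Q c) h x \<in> cpoints Q c" by (rule cact_in_points[OF c h x])
    have m: "bact E c (g \<otimes>\<^bsub>cgroup Q c\<^esub> h) (x, u) =
        bact E c g (cact (chart Q c) h x, snd (bact E c h (x, u)))" for u
      using A.composition_rule[of "(x, u)" g h] g h x bact_eq[OF c h x, of u] by simp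
    have "cact (chart Q c) (g \<otimes>\<^bsub>cgroup Q c\<^esub> h) x = cact (chart Q c) g (cact (chart Q c) h x)"
      using m[of 0] by (metis bact_eq[OF c gh x] bact_eq[OF c g hx] prod.inject)
    then show ?thesis
      by (simp add: pp double_act_apply[OF c gh x] double_act_apply[OF c h x] double_act_apply[OF c g hx] m)
  qed
qed

text \<open>
  Equivariance for the doubled charts is equivariance for \<open>E\<close>, applied to both vectors \<open>v\<close> and \<open>w\<close>.
\<close>

lemma double_emb_equivariant:
  assumes i: "i \<in> injs_over Q (bcover E)" and h: "h \<in> carrier (cgroup Q (isrc Q i))"
    and p: "p \<in> double_points (isrc Q i)"
  shows "double_emb i (double_act (isrc Q i) h p) = double_act (itgt Q i) (ihom Q i h) (double_emb i p)"
proof -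
  note inj = vector_bundleD(12)[OF vector_bundle i]
  note c = injs_overD(2,3)[OF i]
  obtain x v w where pp: "p = ((x, v), w)" and x: "x \<in> cpoints Q (isrc Q i)" using p by auto
  have h': "ihom Q i h \<in> carrier (cgroup Q (itgt Q i))"
    using chart_injectionD(4)[OF inj] h by (auto simp: hom_def)
  have ix: "iemb Q i x \<in> cpoints Q (itgt Q i)" by (rule iemb_in_points[OF i x])
  have "bemb Q E i (bact E (isrc Q i) h (x, u)) = bact E (itgt Q i) (ihom Q i h) (bemb Q E i (x, u))" for u
    using chart_injectionD(6)[OF inj, of h "(x, u)"] h x by simp
  then have eq: "(iemb Q i (cact (chart Q (isrc Q i)) h x),
      btrans E i (cact (chart Q (isrc Q i)) h x) *v snd (bact E (isrc Q i) h (x, u))) =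
      (cact (chart Q (itgt Q i)) (ihom Q i h) (iemb Q i x),
        snd (bact E (itgt Q i) (ihom Q i h) (iemb Q i x, btrans E i x *v u)))" for u
    by (metis bemb_apply bact_eq[OF c(1) h x] bact_eq[OF c(2) h' ix])
  show ?thesis
    using eq[of v] eq[of w]
    by (simp add: pp double_act_apply[OF c(1) h x] double_act_apply[OF c(2) h' ix])
qed

end

section \<open>The topology on the space of lines\<close>

lemma open_map_of_open_embedding:
  assumes "embedding_map X Y f" "openin Y (f ` topspace X)" "openin X U"
  shows "openin Y (f ` U)"
proof -
  have "openin (subtopology Y (f ` topspace X)) (f ` U)"
    using assms(1,3) unfolding embedding_map_def
    by (meson homeomorphic_map_openness_eq)
  then show ?thesis using assms(2) by (rule openin_trans_full)
qed

context orbi_bundle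
begin

lemma smooth_double_act:
  assumes c: "c \<in> bcover E" and h: "h \<in> carrier (cgroup Q c)"
  shows "smooth_map (cman (bchart total_space F c)) (cman (bchart total_space F c)) (double_act c h)"
proof -
  note M = base_manifold[OF c]
  have "smooth_map (prod_manifold (cman (chart Q c)) euclidean_manifold)
      (prod_manifold (cman (chart Q c)) euclidean_manifold) (bact E c h)"
    using is_orbichartD(6)[OF total_chart[OF c]] h by simp
  then have "smooth_map (prod_manifold (prod_manifold (cman (chart Q c)) euclidean_manifold) euclidean_manifold)
      (prod_manifold (prod_manifold (cman (chart Q c)) euclidean_manifold) euclidean_manifold)
      (fibre_double (bact E c h))"
    by (rule smooth_map_fibre_double[OF M M]) (rule vector_bundleD(8)[OF vector_bundle c h])
  then show ?thesis
    unfolding bchart_simps total_space_simps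
    by (rule smooth_map_cong[rotated 2]) (auto simp: double_act_def intro!: smooth_manifold_prod M smooth_manifold_euclidean)
qed

lemma continuous_double_act:
  assumes "c \<in> bcover E" "h \<in> carrier (cgroup Q c)"
  shows "continuous_map (double_top c) (double_top c) (double_act c h)"
  using smooth_mapD(1)[OF smooth_double_act[OF assms]] by simp

lemma openin_double_act:
  assumes "c \<in> bcover E" "h \<in> carrier (cgroup Q c)" "openin (double_top c) U"
  shows "openin (double_top c) (double_act c h ` U)"
  by (rule group_action_open_map[where G = "cgroup Q c" and \<phi> = "double_act c"])
     (use double_action continuous_double_act assms in auto)

lemma smooth_embedding_double_emb:
  assumes i: "i \<in> injs_over Q (bcover E)"
  shows "smooth_embedding (cman (bchart total_space F (isrc Q i))) (cman (bchart total_space F (itgt Q i)))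
    (double_emb i)"
proof -
  note c = injs_overD(2,3)[OF i]
  have "smooth_embedding (prod_manifold (cman (chart Q (isrc Q i))) euclidean_manifold)
      (prod_manifold (cman (chart Q (itgt Q i))) euclidean_manifold) (bemb Q E i)"
    using chart_injectionD(1)[OF vector_bundleD(12)[OF vector_bundle i]] by simp
  then show ?thesis
    unfolding bchart_simps total_space_simps
    by (rule smooth_embedding_fibre_double[OF base_manifold[OF c(1)] base_manifold[OF c(2)], where \<phi> = "iemb Q i"])
       simp
qed

lemma double_emb_image:
  assumes i: "i \<in> injs_over Q (bcover E)"
  shows "double_emb i ` double_points (isrc Q i) = bemb Q E i ` (cpoints Q (isrc Q i) \<times> UNIV) \<times> UNIV"
proof (rule fibre_double_image[where \<phi> = "iemb Q i"])
  fix x assume x: "x \<in> cpoints Q (isrc Q i)"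
  obtain B where "\<And>v. btrans E i x *v (B *v v) = v" by (rule btrans_bij[OF i x]) (rule that)
  then show "surj (\<lambda>v. snd (bemb Q E i (x, v)))"
    by (intro surjI[of _ "\<lambda>v. B *v v"]) simp
qed simp

lemma openin_double_emb_image:
  assumes i: "i \<in> injs_over Q (bcover E)"
  shows "openin (double_top (itgt Q i)) (double_emb i ` double_points (isrc Q i))"
proof -
  have "openin (prod_topology (mtop (cman (chart Q (itgt Q i)))) euclidean)
      (bemb Q E i ` (cpoints Q (isrc Q i) \<times> UNIV))"
    using chart_injectionD(2)[OF vector_bundleD(12)[OF vector_bundle i]] by simp
  then show ?thesis
    unfolding double_emb_image[OF i] by (simp add: openin_prod_Times_iff)
qed

lemma openin_double_emb:
  assumes i: "i \<in> injs_over Q (bcover E)" and U: "openin (double_top (isrc Q i)) U"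
  shows "openin (double_top (itgt Q i)) (double_emb i ` U)"
  by (rule open_map_of_open_embedding[OF _ _ U])
     (use smooth_embeddingD(2)[OF smooth_embedding_double_emb[OF i]] openin_double_emb_image[OF i] in simp_all)

lemma continuous_double_emb:
  assumes i: "i \<in> injs_over Q (bcover E)"
  shows "continuous_map (double_top (isrc Q i)) (double_top (itgt Q i)) (double_emb i)"
  using smooth_mapD(1)[OF smooth_embeddingD(1)[OF smooth_embedding_double_emb[OF i]]] by simp

lemma fibre_line_double_act:
  assumes "c \<in> bcover E" "h \<in> carrier (cgroup Q c)" "p \<in> double_points c"
  shows "fibre_line E c (double_act c h p) = fibre_line E c p"
  using fibre_line_eq_iff[OF assms(1,3) double_act_in[OF assms]] assms(2) by metis

text \<open>
  Since group elements and transition matrices are bijective on fibres, the two vectors of \<open>q\<close> can be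
  pulled back along with its base point.
\<close>

lemma common_double_chart:
  assumes c: "c \<in> bcover E" and d: "d \<in> bcover E" and x: "x \<in> cpoints Q c" and q: "q \<in> double_points d"
    and eq: "cproj (chart Q c) x = cproj (chart Q d) (fst (fst q))"
  obtains i j h r where "i \<in> injs_over Q (bcover E)" "j \<in> injs_over Q (bcover E)"
    "isrc Q i = isrc Q j" "itgt Q i = c" "itgt Q j = d" "r \<in> double_points (isrc Q i)"
    "h \<in> carrier (cgroup Q d)" "double_act d h (double_emb j r) = q"
proof -
  obtain y v w where qq: "q = ((y, v), w)" and y: "y \<in> cpoints Q d" using q by auto
  have eq': "cproj (chart Q c) x = cproj (chart Q d) y" using eq qq by simp
  obtain i j z h where ij: "i \<in> injs_over Q (bcover E)" "j \<in> injs_over Q (bcover E)"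
    "isrc Q i = isrc Q j" "itgt Q i = c" "itgt Q j = d" and z: "z \<in> cpoints Q (isrc Q i)"
    and h: "h \<in> carrier (cgroup Q d)" "cact (chart Q d) h (iemb Q j z) = y"
    using common_chart[OF c d x y eq'] by blast
  have zj: "z \<in> cpoints Q (isrc Q j)" using z ij(3) by simp
  have jz: "iemb Q j z \<in> cpoints Q d" using iemb_in_points[OF ij(2) zj] ij(5) by simp
  obtain B where B: "\<And>v. btrans E j z *v (B *v v) = v" by (rule btrans_bij[OF ij(2) zj]) (rule that)
  obtain v1 where v1: "v = snd (bact E d h (iemb Q j z, v1))" using surjD[OF bact_bij(2)[OF d h(1) jz]] by blast
  obtain w1 where w1: "w = snd (bact E d h (iemb Q j z, w1))" using surjD[OF bact_bij(2)[OF d h(1) jz]] by blast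
  have "double_act d h (double_emb j ((z, B *v v1), B *v w1)) = q"
    using double_act_apply[OF d h(1) jz] by (simp add: B qq h(2) v1 w1)
  then show ?thesis
    using that[OF ij, of "((z, B *v v1), B *v w1)" h] z h(1) by simp
qed

lemma cproj_eq_of_bpi_eq:
  assumes "c \<in> bcover E" "d \<in> bcover E" "x \<in> cpoints Q c" "y \<in> cpoints Q d" "bpi E c (x, v) = bpi E d (y, w)"
  shows "cproj (chart Q c) x = cproj (chart Q d) y"
  using vector_bundleD(7)[OF vector_bundle assms(1,3), of v] vector_bundleD(7)[OF vector_bundle assms(2,4), of w]
    assms(5) by simp

lemma fibre_line_at_0: "fibre_line E c p 0 = bpi E c (fst p)"
  by (simp add: fibre_line_def)

lemma cproj_eq_of_line_class_eq:
  assumes "c \<in> bcover E" "p \<in> double_points c" "d \<in> bcover E" "q \<in> double_points d"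
    "line_class c p = line_class d q"
  shows "cproj (chart Q c) (fst (fst p)) = cproj (chart Q d) (fst (fst q))"
proof (rule cproj_eq_of_bpi_eq[OF assms(1,3)])
  have "fibre_line E c p 0 = fibre_line E d q 0"
    using line_class_eq_iff[OF assms(1-4)] assms(5) by simp
  then show "bpi E c (fst (fst p), snd (fst p)) = bpi E d (fst (fst q), snd (fst q))"
    by (simp add: fibre_line_at_0)
qed (use assms(2,4) in auto)

text \<open>
  The chart projections are open maps for the quotient topology. Near a point \<open>q\<close> of chart \<open>d\<close> whose class
  lies in the image of \<open>W\<close>, the charts \<open>c\<close> and \<open>d\<close> are related through a common chart by open embeddings
  \<open>i\<close>, \<open>j\<close> and group elements \<open>k\<close>, \<open>h\<close>, and the open set \<open>h j (i\<^sup>-\<^sup>1 (k W))\<close> consists of points with classes in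
  the image of \<open>W\<close>.
\<close>

lemma openin_line_class_preimage:
  assumes c: "c \<in> bcover E" and d: "d \<in> bcover E" and W: "openin (double_top c) W"
  shows "openin (double_top d) {q \<in> double_points d. line_class d q \<in> line_class c ` W}"
proof (subst openin_subopen, intro ballI)
  have Wc: "W \<subseteq> double_points c" using openin_subset[OF W] by simp
  fix q assume "q \<in> {q \<in> double_points d. line_class d q \<in> line_class c ` W}"
  then obtain p where q: "q \<in> double_points d" and p: "p \<in> W" and eq: "line_class c p = line_class d q"
    by auto
  have pc: "p \<in> double_points c" using p Wc by blast
  have x: "fst (fst p) \<in> cpoints Q c" using pc by auto
  obtain i j h r where i: "i \<in> injs_over Q (bcover E)" and j: "j \<in> injs_over Q (bcover E)"
    and ij: "isrc Q i = isrc Q j" "itgt Q i = c" "itgt Q j = d" and r: "r \<in> double_points (isrc Q i)"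
    and h: "h \<in> carrier (cgroup Q d)" "double_act d h (double_emb j r) = q"
    by (rule common_double_chart[OF c d x q cproj_eq_of_line_class_eq[OF c pc d q eq]]) (rule that)
  have line: "fibre_line E d (double_act d h (double_emb j s)) = fibre_line E c (double_emb i s)"
    if "s \<in> double_points (isrc Q i)" for s
    using fibre_line_double_act[OF d h(1), of "double_emb j s"] double_emb_in[OF j, of s]
      fibre_line_double_emb[OF i, of s] fibre_line_double_emb[OF j, of s] that ij by simp
  have ir: "double_emb i r \<in> double_points c" using double_emb_in[OF i r] ij(2) by simp
  have "fibre_line E c p = fibre_line E c (double_emb i r)"
    using line[OF r] h(2) eq line_class_eq_iff[OF c pc d q] by simp
  then obtain k where k: "k \<in> carrier (cgroup Q c)" "double_act c k p = double_emb i r"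
    using fibre_line_eq_iff[OF c pc ir] by blast
  let ?S = "{s \<in> topspace (double_top (isrc Q i)). double_emb i s \<in> double_act c k ` W}"
  let ?T = "double_act d h ` double_emb j ` ?S"
  have "openin (double_top (isrc Q i)) ?S"
    using openin_continuous_map_preimage[OF continuous_double_emb[OF i]] openin_double_act[OF c k(1) W] ij(2)
    by simp
  then have "openin (double_top d) ?T"
    using openin_double_act[OF d h(1)] openin_double_emb[OF j] ij by simp
  moreover have "q \<in> ?T"
  proof -
    have "double_emb i r \<in> double_act c k ` W"
      unfolding k(2)[symmetric] by (rule imageI[OF p])
    then have "r \<in> ?S" using r by simp
    then show ?thesis unfolding h(2)[symmetric] by (intro imageI)
  qed
  moreover have "?T \<subseteq> {q \<in> double_points d. line_class d q \<in> line_class c ` W}"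
  proof
    fix q' assume "q' \<in> ?T"
    then obtain s p' where s: "s \<in> double_points (isrc Q i)" and p': "p' \<in> W" "double_emb i s = double_act c k p'"
      and q': "q' = double_act d h (double_emb j s)" by auto
    have p'c: "p' \<in> double_points c" using p'(1) Wc by blast
    have q'd: "q' \<in> double_points d"
      unfolding q' using double_act_in[OF d h(1)] double_emb_in[OF j, of s] s ij by simp
    have "fibre_line E d q' = fibre_line E c p'"
      using line[OF s] fibre_line_double_act[OF c k(1) p'c] p'(2) q' by simp
    then have "line_class d q' = line_class c p'"
      using line_class_eq_iff[OF d q'd c p'c] by simp
    then show "q' \<in> {q \<in> double_points d. line_class d q \<in> line_class c ` W}"
      using q'd p'(1) by blast
  qed
  ultimately show "\<exists>T. openin (double_top d) T \<and> q \<in> T \<and>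
      T \<subseteq> {q \<in> double_points d. line_class d q \<in> line_class c ` W}" by blast
qed

text \<open>
  The finest topology for which the projections of all charts are continuous.
\<close>

definition line_topology :: "('c \<times> ('v \<times> (real ^ 'k)) \<times> (real ^ 'k)) set topology" where
  "line_topology = topology (\<lambda>U. U \<subseteq> (\<Union>c\<in>bcover E. line_class c ` double_points c) \<and>
     (\<forall>c\<in>bcover E. openin (double_top c) {p \<in> double_points c. line_class c p \<in> U}))"

lemma openin_line_topology:
  "openin line_topology U \<longleftrightarrow> U \<subseteq> (\<Union>c\<in>bcover E. line_class c ` double_points c) \<and>
     (\<forall>c\<in>bcover E. openin (double_top c) {p \<in> double_points c. line_class c p \<in> U})"
proof -
  have "istopology (\<lambda>U. U \<subseteq> (\<Union>c\<in>bcover E. line_class c ` double_points c) \<and>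
     (\<forall>c\<in>bcover E. openin (double_top c) {p \<in> double_points c. line_class c p \<in> U}))"
    unfolding istopology_def
  proof (intro conjI allI impI ballI)
    fix S T c assume "S \<subseteq> (\<Union>c\<in>bcover E. line_class c ` double_points c) \<and>
        (\<forall>c\<in>bcover E. openin (double_top c) {p \<in> double_points c. line_class c p \<in> S})"
      "T \<subseteq> (\<Union>c\<in>bcover E. line_class c ` double_points c) \<and>
        (\<forall>c\<in>bcover E. openin (double_top c) {p \<in> double_points c. line_class c p \<in> T})" and c: "c \<in> bcover E"
    then have "openin (double_top c)
        ({p \<in> double_points c. line_class c p \<in> S} \<inter> {p \<in> double_points c. line_class c p \<in> T})"
      by (intro openin_Int) simp_all
    moreover have "{p \<in> double_points c. line_class c p \<in> S} \<inter> {p \<in> double_points c. line_class c p \<in> T} =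
        {p \<in> double_points c. line_class c p \<in> S \<inter> T}" by blast
    ultimately show "openin (double_top c) {p \<in> double_points c. line_class c p \<in> S \<inter> T}" by simp
  next
    fix K c assume "\<forall>S\<in>K. S \<subseteq> (\<Union>c\<in>bcover E. line_class c ` double_points c) \<and>
        (\<forall>c\<in>bcover E. openin (double_top c) {p \<in> double_points c. line_class c p \<in> S})" and c: "c \<in> bcover E"
    then have "openin (double_top c) (\<Union>S\<in>K. {p \<in> double_points c. line_class c p \<in> S})"
      by (intro openin_Union) auto
    moreover have "(\<Union>S\<in>K. {p \<in> double_points c. line_class c p \<in> S}) =
        {p \<in> double_points c. line_class c p \<in> \<Union>K}" by blast
    ultimately show "openin (double_top c) {p \<in> double_points c. line_class c p \<in> \<Union>K}" by simp
  qed auto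
  then show ?thesis by (simp add: line_topology_def topology_inverse')
qed

lemma openin_line_class_image:
  assumes "c \<in> bcover E" "openin (double_top c) W"
  shows "openin line_topology (line_class c ` W)"
  unfolding openin_line_topology
  using openin_line_class_preimage[OF assms(1) _ assms(2)] openin_subset[OF assms(2)] assms(1) by fastforce

lemma topspace_line_topology: "topspace line_topology = (\<Union>c\<in>bcover E. line_class c ` double_points c)"
proof
  show "topspace line_topology \<subseteq> (\<Union>c\<in>bcover E. line_class c ` double_points c)"
    using openin_topspace[of line_topology] unfolding openin_line_topology by blast
  show "(\<Union>c\<in>bcover E. line_class c ` double_points c) \<subseteq> topspace line_topology"
  proof
    fix A assume "A \<in> (\<Union>c\<in>bcover E. line_class c ` double_points c)"
    then obtain c where c: "c \<in> bcover E" "A \<in> line_class c ` double_points c" by blast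
    have "openin line_topology (line_class c ` double_points c)"
      using openin_line_class_image[OF c(1) openin_topspace] by simp
    then show "A \<in> topspace line_topology" using c(2) openin_subset by blast
  qed
qed

lemma continuous_line_class:
  assumes "c \<in> bcover E"
  shows "continuous_map (double_top c) line_topology (line_class c)"
  unfolding continuous_map_def
  using assms by (auto simp: openin_line_topology topspace_line_topology)

lemma quotient_line_class:
  assumes c: "c \<in> bcover E"
  shows "quotient_map (double_top c) (subtopology line_topology (line_class c ` double_points c)) (line_class c)"
proof (rule continuous_open_imp_quotient_map)
  show "continuous_map (double_top c) (subtopology line_topology (line_class c ` double_points c)) (line_class c)"
    using continuous_line_class[OF c] by (auto simp: continuous_map_in_subtopology)
  show "open_map (double_top c) (subtopology line_topology (line_class c ` double_points c)) (line_class c)"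
    unfolding open_map_def
  proof (intro allI impI)
    fix U assume U: "openin (double_top c) U"
    have "line_class c ` U \<subseteq> line_class c ` double_points c"
      using openin_subset[OF U] by auto
    then show "openin (subtopology line_topology (line_class c ` double_points c)) (line_class c ` U)"
      using openin_line_class_image[OF c U] by (rule subset_openin_subtopology[rotated])
  qed
  have "line_class c ` double_points c \<subseteq> topspace line_topology"
    using c by (auto simp: topspace_line_topology)
  then show "line_class c ` topspace (double_top c) = topspace (subtopology line_topology (line_class c ` double_points c))"
    by auto
qed

lemma continuous_from_line_topology:
  assumes cont: "\<And>c. c \<in> bcover E \<Longrightarrow> continuous_map (double_top c) Z (\<lambda>p. g (line_class c p))"
  shows "continuous_map line_topology Z g"
proof (rule continuous_map_from_quotient_charts[where A = "bcover E" and f = line_class and X = double_top])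
  fix c assume c: "c \<in> bcover E"
  show op: "openin line_topology (line_class c ` topspace (double_top c))"
    by (rule openin_line_class_image[OF c openin_topspace])
  show "continuous_map (double_top c) Z (\<lambda>p. g (line_class c p))" by (rule cont[OF c])
  show "quotient_map (double_top c) (subtopology line_topology (line_class c ` topspace (double_top c))) (line_class c)"
    using quotient_line_class[OF c] by simp
qed (simp add: topspace_line_topology)

lemma line_topology_cases:
  assumes "A \<in> topspace line_topology"
  obtains c p where "c \<in> bcover E" "p \<in> double_points c" "A = line_class c p"
  using assms unfolding topspace_line_topology by blast

lemma continuous_fibre_line:
  assumes c: "c \<in> bcover E"
  shows "continuous_map (double_top c) (btop E) (\<lambda>p. fibre_line E c p t)"
proof -
  let ?M = "mtop (cman (chart Q c))"
  have pi: "continuous_map (prod_topology ?M euclidean) (btop E) (bpi E c)"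
    using quotient_imp_continuous_map[OF is_orbichartD(8)[OF total_chart[OF c]]]
    by (simp add: continuous_map_in_subtopology)
  have pair: "continuous_map (double_top c) (prod_topology euclidean euclidean) (\<lambda>p. (snd (fst p), snd p))"
    by (intro continuous_map_pairedI continuous_map_snd
        continuous_map_compose[OF continuous_map_fst continuous_map_snd, unfolded o_def])
  have "continuous_on UNIV (\<lambda>q :: (real ^ 'k) \<times> (real ^ 'k). fst q + t *\<^sub>R snd q)"
    by (intro continuous_intros)
  then have add: "continuous_map (prod_topology euclidean euclidean) euclidean
      (\<lambda>q :: (real ^ 'k) \<times> (real ^ 'k). fst q + t *\<^sub>R snd q)"
    by simp
  have "continuous_map (double_top c) euclidean (\<lambda>p. snd (fst p) + t *\<^sub>R snd p)"
    using continuous_map_compose[OF pair add] by (simp add: o_def)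
  then have "continuous_map (double_top c) (prod_topology ?M euclidean)
      (\<lambda>p. (fst (fst p), snd (fst p) + t *\<^sub>R snd p))"
    by (intro continuous_map_pairedI continuous_map_compose[OF continuous_map_fst continuous_map_fst, unfolded o_def])
  from continuous_map_compose[OF this pi] show ?thesis
    by (simp add: fibre_line_def[abs_def] o_def)
qed

lemma continuous_line_at: "continuous_map line_topology (btop E) (\<lambda>A. line_at A t)"
proof (rule continuous_from_line_topology)
  fix c assume c: "c \<in> bcover E"
  show "continuous_map (double_top c) (btop E) (\<lambda>p. line_at (line_class c p) t)"
    by (rule continuous_map_eq[OF continuous_fibre_line[OF c, of t]]) (simp add: line_at_line_class[OF c])
qed

text \<open>
  Distinct classes have distinct curves, so some evaluation \<open>line_at\<close> at \<open>t\<close> maps them to distinct points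
  of the Hausdorff space \<open>E\<close>; these evaluations are continuous.
\<close>

lemma Hausdorff_line_topology: "Hausdorff_space line_topology"
  unfolding Hausdorff_space_def
proof (intro allI impI)
  fix A B assume AB: "A \<in> topspace line_topology \<and> B \<in> topspace line_topology \<and> A \<noteq> B"
  obtain c p where A: "c \<in> bcover E" "p \<in> double_points c" "A = line_class c p"
    using AB line_topology_cases by blast
  obtain d q where B: "d \<in> bcover E" "q \<in> double_points d" "B = line_class d q"
    using AB line_topology_cases by blast
  have "line_at A \<noteq> line_at B"
    using AB line_class_eq_iff[OF A(1,2) B(1,2)] by (simp add: A B line_at_line_class)
  then obtain t where t: "line_at A t \<noteq> line_at B t" by blast
  have "line_at A t \<in> topspace (btop E)" "line_at B t \<in> topspace (btop E)"
    using continuous_map_image_subset_topspace[OF continuous_line_at[of t]] AB by blast+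
  then obtain U V where UV: "openin (btop E) U" "openin (btop E) V" "line_at A t \<in> U" "line_at B t \<in> V" "disjnt U V"
    using vector_bundleD(3)[OF vector_bundle] t unfolding Hausdorff_space_def by metis
  show "\<exists>U V. openin line_topology U \<and> openin line_topology V \<and> A \<in> U \<and> B \<in> V \<and> disjnt U V"
    using openin_continuous_map_preimage[OF continuous_line_at UV(1), of t]
      openin_continuous_map_preimage[OF continuous_line_at UV(2), of t] AB UV(3-5)
    by (intro exI[of _ "{A \<in> topspace line_topology. line_at A t \<in> U}"]
        exI[of _ "{A \<in> topspace line_topology. line_at A t \<in> V}"]) (auto simp: disjnt_iff)
qed

section \<open>The pull-back bundle is good\<close>

definition vertical_bundle ::
  "(('c \<times> ('v \<times> (real ^ 'k)) \<times> (real ^ 'k)) set, 'e, 'c, 'i, 'v \<times> (real ^ 'k), 'g, 'k) vbundle" where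
  "vertical_bundle = \<lparr>btop = line_topology, bproj = (\<lambda>A. line_at A 0), bcover = bcover E,
     bact = double_act, bpi = line_class, btrans = (\<lambda>i p. btrans E i (fst p))\<rparr>"

lemma vertical_bundle_simps [simp]:
  "btop vertical_bundle = line_topology" "bproj vertical_bundle A = line_at A 0"
  "bcover vertical_bundle = bcover E" "bact vertical_bundle = double_act"
  "bpi vertical_bundle = line_class" "btrans vertical_bundle i p = btrans E i (fst p)"
  by (simp_all add: vertical_bundle_def)

lemma bemb_vertical_bundle [simp]: "bemb total_space vertical_bundle i = double_emb i"
  by (rule ext) (simp add: bemb_def fibre_double_def split_beta)

lemma is_orbichart_vertical_bundle:
  assumes c: "c \<in> bcover E"
  shows "is_orbichart line_topology (bchart total_space vertical_bundle c)"
proof -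
  have im: "chart_image (bchart total_space vertical_bundle c) = line_class c ` double_points c"
    by (simp add: chart_image_def)
  show ?thesis
    unfolding is_orbichart_def im
  proof (intro conjI ballI)
    show "smooth_manifold (cman (bchart total_space vertical_bundle c))"
      using base_manifold[OF c] by (simp add: smooth_manifold_prod smooth_manifold_euclidean)
    have "connected_space (mtop (cman (chart Q c)))"
      by (rule is_orbichartD(2)[OF base_chart[OF c]])
    moreover have "connected_space (euclidean :: (real ^ 'k) topology)"
      by (simp add: connected_UNIV flip: connectedin_topspace)
    ultimately show "connected_space (mtop (cman (bchart total_space vertical_bundle c)))"
      by (simp add: connected_space_prod_topology)
    show "points (cman (bchart total_space vertical_bundle c)) \<noteq> {}"
      using is_orbichartD(3)[OF base_chart[OF c]] by simp
    show "finite (carrier (cgrp (bchart total_space vertical_bundle c)))"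
      using is_orbichartD(4)[OF base_chart[OF c]] by simp
    show "group_action (cgrp (bchart total_space vertical_bundle c))
        (points (cman (bchart total_space vertical_bundle c))) (cact (bchart total_space vertical_bundle c))"
      using double_action[OF c] by simp
    show "smooth_map (cman (bchart total_space vertical_bundle c)) (cman (bchart total_space vertical_bundle c))
        (cact (bchart total_space vertical_bundle c) h)"
      if "h \<in> carrier (cgrp (bchart total_space vertical_bundle c))" for h
      using smooth_double_act[OF c, of h vertical_bundle] that by simp
    show "openin line_topology (line_class c ` double_points c)"
      using openin_line_class_image[OF c openin_topspace] by simp
    show "quotient_map (mtop (cman (bchart total_space vertical_bundle c)))
        (subtopology line_topology (line_class c ` double_points c)) (cproj (bchart total_space vertical_bundle c))"
      using quotient_line_class[OF c] by simp
    fix p q assume "p \<in> points (cman (bchart total_space vertical_bundle c))"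
      "q \<in> points (cman (bchart total_space vertical_bundle c))"
    then have p: "p \<in> double_points c" and q: "q \<in> double_points c" by simp_all
    have "line_class c p = line_class c q \<longleftrightarrow> (\<exists>h\<in>carrier (cgroup Q c). double_act c h p = q)"
      using line_class_eq_iff[OF c p c q] fibre_line_eq_iff[OF c p q] by simp
    then show "cproj (bchart total_space vertical_bundle c) p = cproj (bchart total_space vertical_bundle c) q \<longleftrightarrow>
        q \<in> orbit (cgrp (bchart total_space vertical_bundle c)) (cact (bchart total_space vertical_bundle c)) p"
      by (auto simp: orbit_def)
  qed
qed

text \<open>
  This is why the pull-back is good: an element that fixes every \<open>(x, v)\<close> fixes every \<open>((x, v), w)\<close>, the
  action on the second vector being the same as on the first.
\<close>

lemma act_kernel_vertical_bundle:
  assumes c: "c \<in> bcover E"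
  shows "act_kernel (bchart total_space vertical_bundle c) = act_kernel (bchart Q E c)"
proof -
  have "double_act c h = (\<lambda>p\<in>double_points c. p) \<longleftrightarrow> bact E c h = (\<lambda>p\<in>cpoints Q c \<times> UNIV. p)"
    if h: "h \<in> carrier (cgroup Q c)" for h
  proof
    assume id: "double_act c h = (\<lambda>p\<in>double_points c. p)"
    have ext: "bact E c h \<in> extensional (cpoints Q c \<times> UNIV)"
      using group_action.bij_prop0[OF total_action[OF c] h] by (rule Bij_imp_extensional)
    show "bact E c h = (\<lambda>p\<in>cpoints Q c \<times> UNIV. p)"
    proof (rule extensionalityI[OF ext])
      fix p assume p: "p \<in> cpoints Q c \<times> (UNIV :: (real ^ 'k) set)"
      then have "double_act c h (p, 0) = (p, 0)" by (simp add: id)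
      then show "bact E c h p = (\<lambda>p\<in>cpoints Q c \<times> UNIV. p) p"
        using p by (simp add: double_act_def)
    qed simp
  next
    assume id: "bact E c h = (\<lambda>p\<in>cpoints Q c \<times> UNIV. p)"
    show "double_act c h = (\<lambda>p\<in>double_points c. p)"
      by (rule extensionalityI[of _ "double_points c"]) (auto simp: double_act_def id)
  qed
  then show ?thesis
    by (auto simp: act_kernel_eq)
qed

lemma chart_injection_vertical_bundle:
  assumes i: "i \<in> injs_over Q (bcover E)"
  shows "chart_injection (bchart total_space vertical_bundle (isrc Q i))
    (bchart total_space vertical_bundle (itgt Q i)) (double_emb i) (ihom Q i)"
proof -
  note inj = vector_bundleD(12)[OF vector_bundle i] and c = injs_overD(2,3)[OF i]
  show ?thesis
    unfolding chart_injection_def act_kernel_vertical_bundle[OF c(1)] act_kernel_vertical_bundle[OF c(2)]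
  proof (intro conjI ballI)
    show "smooth_embedding (cman (bchart total_space vertical_bundle (isrc Q i)))
        (cman (bchart total_space vertical_bundle (itgt Q i))) (double_emb i)"
      by (rule smooth_embedding_double_emb[OF i])
    show "openin (mtop (cman (bchart total_space vertical_bundle (itgt Q i))))
        (double_emb i ` points (cman (bchart total_space vertical_bundle (isrc Q i))))"
      using openin_double_emb_image[OF i] by simp
    show "cproj (bchart total_space vertical_bundle (itgt Q i)) (double_emb i p) =
        cproj (bchart total_space vertical_bundle (isrc Q i)) p"
      if "p \<in> points (cman (bchart total_space vertical_bundle (isrc Q i)))" for p
    proof -
      have p: "p \<in> double_points (isrc Q i)" using that by simp
      show ?thesis
        using line_class_eq_iff[OF c(2) double_emb_in[OF i p] c(1) p] fibre_line_double_emb[OF i p] by simp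
    qed
    show "double_emb i (cact (bchart total_space vertical_bundle (isrc Q i)) h p) =
        cact (bchart total_space vertical_bundle (itgt Q i)) (ihom Q i h) (double_emb i p)"
      if "h \<in> carrier (cgrp (bchart total_space vertical_bundle (isrc Q i)))"
        "p \<in> points (cman (bchart total_space vertical_bundle (isrc Q i)))" for h p
      using double_emb_equivariant[OF i, of h p] that by simp
  qed (use chart_injectionD(4,5,7)[OF inj] in simp_all)
qed

text \<open>
  A line whose starting point lies in chart \<open>c\<close> has an expression in chart \<open>c\<close> itself, found by moving
  both vectors through a common chart.
\<close>

lemma chart_image_vertical_bundle:
  assumes c: "c \<in> bcover E"
  shows "chart_image (bchart total_space vertical_bundle c) =
    {A \<in> topspace line_topology. line_at A 0 \<in> chart_image (bchart Q E c)}"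
proof (intro equalityI subsetI)
  fix A assume "A \<in> chart_image (bchart total_space vertical_bundle c)"
  then obtain p where p: "p \<in> double_points c" "A = line_class c p" by (auto simp: chart_image_def)
  then have "A \<in> topspace line_topology" using c by (auto simp: topspace_line_topology)
  moreover have "line_at A 0 = bpi E c (fst p)"
    using line_at_line_class[OF c p(1)] by (simp add: p(2) fibre_line_at_0)
  moreover have "fst p \<in> cpoints Q c \<times> UNIV" using p(1) by auto
  ultimately show "A \<in> {A \<in> topspace line_topology. line_at A 0 \<in> chart_image (bchart Q E c)}"
    by (simp add: chart_image_def)
next
  fix A assume A: "A \<in> {A \<in> topspace line_topology. line_at A 0 \<in> chart_image (bchart Q E c)}"
  then obtain d q where d: "d \<in> bcover E" and q: "q \<in> double_points d" and Aq: "A = line_class d q"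
    using line_topology_cases by blast
  have "line_at A 0 = bpi E d (fst q)"
    using line_at_line_class[OF d q] by (simp add: Aq fibre_line_at_0)
  then obtain x v where x: "x \<in> cpoints Q c" and "bpi E d (fst q) = bpi E c (x, v)"
    using A by (auto simp: chart_image_def)
  then have "cproj (chart Q c) x = cproj (chart Q d) (fst (fst q))"
    using cproj_eq_of_bpi_eq[OF c d x, of "fst (fst q)" v "snd (fst q)"] q by auto
  then obtain i j h r where i: "i \<in> injs_over Q (bcover E)" and j: "j \<in> injs_over Q (bcover E)"
    and ij: "isrc Q i = isrc Q j" "itgt Q i = c" "itgt Q j = d" and r: "r \<in> double_points (isrc Q i)"
    and h: "h \<in> carrier (cgroup Q d)" "double_act d h (double_emb j r) = q"
    by (rule common_double_chart[OF c d x q]) (rule that)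
  have "fibre_line E d q = fibre_line E c (double_emb i r)"
    using fibre_line_double_act[OF d h(1), of "double_emb j r"] double_emb_in[OF j, of r]
      fibre_line_double_emb[OF i r] fibre_line_double_emb[OF j, of r] r ij h(2) by simp
  moreover have ir: "double_emb i r \<in> double_points c" using double_emb_in[OF i r] ij(2) by simp
  ultimately have "A = line_class c (double_emb i r)"
    using line_class_eq_iff[OF d q c ir] Aq by simp
  then show "A \<in> chart_image (bchart total_space vertical_bundle c)"
    using ir by (simp add: chart_image_def)
qed

lemma vector_bundle_vertical_bundle: "vector_bundle total_space vertical_bundle"
  unfolding vector_bundle_def vertical_bundle_simps injs_over_total_space bemb_vertical_bundle total_space_simps
proof (intro conjI ballI allI impI is_orbifold_total_space total_compatible_cover Hausdorff_line_topology
    is_orbichart_vertical_bundle chart_image_vertical_bundle chart_injection_vertical_bundle)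
  show "continuous_map line_topology (btop E) (\<lambda>A. line_at A 0)" by (rule continuous_line_at)
next
  fix c p and w :: "real ^ 'k" assume c: "c \<in> bcover E" and "p \<in> points (cman (bchart Q E c))"
  then have "(p, w) \<in> double_points c" by simp
  then show "line_at (line_class c (p, w)) 0 = cproj (bchart Q E c) p"
    using line_at_line_class[OF c] by (simp add: fibre_line_at_0)
next
  fix c h p assume c: "c \<in> bcover E" and h: "h \<in> carrier (cgrp (bchart Q E c))"
    and p: "p \<in> points (cman (bchart Q E c))"
  have eq: "double_act c h (p, w) = (bact E c h p, snd (bact E c h (fst p, w)))" for w
    using p by (simp add: double_act_def)
  show "fst (double_act c h (p, w)) = cact (bchart Q E c) h p" for w
    by (simp add: eq)
  have "fst p \<in> cpoints Q c" using p by auto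
  then show "linear (\<lambda>w. snd (double_act c h (p, w)))"
    using vector_bundleD(9)[OF vector_bundle c, of h "fst p"] h by (simp add: eq)
next
  fix i assume i: "i \<in> injs_over Q (bcover E)"
  show "smooth_map (cman (bchart Q E (isrc Q i))) euclidean_manifold (\<lambda>p. btrans E i (fst p))"
    using smooth_map_fst_euclidean[OF base_manifold[OF injs_overD(2)[OF i]] vector_bundleD(10)[OF vector_bundle i]]
    by simp
  show "invertible (btrans E i (fst p))" if "p \<in> points (cman (bchart Q E (isrc Q i)))" for p
    using vector_bundleD(11)[OF vector_bundle i, of "fst p"] that by auto
next
  fix i j k p assume ijk: "i \<in> injs_over Q (bcover E)" "j \<in> injs_over Q (bcover E)" "k \<in> injs_over Q (bcover E)"
    and comp: "inj_composite total_space j i k" and p: "p \<in> points (cman (bchart Q E (isrc Q i)))"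
  have "fst p \<in> cpoints Q (isrc Q i)" using p by auto
  moreover have "fst (bemb Q E i p) = iemb Q i (fst p)" by (simp add: bemb_def split_beta)
  ultimately show "btrans E k (fst p) = btrans E j (fst (bemb Q E i p)) ** btrans E i (fst p)"
    using vector_bundleD(13)[OF vector_bundle ijk] comp inj_composite_total_space[OF ijk] by simp
qed

lemma good_vertical_bundle: "good_bundle total_space vertical_bundle"
  unfolding good_bundle_def
proof (intro conjI ballI vector_bundle_vertical_bundle)
  fix A assume "A \<in> topspace (btop vertical_bundle)"
  then have A: "A \<in> topspace line_topology" by simp
  obtain c p where c: "c \<in> bcover E" "p \<in> double_points c" "A = line_class c p"
    by (rule line_topology_cases[OF A]) (rule that)
  then have "A \<in> chart_image (bchart total_space vertical_bundle c)"
    by (simp add: chart_image_def)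
  then show "\<exists>c\<in>bcover vertical_bundle. A \<in> chart_image (bchart total_space vertical_bundle c) \<and>
      act_kernel (bchart total_space vertical_bundle c) = act_kernel (chart total_space c)"
    using c(1) act_kernel_vertical_bundle[OF c(1)]
    by (intro bexI[of _ c]) simp_all
qed

end

section \<open>Restriction to the zero section\<close>

text \<open>
  Transport of structure along a homeomorphism of the underlying spaces. The actions are compared on
  the group only, since their values elsewhere are arbitrary.
\<close>

lemma is_orbichart_homeomorphic:
  assumes C: "is_orbichart X C" and \<Theta>: "homeomorphic_map X Y \<Theta>"
    and same: "cman D = cman C" "cgrp D = cgrp C"
    and act: "\<And>h. h \<in> carrier (cgrp C) \<Longrightarrow> cact D h = cact C h"
    and proj: "\<And>x. x \<in> points (cman C) \<Longrightarrow> cproj D x = \<Theta> (cproj C x)"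
  shows "is_orbichart Y D" "chart_image D = \<Theta> ` chart_image C"
proof -
  note c = is_orbichartD[OF C]
  show im: "chart_image D = \<Theta> ` chart_image C"
    using proj by (auto simp: chart_image_def same image_image)
  have sub: "chart_image C \<subseteq> topspace X" by (rule openin_subset[OF c(7)])
  interpret A: group_action "cgrp C" "points (cman C)" "cact C" by (rule c(5))
  interpret G: group "cgrp C" using A.group_hom group_hom.axioms(1) by blast
  have grp: "group_action (cgrp C) (points (cman C)) (cact D)"
  proof (rule group_actionI[OF G.group_axioms])
    show "cact D h \<in> extensional (points (cman C))" if "h \<in> carrier (cgrp C)" for h
      using A.bij_prop0[OF that] by (simp add: act that Bij_def)
    show "cact D h x \<in> points (cman C)" if "h \<in> carrier (cgrp C)" "x \<in> points (cman C)" for h x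
      using c(10)[OF that] by (simp add: act that)
    show "cact D \<one>\<^bsub>cgrp C\<^esub> x = x" if "x \<in> points (cman C)" for x
      using that by (simp add: act A.id_eq_one[symmetric])
    show "cact D (g \<otimes>\<^bsub>cgrp C\<^esub> h) x = cact D g (cact D h x)"
      if "g \<in> carrier (cgrp C)" "h \<in> carrier (cgrp C)" "x \<in> points (cman C)" for g h x
      using A.composition_rule[OF that(3,1,2)] that by (simp add: act)
  qed
  have quo: "quotient_map (mtop (cman C)) (subtopology Y (\<Theta> ` chart_image C)) (cproj D)"
  proof -
    have "homeomorphic_map (subtopology X (chart_image C)) (subtopology Y (\<Theta> ` chart_image C)) \<Theta>"
    proof (rule homeomorphic_map_subtopologies[OF \<Theta>])
      have "\<Theta> ` chart_image C \<subseteq> topspace Y"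
        using sub homeomorphic_imp_surjective_map[OF \<Theta>] by blast
      then show "\<Theta> ` (topspace X \<inter> chart_image C) = topspace Y \<inter> \<Theta> ` chart_image C"
        using sub by (simp add: Int_absorb1 Int_absorb2)
    qed
    then have "quotient_map (mtop (cman C)) (subtopology Y (\<Theta> ` chart_image C)) (\<Theta> \<circ> cproj C)"
      by (intro quotient_map_compose[OF c(8)]) (simp_all add: homeomorphic_map_def)
    then show ?thesis by (rule quotient_map_eq) (simp add: proj)
  qed
  have op: "openin Y (\<Theta> ` chart_image C)"
    using homeomorphic_map_openness[OF \<Theta> sub] c(7) by simp
  have orb: "cproj D x = cproj D y \<longleftrightarrow> y \<in> orbit (cgrp C) (cact D) x"
    if x: "x \<in> points (cman C)" and y: "y \<in> points (cman C)" for x y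
  proof -
    have "cproj D x = cproj D y \<longleftrightarrow> cproj C x = cproj C y"
      using inj_onD[OF homeomorphic_imp_injective_map[OF \<Theta>]] c(11)[OF x] c(11)[OF y] by (auto simp: proj x y)
    also have "\<dots> \<longleftrightarrow> (\<exists>h\<in>carrier (cgrp C). cact C h x = y)" by (rule c(9)[OF x y])
    also have "\<dots> \<longleftrightarrow> (\<exists>h\<in>carrier (cgrp C). cact D h x = y)" by (simp add: act)
    also have "\<dots> \<longleftrightarrow> y \<in> orbit (cgrp C) (cact D) x" by (auto simp: orbit_def)
    finally show ?thesis .
  qed
  show "is_orbichart Y D"
    unfolding is_orbichart_def im same
    using c(1-4,6) grp quo op orb by (simp add: act)
qed

lemma vector_bundle_homeomorphic:
  assumes vb: "vector_bundle Q E" and \<Theta>: "homeomorphic_map (btop E) (btop F) \<Theta>"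
    and proj: "\<And>e. e \<in> topspace (btop E) \<Longrightarrow> bproj F (\<Theta> e) = bproj E e"
    and cov: "bcover F = bcover E"
    and act: "\<And>c h. c \<in> bcover E \<Longrightarrow> h \<in> carrier (cgroup Q c) \<Longrightarrow> bact F c h = bact E c h"
    and bpi: "\<And>c x v. c \<in> bcover E \<Longrightarrow> x \<in> cpoints Q c \<Longrightarrow> bpi F c (x, v) = \<Theta> (bpi E c (x, v))"
    and trans: "btrans F = btrans E"
  shows "vector_bundle Q F"
proof -
  note E = vector_bundleD[OF vb]
  have top: "topspace (btop F) = \<Theta> ` topspace (btop E)"
    using homeomorphic_imp_surjective_map[OF \<Theta>] by simp
  have emb: "bemb Q F = bemb Q E" by (rule ext) (simp add: bemb_def trans)
  have chart: "is_orbichart (btop F) (bchart Q F c)" "chart_image (bchart Q F c) = \<Theta> ` chart_image (bchart Q E c)"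
    if c: "c \<in> bcover E" for c
    by (rule is_orbichart_homeomorphic[OF E(5)[OF c] \<Theta>]; use c act bpi in force)+
  have Haus: "Hausdorff_space (btop F)"
    using E(3) homeomorphic_map_imp_homeomorphic_space[OF \<Theta>] homeomorphic_Hausdorff_space by blast
  have cont: "continuous_map (btop F) (otop Q) (bproj F)"
  proof -
    have "continuous_map (btop E) (otop Q) (bproj F \<circ> \<Theta>)"
      by (rule continuous_map_eq[OF E(4)]) (simp add: proj)
    then show ?thesis
      using \<Theta> by (intro continuous_compose_quotient_map[of "btop E" "btop F" \<Theta>]) (simp_all add: homeomorphic_map_def)
  qed
  have im: "chart_image (bchart Q F c) = {e \<in> topspace (btop F). bproj F e \<in> chart_image (chart Q c)}"
    if c: "c \<in> bcover E" for c
    unfolding chart(2)[OF c] E(6)[OF c] top using proj by auto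
  have pr: "bproj F (bpi F c (x, v)) = cproj (chart Q c) x" if c: "c \<in> bcover E" and x: "x \<in> cpoints Q c" for c x v
    using is_orbichartD(11)[OF E(5)[OF c], of "(x, v)"] x E(7)[OF c x] by (simp add: bpi[OF c x] proj)
  have ker: "act_kernel (bchart Q F c) = act_kernel (bchart Q E c)" if "c \<in> bcover E" for c
    using act[OF that] by (auto simp: act_kernel_eq)
  have inj: "chart_injection (bchart Q F (isrc Q i)) (bchart Q F (itgt Q i)) (bemb Q F i) (ihom Q i)"
    if i: "i \<in> injs_over Q (bcover E)" for i
  proof -
    note I = chart_injectionD[OF E(12)[OF i]] and c = injs_overD(2,3)[OF i]
    show ?thesis
      unfolding chart_injection_def ker[OF c(1)] ker[OF c(2)] emb
    proof (intro conjI ballI)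
      show "cproj (bchart Q F (itgt Q i)) (bemb Q E i p) = cproj (bchart Q F (isrc Q i)) p"
        if "p \<in> points (cman (bchart Q F (isrc Q i)))" for p
      proof -
        obtain x v where p: "p = (x, v)" "x \<in> cpoints Q (isrc Q i)" using \<open>p \<in> _\<close> by auto
        have "iemb Q i x \<in> cpoints Q (itgt Q i)" using I(8)[of p] p by simp
        then show ?thesis using I(3)[of p] p by (simp add: bpi c)
      qed
      show "bemb Q E i (cact (bchart Q F (isrc Q i)) h p) = cact (bchart Q F (itgt Q i)) (ihom Q i h) (bemb Q E i p)"
        if h: "h \<in> carrier (cgrp (bchart Q F (isrc Q i)))" and "p \<in> points (cman (bchart Q F (isrc Q i)))" for h p
      proof -
        have "ihom Q i h \<in> carrier (cgroup Q (itgt Q i))" using I(4) h by (auto simp: hom_def)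
        then show ?thesis using I(6)[of h p] that by (simp add: act c)
      qed
    qed (use I(1,2,4,5,7) in simp_all)
  qed
  show ?thesis
    unfolding vector_bundle_def cov trans
    using E(1,2,8-11,13) Haus cont chart(1) im pr inj by (simp add: act)
qed

context orbi_bundle
begin

text \<open>
  A point \<open>[x, v]\<close> of \<open>E\<close> determines the radial line \<open>t \<mapsto> [x, t v]\<close>, as the group fixes zero vectors.
\<close>

lemma radial_line_eq_same_chart:
  assumes c: "c \<in> bcover E" and x: "x \<in> cpoints Q c" and y: "y \<in> cpoints Q c"
    and eq: "bpi E c (x, v) = bpi E c (y, w)"
  shows "fibre_line E c ((x, 0), v) = fibre_line E c ((y, 0), w)"
proof -
  obtain h where h: "h \<in> carrier (cgroup Q c)" "bact E c h (x, v) = (y, w)"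
    using bpi_eq_iff[OF c x y] eq by blast
  then have "cact (chart Q c) h x = y" "snd (bact E c h (x, v)) = w"
    using bact_eq[OF c h(1) x, of v] by simp_all
  then have "double_act c h ((x, 0), v) = ((y, 0), w)"
    using double_act_apply[OF c h(1) x] bact_zero[OF c h(1) x] by simp
  then show ?thesis
    using fibre_line_double_act[OF c h(1), of "((x, 0), v)"] x by simp
qed

text \<open>
  For different charts, the line in chart \<open>d\<close> is moved to chart \<open>c\<close>. Its value at \<open>t = 0\<close> lies on the zero
  section, so the result is again a radial line, and its value at \<open>t = 1\<close> is the given point.
\<close>

lemma radial_line_eq:
  assumes c: "c \<in> bcover E" and d: "d \<in> bcover E" and x: "x \<in> cpoints Q c" and y: "y \<in> cpoints Q d"
    and eq: "bpi E c (x, v) = bpi E d (y, w)"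
  shows "fibre_line E c ((x, 0), v) = fibre_line E d ((y, 0), w)"
proof -
  let ?q = "((y, 0), w)"
  have q: "?q \<in> double_points d" using y by simp
  have pr: "cproj (chart Q c) x = cproj (chart Q d) (fst (fst ?q))"
    using cproj_eq_of_bpi_eq[OF c d x y eq] by simp
  obtain i j h r where i: "i \<in> injs_over Q (bcover E)" and j: "j \<in> injs_over Q (bcover E)"
    and ij: "isrc Q i = isrc Q j" "itgt Q i = c" "itgt Q j = d" and r: "r \<in> double_points (isrc Q i)"
    and h: "h \<in> carrier (cgroup Q d)" "double_act d h (double_emb j r) = ?q"
    by (rule common_double_chart[OF c d x q pr]) (rule that)
  have line: "fibre_line E d ?q = fibre_line E c (double_emb i r)"
    using fibre_line_double_act[OF d h(1), of "double_emb j r"] double_emb_in[OF j, of r]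
      fibre_line_double_emb[OF i r] fibre_line_double_emb[OF j, of r] r ij h(2) by simp
  obtain x' u u' where emb: "double_emb i r = ((x', u), u')" and x': "x' \<in> cpoints Q c"
    using double_emb_in[OF i r] ij(2) by auto
  have "bpi E c (x', u) = bpi E d (y, 0)"
    using line fibre_line_at_0[of d ?q] fibre_line_at_0[of c "((x', u), u')"] by (simp add: emb)
  then have u: "u = 0"
    using bpi_in_zero_section_iff[OF c x', of u] bpi_in_zero_section_iff[OF d y, of 0] by simp
  have "fibre_line E d ?q 1 = fibre_line E c ((x', u), u') 1" using line emb by simp
  then have "bpi E c (x, v) = bpi E c (x', u')" using eq by (simp add: fibre_line_def u)
  then have "fibre_line E c ((x, 0), v) = fibre_line E c ((x', 0), u')"
    by (rule radial_line_eq_same_chart[OF c x x'])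
  then show ?thesis using line emb u by simp
qed

text \<open>
  The union is over all expressions of \<open>e\<close> in charts; all the classes in it are equal by the preceding
  lemma, so it is one class.
\<close>

definition radial_line :: "'e \<Rightarrow> ('c \<times> ('v \<times> (real ^ 'k)) \<times> (real ^ 'k)) set" where
  "radial_line e = (\<Union>c\<in>bcover E. \<Union>(x, v)\<in>{p \<in> cpoints Q c \<times> UNIV. bpi E c p = e}. line_class c ((x, 0), v))"

lemma radial_line_bpi:
  assumes c: "c \<in> bcover E" and x: "x \<in> cpoints Q c"
  shows "radial_line (bpi E c (x, v)) = line_class c ((x, 0), v)"
proof (intro equalityI subsetI)
  fix s assume "s \<in> radial_line (bpi E c (x, v))"
  then obtain d y w where d: "d \<in> bcover E" "y \<in> cpoints Q d" "bpi E d (y, w) = bpi E c (x, v)"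
    and s: "s \<in> line_class d ((y, 0), w)" by (auto simp: radial_line_def)
  have "line_class d ((y, 0), w) = line_class c ((x, 0), v)"
    using line_class_eq_iff[OF d(1) _ c] d(2) x radial_line_eq[OF d(1) c d(2) x d(3)] by simp
  then show "s \<in> line_class c ((x, 0), v)" using s by simp
next
  fix s assume "s \<in> line_class c ((x, 0), v)"
  then show "s \<in> radial_line (bpi E c (x, v))" using c x by (auto simp: radial_line_def)
qed

lemma line_at_radial_line:
  assumes c: "c \<in> bcover E" and x: "x \<in> cpoints Q c"
  shows "line_at (radial_line (bpi E c (x, v))) t = bpi E c (x, t *\<^sub>R v)"
  using line_at_line_class[OF c, of "((x, 0), v)"] x
  by (simp add: radial_line_bpi[OF c x] fibre_line_def)

lemma continuous_radial_line: "continuous_map (btop E) line_topology radial_line"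
proof (rule continuous_map_from_quotient_charts[where A = "bcover E"
      and f = "bpi E" and X = "\<lambda>c. prod_topology (mtop (cman (chart Q c))) euclidean"])
  have im: "bpi E c ` topspace (prod_topology (mtop (cman (chart Q c))) euclidean) = chart_image (bchart Q E c)" for c
    by (simp add: chart_image_def)
  show "(\<Union>c\<in>bcover E. bpi E c ` topspace (prod_topology (mtop (cman (chart Q c))) euclidean)) = topspace (btop E)"
    unfolding im using compatible_coverD(2)[OF total_compatible_cover] by simp
  fix c assume c: "c \<in> bcover E"
  show "openin (btop E) (bpi E c ` topspace (prod_topology (mtop (cman (chart Q c))) euclidean))"
    "quotient_map (prod_topology (mtop (cman (chart Q c))) euclidean)
      (subtopology (btop E) (bpi E c ` topspace (prod_topology (mtop (cman (chart Q c))) euclidean))) (bpi E c)"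
    unfolding im using is_orbichartD(7,8)[OF total_chart[OF c]] by simp_all
  let ?z = "\<lambda>p :: 'v \<times> (real ^ 'k). ((fst p, 0 :: real ^ 'k), snd p)"
  have "continuous_map (prod_topology (mtop (cman (chart Q c))) euclidean) (double_top c) ?z"
    by (intro continuous_map_pairedI continuous_map_fst continuous_map_snd) simp
  from continuous_map_compose[OF this continuous_line_class[OF c]]
  show "continuous_map (prod_topology (mtop (cman (chart Q c))) euclidean) line_topology (\<lambda>p. radial_line (bpi E c p))"
    by (rule continuous_map_eq) (auto simp: radial_line_bpi[OF c])
qed

abbreviation restriction :: "(('c \<times> ('v \<times> (real ^ 'k)) \<times> (real ^ 'k)) set, 'q, 'c, 'i, 'v, 'g, 'k) vbundle" where
  "restriction \<equiv> restrict_bundle Q zero_suborbifold vertical_bundle"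

text \<open>
  The inverse is evaluation at \<open>t = 1\<close>: a line in the restriction starts on the zero section, hence it is
  radial and determined by its value there.
\<close>

lemma homeomorphic_radial_line: "homeomorphic_map (btop E) (btop restriction) radial_line"
proof -
  let ?Z = "{A. line_at A 0 \<in> zero_section ` topspace (otop Q)}"
  have btop: "btop restriction = subtopology line_topology ?Z"
    by (simp add: restrict_bundle_def)
  have "homeomorphic_maps (btop E) (subtopology line_topology ?Z) radial_line (\<lambda>A. line_at A 1)"
    unfolding homeomorphic_maps_def
  proof (intro conjI ballI)
    have "radial_line e \<in> ?Z" if "e \<in> topspace (btop E)" for e
      using that
    proof (rule total_cover_cases)
      fix c x v assume c: "c \<in> bcover E" and x: "x \<in> cpoints Q c" and e: "e = bpi E c (x, v)"
      show ?thesis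
        using bpi_in_zero_section_iff[OF c x, of 0] by (simp add: e line_at_radial_line[OF c x])
    qed
    then show "continuous_map (btop E) (subtopology line_topology ?Z) radial_line"
      using continuous_radial_line by (auto simp: continuous_map_in_subtopology)
    show "continuous_map (subtopology line_topology ?Z) (btop E) (\<lambda>A. line_at A 1)"
      by (rule continuous_map_from_subtopology[OF continuous_line_at])
    show "line_at (radial_line e) 1 = e" if "e \<in> topspace (btop E)" for e
      using that by (rule total_cover_cases) (simp add: line_at_radial_line)
    fix A assume "A \<in> topspace (subtopology line_topology ?Z)"
    then have A: "A \<in> topspace line_topology" "line_at A 0 \<in> zero_section ` topspace (otop Q)" by auto
    obtain c p where c: "c \<in> bcover E" and p: "p \<in> double_points c" and Ap: "A = line_class c p"
      by (rule line_topology_cases[OF A(1)]) (rule that)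
    obtain x u v where pp: "p = ((x, u), v)" and x: "x \<in> cpoints Q c" using p by auto
    have "u = 0"
      using A(2) bpi_in_zero_section_iff[OF c x, of u] line_at_line_class[OF c p]
      by (simp add: Ap pp fibre_line_def)
    then show "radial_line (line_at A 1) = A"
      using line_at_line_class[OF c p] by (simp add: Ap pp fibre_line_def radial_line_bpi[OF c x])
  qed
  then show ?thesis unfolding btop homeomorphic_map_maps by blast
qed

lemma vector_bundle_restriction: "vector_bundle Q restriction"
proof (rule vector_bundle_homeomorphic[OF vector_bundle homeomorphic_radial_line])
  have inj: "inj_on zero_section (topspace (otop Q))"
    by (rule inj_on_inverseI[where g = "bproj E"]) (rule bproj_zero_section)
  show "bproj restriction (radial_line e) = bproj E e" if "e \<in> topspace (btop E)" for e
    using that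
  proof (rule total_cover_cases)
    fix c x v assume c: "c \<in> bcover E" and x: "x \<in> cpoints Q c" and e: "e = bpi E c (x, v)"
    have "bproj restriction (radial_line e) = inv_into (topspace (otop Q)) zero_section (bpi E c (x, 0))"
      by (simp add: restrict_bundle_def e line_at_radial_line[OF c x])
    also have "bpi E c (x, 0) = zero_section (cproj (chart Q c) x)"
      by (rule zero_section_cproj[OF c x, symmetric])
    also have "inv_into (topspace (otop Q)) zero_section \<dots> = cproj (chart Q c) x"
      by (rule inv_into_f_f[OF inj is_orbichartD(11)[OF base_chart[OF c] x]])
    also have "\<dots> = bproj E e"
      using vector_bundleD(7)[OF vector_bundle c x] by (simp add: e)
    finally show ?thesis .
  qed
  show "bcover restriction = bcover E" by (simp add: restrict_bundle_def)
  show "bact restriction c h = bact E c h" if c: "c \<in> bcover E" and h: "h \<in> carrier (cgroup Q c)" for c h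
  proof (rule extensionalityI)
    show "bact E c h \<in> extensional (cpoints Q c \<times> UNIV)"
      using group_action.bij_prop0[OF total_action[OF c] h] by (rule Bij_imp_extensional)
    show "bact restriction c h \<in> extensional (cpoints Q c \<times> UNIV)"
      by (simp add: restrict_bundle_def)
    fix p assume "p \<in> cpoints Q c \<times> (UNIV :: (real ^ 'k) set)"
    then obtain x v where p: "p = (x, v)" and x: "x \<in> cpoints Q c" by auto
    have "bact restriction c h p = (cact (chart Q c) h x, snd (double_act c h ((x, 0), v)))"
      using x by (simp add: restrict_bundle_def p)
    then show "bact restriction c h p = bact E c h p"
      using double_act_apply[OF c h x] bact_eq[OF c h x, of v] by (simp add: p)
  qed
  show "bpi restriction c (x, v) = radial_line (bpi E c (x, v))" if "c \<in> bcover E" "x \<in> cpoints Q c" for c x v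
    using radial_line_bpi[OF that] by (simp add: restrict_bundle_def)
  show "btrans restriction = btrans E"
    by (simp add: restrict_bundle_def fun_eq_iff)
qed

text \<open>
  The group elements act on the restricted bundle as on \<open>E\<close>, and the transition maps are those of \<open>E\<close>;
  hence the identity matrices form an isomorphism.
\<close>

lemma isomorphic_restriction: "isomorphic_bundles Q E restriction"
proof -
  have res: "bcover restriction = bcover E" "btrans restriction = btrans E"
    by (simp_all add: restrict_bundle_def fun_eq_iff)
  have act: "snd (bact restriction c h (x, v)) = snd (bact E c h (x, v))"
    if "c \<in> bcover E" "h \<in> carrier (cgroup Q c)" "x \<in> cpoints Q c" for c h x v
    using double_act_apply[OF that] that(3) by (simp add: restrict_bundle_def)
  show ?thesis
    unfolding isomorphic_bundles_def
  proof (intro conjI vector_bundle vector_bundle_restriction exI[of _ "bcover E"]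
      exI[of _ "\<lambda>c x. mat 1 :: real ^ 'k ^ 'k"] ballI allI)
    show "smooth_map (cman (chart Q c)) euclidean_manifold (\<lambda>x. mat 1 :: real ^ 'k ^ 'k)" if "c \<in> bcover E" for c
      by (rule smooth_map_const[OF base_manifold[OF that]])
    show "invertible (mat 1 :: real ^ 'k ^ 'k)" by (auto simp: invertible_def intro: exI[of _ "mat 1"])
  qed (use cover act in \<open>simp_all add: res\<close>)
qed

end

theorem theorem1:
  fixes Q :: "('q, 'c, 'i, 'v, 'm::{real_normed_vector, heine_borel}, 'g) orbifold"
    and E :: "('e, 'q, 'c, 'i, 'v, 'g, 'k::finite) vbundle"
  assumes "is_orbifold Q" and "bad_bundle Q E"
  shows "\<exists>(R :: ('e, 'c, 'i, 'v \<times> (real ^ 'k), 'm \<times> (real ^ 'k), 'g) orbifold)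
          (S :: ('q, 'c, 'i, 'v, 'e, 'c, 'i, 'v \<times> (real ^ 'k)) suborb)
          (F :: (('c \<times> ('v \<times> (real ^ 'k)) \<times> (real ^ 'k)) set, 'e, 'c, 'i, 'v \<times> (real ^ 'k), 'g, 'k) vbundle).
          is_orbifold R \<and> is_suborbifold Q R S \<and> good_bundle R F \<and>
          isomorphic_bundles Q E (restrict_bundle Q S F)"
proof -
  interpret orbi_bundle Q E
    using assms(2) by unfold_locales (simp add: bad_bundle_def)
  show ?thesis
    using is_orbifold_total_space is_suborbifold_zero_suborbifold good_vertical_bundle isomorphic_restriction
    by blast
qed

end
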